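(* Consider $\min_{x\in\mathbb R^d} F(x)=f(x)+r(x)$, $f=\frac1n\sum_{i=1}^n f_i$, and the algorithms MM-SAGA, MM-SVRG, MM-SARAH described in the context. Suppose that: (A1) $F^*=\inf_{x\in\mathbb R^d}F(x)>-\infty$ and $\operatorname{dom}F=\operatorname{dom}f\cap\operatorname{dom}r\neq\emptyset$; each $f_i$ is continuously differentiable and $L>0$ is a constant with $\frac1n\sum_{i=1}^n\|\nabla f_i(x)-\nabla f_i(y)\|^2\le L^2\|x-y\|^2$ for all $x,y\in\operatorname{dom}f$. (A2) The surrogate $u$ of $r$ satisfies: for every $x$, $u(x,\cdot)$ is continuous; for every $y$, $u(\cdot,y)$ is lower semicontinuous and convex; and there exists a function $\bar h:\mathbb R^d\times\mathbb R^d\to\mathbb R\cup\{+\infty\}$ such that for every $y\in\mathbb R^d$, $\bar h(\cdot,y)$ is continuously differentiable at $y$ with $\nabla\bar h(\cdot,y)(y)=0$, and $u(\cdot,y)-r(\cdot)\le\bar h(\cdot,y)$. (A3) For any bounded subset $\Omega$ of $\mathbb R^d$ there exists a constant $L_u$ such that for any $x,y\in\Omega$ and any $\nu\in\partial u(\cdot,y)(x)$ there exists $\zeta\in\partial r(x)$ with $\|\nu-\zeta\|\le L_u\|x-y\|$. Then the complexity of obtaining an $\epsilon$-stationary point (in expectation), measured by the number of individual gradient evaluations $\nabla f_i$, is as follows: (a) For MM-SAGA with $\mu=L$ and $b=\lfloor 4^{2/3}n^{2/3}\rfloor$, the complexity is $\mathcal O(n^{2/3}/\epsilon^2)$. (b)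 For MM-SVRG with $\mu=L$, $b=\lfloor n^{2/3}\rfloor$ and $m=\lfloor\sqrt b/4\rfloor$ (that is, $m\approx n^{1/3}/4$), the complexity is $\mathcal O(n^{2/3}/\epsilon^2)$. (c) For MM-SARAH with $\mu=L$, $b=\lfloor n^{1/2}\rfloor$ and $m=\lfloor b/4\rfloor$ (that is, $m\approx n^{1/2}/4$), the complexity is $\mathcal O(n^{1/2}/\epsilon^2)$.
   Context: Setting. $r:\mathbb R^d\to\mathbb R\cup\{+\infty\}$ is proper and lower semicontinuous (possibly nonconvex, nonsmooth), $f_i:\mathbb R^d\to\mathbb R$ ($i=1,\dots,n$) are differentiable (possibly nonconvex), $f=\frac1n\sum_{i=1}^nf_i$, $F=f+r$. $\operatorname{dom}g=\{x: g(x)<+\infty\}$, $[n]=\{1,\dots,n\}$, $\operatorname{dist}(x,\mathcal C)=\inf_{y\in\mathcal C}\|x-y\|$. Subdifferential. For $x\in\operatorname{dom}g$, the Fréchet subdifferential $\hat\partial g(x)$ is the set of $v$ with $\liminf_{y\to x,\,y\ne x}\frac{g(y)-g(x)-\langle v,y-x\rangle}{\|y-x\|}\ge0$ (it is empty if $x\notin\operatorname{dom}g$); the limiting subdifferential is $\partial g(x)=\{v:\exists x^k\to x,\ g(x^k)\to g(x),\ v^k\in\hat\partial g(x^k),\ v^k\to v\}$. $\partial u(\cdot,y)(x)$ denotes the subdifferential of $u(\cdot,y)$ at $x$. A point $x^*$ is an $\epsilon$-stationary point of $g$ if $\operatorname{dist}(0,\partial g(x^* ))\le\epsilon$. Surrogate.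 $u:\mathbb R^d\times\mathbb R^d\to\mathbb R\cup\{+\infty\}$ is a surrogate of $r$ if $u(y,y)=r(y)$ for all $y$ and $u(x,y)\ge r(x)$ for all $x,y$. Algorithms. Inputs: $x^0\in\mathbb R^d$, $\mu>L/2$, a batch size $b$ (positive integer), a surrogate $u$ of $r$ and, for MM-SVRG and MM-SARAH, a positive integer $m$ (so $n$ is large enough that the stated $m$ is at least $1$). At each iteration $k=0,1,2,\dots$ draw a random batch $I_k=(i_1,\dots,i_b)$, a list of $b$ (possibly repeated) indices, each chosen independently and uniformly at random from $[n]$ (sums over $I_k$ count repetitions), form an estimator $\widetilde\nabla f(x^k)$ and set $$x^{k+1}=\operatorname{argmin}_{x\in\mathbb R^d}\ \tfrac\mu2\|x-x^k\|^2+\langle\widetilde\nabla f(x^k),x\rangle+u(x,x^k).$$ The estimators are: - MM-SAGA: $\widetilde\nabla f(x^k)=\frac1b\sum_{i\in I_k}\big(\nabla f_i(x^k)-\nabla f_i(x_i^{k-1})\big)+\frac1n\sum_{i=1}^n\nabla f_i(x_i^{k-1})$, where $x_i^{-1}=x^0$ for all $i$, and $x_i^k=x^k$ if $i\in I_k$, $x_i^k=x_i^{k-1}$ otherwise; the gradients $\nabla f_i(x_i^{k-1})$ are stored, so they are not re-evaluated. - MM-SVRG: $\widetilde\nabla f(x^k)=\frac1b\sum_{i\in I_k}\big(\nabla f_i(x^k)-\nabla f_i(\tilde x^k)\big)+\nabla f(\tilde x^k)$, where $\tilde x^{-1}=x^0$ and $\tilde x^k=x^k$ with probability $1/m$, $\tilde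 x^k=\tilde x^{k-1}$ otherwise; $\nabla f(\tilde x^k)$ is recomputed only when $\tilde x^k$ changes. - MM-SARAH: with $x^{-1}=x^0$ and $\widetilde\nabla f(x^{-1})=\nabla f(x^0)$, $\widetilde\nabla f(x^k)=\nabla f(x^k)$ with probability $1/m$, and $\widetilde\nabla f(x^k)=\frac1b\sum_{i\in I_k}\big(\nabla f_i(x^k)-\nabla f_i(x^{k-1})\big)+\widetilde\nabla f(x^{k-1})$ otherwise. The probability-$1/m$ choices are independent of the batches and of the past. Complexity. The complexity of obtaining an $\epsilon$-stationary point is the expected total number of evaluations of individual gradients $\nabla f_i$ over the first $K$ iterations, where $K$ is the smallest integer with $\min_{1\le k\le K}\mathbb E\,\operatorname{dist}^2(0,\partial F(x^k))\le\epsilon^2$. The constant hidden in $\mathcal O$ may depend on $L$, on $F(x^0)-F^*$ and on the constant $L_u$ of (A3) for a bounded set containing the iterates, but not on $n$ or $\epsilon$. *)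

theory Defs
  imports "HOL-Analysis.Analysis" "HOL-Probability.Probability"
begin

section \<open>Gradients and subdifferentials\<close>

definition gradient :: "('a::real_inner \<Rightarrow> real) \<Rightarrow> 'a \<Rightarrow> 'a" where
  "gradient f x = (THE D. GDERIV f x :> D)"

text \<open>Functions into \<open>\<real> \<union> {+\<infinity>}\<close> are \<^typ>\<open>ereal\<close>-valued functions that never take the value \<open>-\<infinity>\<close>;
  all extended-valued functions below are subject to an explicit assumption of this kind.\<close>

definition frechet_subdiff :: "('a::real_inner \<Rightarrow> ereal) \<Rightarrow> 'a \<Rightarrow> 'a set" where
  "frechet_subdiff g x = {v. g x < \<infinity> \<and>
     0 \<le> Liminf (at x) (\<lambda>y. (g y - g x - ereal (v \<bullet> (y - x))) / ereal (norm (y - x)))}"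

definition limiting_subdiff :: "('a::real_inner \<Rightarrow> ereal) \<Rightarrow> 'a \<Rightarrow> 'a set" where
  "limiting_subdiff g x = {v. g x < \<infinity> \<and>
     (\<exists>X V. X \<longlonglongrightarrow> x \<and> (\<lambda>k. g (X k)) \<longlonglongrightarrow> g x \<and>
            (\<forall>k. V k \<in> frechet_subdiff g (X k)) \<and> V \<longlonglongrightarrow> v)}"

text \<open>\<open>dist(0, C)\<close>, with value \<open>\<infinity>\<close> for empty \<open>C\<close> (whereas \<^const>\<open>infdist\<close> would give \<open>0\<close>).\<close>

definition dist_zero :: "'a::real_normed_vector set \<Rightarrow> ennreal" where
  "dist_zero C = (INF y\<in>C. ennreal (norm y))"

definition lower_semicont :: "('a::topological_space \<Rightarrow> ereal) \<Rightarrow> bool" where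
  "lower_semicont g \<longleftrightarrow> (\<forall>x. g x \<le> Liminf (at x) g)"

definition ext_convex :: "('a::real_vector \<Rightarrow> ereal) \<Rightarrow> bool" where
  "ext_convex g \<longleftrightarrow> (\<forall>x y. \<forall>t::real. 0 < t \<and> t < 1 \<longrightarrow>
     g ((1 - t) *\<^sub>R x + t *\<^sub>R y) \<le> ereal (1 - t) * g x + ereal t * g y)"


section \<open>The optimization problem\<close>

definition finite_avg :: "nat \<Rightarrow> (nat \<Rightarrow> 'a \<Rightarrow> real) \<Rightarrow> 'a \<Rightarrow> real" where
  "finite_avg n f x = (\<Sum>i=1..n. f i x) / real n"

definition objective :: "nat \<Rightarrow> (nat \<Rightarrow> 'a \<Rightarrow> real) \<Rightarrow> ('a \<Rightarrow> ereal) \<Rightarrow> 'a \<Rightarrow> ereal" where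
  "objective n f r x = ereal (finite_avg n f x) + r x"

definition surrogate :: "('a \<Rightarrow> 'a \<Rightarrow> ereal) \<Rightarrow> ('a \<Rightarrow> ereal) \<Rightarrow> bool" where
  "surrogate u r \<longleftrightarrow> (\<forall>x y. u x y \<noteq> -\<infinity>) \<and> (\<forall>y. u y y = r y) \<and> (\<forall>x y. r x \<le> u x y)"

text \<open>Since every \<open>f i\<close> is real-valued, \<open>dom f\<close> is the whole space and \<open>dom F = dom f \<inter> dom r = dom r\<close>.\<close>

definition assumption_A1 ::
  "nat \<Rightarrow> (nat \<Rightarrow> 'a::euclidean_space \<Rightarrow> real) \<Rightarrow> ('a \<Rightarrow> ereal) \<Rightarrow> real \<Rightarrow> bool" where
  "assumption_A1 n f r L \<longleftrightarrow>
     (INF x. objective n f r x) > -\<infinity> \<and>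
     (\<exists>x. objective n f r x < \<infinity>) \<and>
     (\<forall>i\<in>{1..n}. (\<forall>x. f i differentiable (at x)) \<and> continuous_on UNIV (gradient (f i))) \<and>
     0 < L \<and>
     (\<forall>x y. (\<Sum>i=1..n. (norm (gradient (f i) x - gradient (f i) y))\<^sup>2) / real n
              \<le> L\<^sup>2 * (norm (x - y))\<^sup>2)"

text \<open>An \<open>\<real> \<union> {+\<infinity>}\<close>-valued function is continuously differentiable at \<open>y\<close> if it is finite and
  differentiable near \<open>y\<close> and its gradient is continuous at \<open>y\<close>.\<close>

definition cont_diff_at :: "('a::real_inner \<Rightarrow> ereal) \<Rightarrow> 'a \<Rightarrow> bool" where
  "cont_diff_at h y \<longleftrightarrow>
     (\<exists>N. open N \<and> y \<in> N \<and>
        (\<forall>x\<in>N. \<bar>h x\<bar> \<noteq> \<infinity> \<and> (\<lambda>z. real_of_ereal (h z)) differentiable (at x))) \<and>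
     isCont (gradient (\<lambda>z. real_of_ereal (h z))) y"

text \<open>The inequality \<open>u(\<cdot>,y) - r \<le> h(\<cdot>,y)\<close> is imposed on \<open>dom r\<close>, the only place where its left-hand
  side is meaningful: off \<open>dom r\<close> it reads \<open>\<infinity> - \<infinity>\<close>, which \<^typ>\<open>ereal\<close> evaluates to \<open>\<infinity>\<close>.\<close>

definition assumption_A2 :: "('a::euclidean_space \<Rightarrow> ereal) \<Rightarrow> ('a \<Rightarrow> 'a \<Rightarrow> ereal) \<Rightarrow> bool" where
  "assumption_A2 r u \<longleftrightarrow>
     (\<forall>x. continuous_on UNIV (\<lambda>y. u x y)) \<and>
     (\<forall>y. lower_semicont (\<lambda>x. u x y) \<and> ext_convex (\<lambda>x. u x y)) \<and>
     (\<exists>h :: 'a \<Rightarrow> 'a \<Rightarrow> ereal.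
        (\<forall>x y. h x y \<noteq> -\<infinity>) \<and>
        (\<forall>y. cont_diff_at (\<lambda>x. h x y) y \<and>
             gradient (\<lambda>x. real_of_ereal (h x y)) y = 0 \<and>
             (\<forall>x. r x < \<infinity> \<longrightarrow> u x y - r x \<le> h x y)))"

definition subdiff_constant_on ::
  "('a::euclidean_space \<Rightarrow> ereal) \<Rightarrow> ('a \<Rightarrow> 'a \<Rightarrow> ereal) \<Rightarrow> 'a set \<Rightarrow> real \<Rightarrow> bool" where
  "subdiff_constant_on r u \<Omega> Lu \<longleftrightarrow>
     (\<forall>x\<in>\<Omega>. \<forall>y\<in>\<Omega>. \<forall>\<nu>\<in>limiting_subdiff (\<lambda>z. u z y) x.
        \<exists>\<zeta>\<in>limiting_subdiff r x. norm (\<nu> - \<zeta>) \<le> Lu * norm (x - y))"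

definition assumption_A3 :: "('a::euclidean_space \<Rightarrow> ereal) \<Rightarrow> ('a \<Rightarrow> 'a \<Rightarrow> ereal) \<Rightarrow> bool" where
  "assumption_A3 r u \<longleftrightarrow> (\<forall>\<Omega>. bounded \<Omega> \<longrightarrow> (\<exists>Lu. subdiff_constant_on r u \<Omega> Lu))"

definition mm_setting ::
  "nat \<Rightarrow> (nat \<Rightarrow> 'a::euclidean_space \<Rightarrow> real) \<Rightarrow> ('a \<Rightarrow> ereal) \<Rightarrow> ('a \<Rightarrow> 'a \<Rightarrow> ereal) \<Rightarrow> real \<Rightarrow> bool" where
  "mm_setting n f r u L \<longleftrightarrow>
     1 \<le> n \<and>
     (\<forall>x. r x \<noteq> -\<infinity>) \<and> (\<exists>x. r x < \<infinity>) \<and> lower_semicont r \<and>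
     surrogate u r \<and>
     assumption_A1 n f r L \<and> assumption_A2 r u \<and> assumption_A3 r u"

text \<open>The initial gap \<open>F(x\<^sup>0) - F\<^sup>*\<close>.\<close>

definition initial_gap :: "nat \<Rightarrow> (nat \<Rightarrow> 'a \<Rightarrow> real) \<Rightarrow> ('a \<Rightarrow> ereal) \<Rightarrow> 'a \<Rightarrow> real" where
  "initial_gap n f r x0 = real_of_ereal (objective n f r x0 - (INF x. objective n f r x))"


section \<open>The algorithms\<close>

text \<open>Each algorithm is a Markov chain of probability mass functions. The last component of a state
  counts the individual gradient evaluations made so far by the iterations; the preliminary
  evaluation of the \<open>n\<close> gradients at \<open>x\<^sup>0\<close> is not included and is added separately where needed.\<close>

definition batch_pmf :: "nat \<Rightarrow> nat \<Rightarrow> nat list pmf" where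
  "batch_pmf n b = replicate_pmf b (pmf_of_set {1..n})"

definition mm_update ::
  "('a::euclidean_space \<Rightarrow> 'a \<Rightarrow> ereal) \<Rightarrow> real \<Rightarrow> 'a \<Rightarrow> 'a \<Rightarrow> 'a" where
  "mm_update u \<mu> x g =
     (ARG_MIN (\<lambda>z. ereal (\<mu> / 2 * (norm (z - x))\<^sup>2 + g \<bullet> z) + u z x) z. True)"

text \<open>MM-SAGA: at the start of iteration \<open>k\<close> the state is \<open>(x\<^sup>k, (x\<^sub>i\<^sup>k\<^sup>-\<^sup>1)\<^sub>i, count)\<close>. The
  gradients at the points \<open>w i\<close> are stored, so an iteration costs \<open>b\<close> evaluations.\<close>

definition saga_step ::
  "nat \<Rightarrow> (nat \<Rightarrow> 'a::euclidean_space \<Rightarrow> real) \<Rightarrow> ('a \<Rightarrow> 'a \<Rightarrow> ereal) \<Rightarrow> real \<Rightarrow> nat \<Rightarrow>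
   'a \<times> (nat \<Rightarrow> 'a) \<times> nat \<Rightarrow> ('a \<times> (nat \<Rightarrow> 'a) \<times> nat) pmf" where
  "saga_step n f u \<mu> b = (\<lambda>(x, w, c). do {
     I \<leftarrow> batch_pmf n b;
     let g = (1 / real b) *\<^sub>R (\<Sum>i\<leftarrow>I. gradient (f i) x - gradient (f i) (w i))
             + (1 / real n) *\<^sub>R (\<Sum>i=1..n. gradient (f i) (w i));
     return_pmf (mm_update u \<mu> x g, (\<lambda>i. if i \<in> set I then x else w i), c + b)
   })"

primrec mm_saga ::
  "nat \<Rightarrow> (nat \<Rightarrow> 'a::euclidean_space \<Rightarrow> real) \<Rightarrow> ('a \<Rightarrow> 'a \<Rightarrow> ereal) \<Rightarrow> real \<Rightarrow> nat \<Rightarrow> 'a \<Rightarrow>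
   nat \<Rightarrow> ('a \<times> (nat \<Rightarrow> 'a) \<times> nat) pmf" where
  "mm_saga n f u \<mu> b x0 0 = return_pmf (x0, (\<lambda>i. x0), 0)"
| "mm_saga n f u \<mu> b x0 (Suc k) = mm_saga n f u \<mu> b x0 k \<bind> saga_step n f u \<mu> b"

text \<open>MM-SVRG: the state is \<open>(x\<^sup>k, y, count)\<close>, where \<open>y\<close> is the reference point of iteration \<open>k-1\<close>.
  An iteration costs \<open>2b\<close> evaluations, and \<open>n\<close> more if the reference point is renewed.\<close>

definition svrg_step ::
  "nat \<Rightarrow> (nat \<Rightarrow> 'a::euclidean_space \<Rightarrow> real) \<Rightarrow> ('a \<Rightarrow> 'a \<Rightarrow> ereal) \<Rightarrow> real \<Rightarrow> nat \<Rightarrow> nat \<Rightarrow>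
   'a \<times> 'a \<times> nat \<Rightarrow> ('a \<times> 'a \<times> nat) pmf" where
  "svrg_step n f u \<mu> b m = (\<lambda>(x, y, c). do {
     I \<leftarrow> batch_pmf n b;
     renew \<leftarrow> bernoulli_pmf (1 / real m);
     let y' = (if renew then x else y);
     let g = (1 / real b) *\<^sub>R (\<Sum>i\<leftarrow>I. gradient (f i) x - gradient (f i) y')
             + gradient (finite_avg n f) y';
     return_pmf (mm_update u \<mu> x g, y', c + 2 * b + (if renew then n else 0))
   })"

primrec mm_svrg ::
  "nat \<Rightarrow> (nat \<Rightarrow> 'a::euclidean_space \<Rightarrow> real) \<Rightarrow> ('a \<Rightarrow> 'a \<Rightarrow> ereal) \<Rightarrow> real \<Rightarrow> nat \<Rightarrow> nat \<Rightarrow> 'a \<Rightarrow>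
   nat \<Rightarrow> ('a \<times> 'a \<times> nat) pmf" where
  "mm_svrg n f u \<mu> b m x0 0 = return_pmf (x0, x0, 0)"
| "mm_svrg n f u \<mu> b m x0 (Suc k) = mm_svrg n f u \<mu> b m x0 k \<bind> svrg_step n f u \<mu> b m"

text \<open>MM-SARAH: the state is \<open>(x\<^sup>k, x\<^sup>k\<^sup>-\<^sup>1, g, count)\<close>, where \<open>g\<close> is the estimator of iteration
  \<open>k-1\<close>. An iteration costs \<open>n\<close> evaluations if the estimator is reset, and \<open>2b\<close> otherwise.\<close>

definition sarah_step ::
  "nat \<Rightarrow> (nat \<Rightarrow> 'a::euclidean_space \<Rightarrow> real) \<Rightarrow> ('a \<Rightarrow> 'a \<Rightarrow> ereal) \<Rightarrow> real \<Rightarrow> nat \<Rightarrow> nat \<Rightarrow>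
   'a \<times> 'a \<times> 'a \<times> nat \<Rightarrow> ('a \<times> 'a \<times> 'a \<times> nat) pmf" where
  "sarah_step n f u \<mu> b m = (\<lambda>(x, xp, g, c). do {
     I \<leftarrow> batch_pmf n b;
     reset \<leftarrow> bernoulli_pmf (1 / real m);
     let g' = (if reset then gradient (finite_avg n f) x
               else (1 / real b) *\<^sub>R (\<Sum>i\<leftarrow>I. gradient (f i) x - gradient (f i) xp) + g);
     return_pmf (mm_update u \<mu> x g', x, g', c + (if reset then n else 2 * b))
   })"

primrec mm_sarah ::
  "nat \<Rightarrow> (nat \<Rightarrow> 'a::euclidean_space \<Rightarrow> real) \<Rightarrow> ('a \<Rightarrow> 'a \<Rightarrow> ereal) \<Rightarrow> real \<Rightarrow> nat \<Rightarrow> nat \<Rightarrow> 'a \<Rightarrow>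
   nat \<Rightarrow> ('a \<times> 'a \<times> 'a \<times> nat) pmf" where
  "mm_sarah n f u \<mu> b m x0 0 = return_pmf (x0, x0, gradient (finite_avg n f) x0, 0)"
| "mm_sarah n f u \<mu> b m x0 (Suc k) = mm_sarah n f u \<mu> b m x0 k \<bind> sarah_step n f u \<mu> b m"


section \<open>Complexity\<close>

text \<open>In this section \<open>P k\<close> is the joint law of \<open>x\<^sup>k\<close> and of the number of individual gradient
  evaluations made by the first \<open>k\<close> iterations.\<close>

definition expected_dist_sq ::
  "('a::real_inner \<Rightarrow> ereal) \<Rightarrow> (nat \<Rightarrow> ('a \<times> nat) pmf) \<Rightarrow> nat \<Rightarrow> ennreal" where
  "expected_dist_sq F P k =
     (\<integral>\<^sup>+(x, c). (dist_zero (limiting_subdiff F x))\<^sup>2 \<partial>measure_pmf (P k))"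

definition stationary_by ::
  "('a::real_inner \<Rightarrow> ereal) \<Rightarrow> (nat \<Rightarrow> ('a \<times> nat) pmf) \<Rightarrow> real \<Rightarrow> nat \<Rightarrow> bool" where
  "stationary_by F P \<epsilon> K \<longleftrightarrow>
     1 \<le> K \<and> (MIN k\<in>{1..K}. expected_dist_sq F P k) \<le> ennreal (\<epsilon>\<^sup>2)"

definition complexity ::
  "('a::real_inner \<Rightarrow> ereal) \<Rightarrow> (nat \<Rightarrow> ('a \<times> nat) pmf) \<Rightarrow> real \<Rightarrow> ennreal" where
  "complexity F P \<epsilon> =
     (if \<exists>K. stationary_by F P \<epsilon> K
      then \<integral>\<^sup>+(x, c). of_nat c \<partial>measure_pmf (P (LEAST K. stationary_by F P \<epsilon> K))
      else \<infinity>)"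

text \<open>\<open>\<Omega>\<close> contains all possible values of the iterates \<open>x\<^sup>0, \<dots>, x\<^sup>K\<close>, where \<open>K\<close> is the number of
  iterations in the definition of complexity (and of all iterates if there is no such \<open>K\<close>).\<close>

definition iterates_in ::
  "('a::real_inner \<Rightarrow> ereal) \<Rightarrow> (nat \<Rightarrow> ('a \<times> nat) pmf) \<Rightarrow> real \<Rightarrow> 'a set \<Rightarrow> bool" where
  "iterates_in F P \<epsilon> \<Omega> \<longleftrightarrow>
     (\<forall>k. (\<forall>K<k. \<not> stationary_by F P \<epsilon> K) \<longrightarrow> fst ` set_pmf (P k) \<subseteq> \<Omega>)"

text \<open>The complexity is \<open>\<O>(\<phi> n / \<epsilon>\<^sup>2)\<close>, with a hidden constant that depends only on \<open>L\<close>, the initial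
  gap and a constant \<open>Lu\<close> valid on a bounded set containing the iterates. The argument \<open>alg\<close> gives
  the law \<open>P\<close> as a function of \<open>n\<close>, \<open>f\<close>, \<open>u\<close>, \<open>L\<close> and \<open>x\<^sup>0\<close>; \<open>adm n\<close> says that the parameters
  prescribed for \<open>n\<close> are admissible. The last conjunct also counts the \<open>n\<close> preliminary evaluations
  at \<open>x\<^sup>0\<close>; a bound \<open>\<O>(\<phi> n / \<epsilon>\<^sup>2)\<close> is then only possible where \<open>\<phi> n / \<epsilon>\<^sup>2\<close> is of order at least \<open>n\<close>,
  which for fixed \<open>n\<close> holds for all small \<open>\<epsilon>\<close>.\<close>

definition complexity_bigo ::
  "(nat \<Rightarrow> (nat \<Rightarrow> 'a::euclidean_space \<Rightarrow> real) \<Rightarrow> ('a \<Rightarrow> 'a \<Rightarrow> ereal) \<Rightarrow> real \<Rightarrow> 'a \<Rightarrow> nat \<Rightarrow>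
    ('a \<times> nat) pmf) \<Rightarrow> (nat \<Rightarrow> bool) \<Rightarrow> (nat \<Rightarrow> real) \<Rightarrow> bool" where
  "complexity_bigo alg adm \<phi> \<longleftrightarrow>
     (\<exists>C :: real \<Rightarrow> real \<Rightarrow> real \<Rightarrow> real.
        \<forall>n f r u L x0 \<epsilon> \<Omega> Lu.
          let F = objective n f r;
              P = alg n f u L x0;
              bound = ennreal (C L (initial_gap n f r x0) Lu * \<phi> n / \<epsilon>\<^sup>2)
          in mm_setting n f r u L \<and> adm n \<and> F x0 < \<infinity> \<and> 0 < \<epsilon> \<and> \<epsilon> \<le> 1 \<and>
             bounded \<Omega> \<and> iterates_in F P \<epsilon> \<Omega> \<and> subdiff_constant_on r u \<Omega> Lu \<longrightarrow>
             complexity F P \<epsilon> \<le> bound \<and>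
             (real n \<le> \<phi> n / \<epsilon>\<^sup>2 \<longrightarrow> of_nat n + complexity F P \<epsilon> \<le> bound))"


section \<open>Parameter choices\<close>

definition saga_batch :: "nat \<Rightarrow> nat" where
  "saga_batch n = nat \<lfloor>4 powr (2/3) * real n powr (2/3)\<rfloor>"

definition svrg_batch :: "nat \<Rightarrow> nat" where
  "svrg_batch n = nat \<lfloor>real n powr (2/3)\<rfloor>"

definition svrg_period :: "nat \<Rightarrow> nat" where
  "svrg_period n = nat \<lfloor>sqrt (real (svrg_batch n)) / 4\<rfloor>"

definition sarah_batch :: "nat \<Rightarrow> nat" where
  "sarah_batch n = nat \<lfloor>real n powr (1/2)\<rfloor>"

definition sarah_period :: "nat \<Rightarrow> nat" where
  "sarah_period n = nat \<lfloor>real (sarah_batch n) / 4\<rfloor>"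

end

theory Submission
  imports Defs
begin

text \<open>Each algorithm decreases a potential \<open>F(x) - F\<^sup>* + (weight) \<times> (measure of staleness)\<close> in
  expectation, by a fixed fraction of \<open>L \<parallel>x\<^sup>k\<^sup>+\<^sup>1 - x\<^sup>k\<parallel>\<^sup>2 + \<parallel>e\<^sup>k\<parallel>\<^sup>2/L\<close>, where \<open>e\<^sup>k\<close> is the error of the
  gradient estimator. That quantity also bounds the squared distance to stationarity of
  \<open>x\<^sup>k\<^sup>+\<^sup>1\<close> (\<open>update_dist_stationary\<close>): optimality in the subproblem gives a subgradient of the
  surrogate, the third assumption turns it into one of \<open>r\<close>, and the smooth part is added by the sum
  rule. Hence the expected squared distances have a sum bounded by a multiple of the initial gap, the
  number of iterations is \<open>O(1/\<epsilon>\<^sup>2)\<close> with a constant free of \<open>n\<close>, and the complexity follows from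
  the expected cost of one iteration.

  The prescribed parameters leave little room, so the decrease has to be estimated sharply. For SAGA
  and SVRG the estimator is unbiased: in the descent inequality the error is paired only with the
  random part of the step, and since the subproblem is \<open>L\<close>-strongly convex this part is at most
  \<open>\<parallel>e\<^sup>k\<parallel>/L\<close> long (\<open>update_lipschitz\<close>, \<open>unbiased_step\<close>). This charges \<open>\<parallel>e\<^sup>k\<parallel>\<^sup>2/L\<close> and leaves all of
  the descent \<open>L/2 \<parallel>x\<^sup>k\<^sup>+\<^sup>1 - x\<^sup>k\<parallel>\<^sup>2\<close>, whereas Young's inequality at the same charge would spend half
  of it. If, apart from the drift caused by the step, the staleness contracts by a factor \<open>t\<^sup>2\<close> per
  iteration, the potential decreases as soon as \<open>b (1 - t)\<^sup>2\<close> exceeds \<open>2\<close>.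

  For SARAH, where the error accumulates, and for SAGA with small \<open>n\<close> this is not enough. Both gaps
  are closed by the same observation: the descent lemma is tight only if the gradient of \<open>f\<close> changes
  by \<open>h = L d\<close> along the step \<open>d\<close> (\<open>quadratic_upper_model_sharp\<close> gains \<open>\<parallel>h - L d\<parallel>\<^sup>2/(4L)\<close>), whereas
  the variance of the changes of the individual gradients is at most \<open>L\<^sup>2 \<parallel>d\<parallel>\<^sup>2 - \<parallel>h\<parallel>\<^sup>2\<close>, which is
  small in just that case.

  All distributions have finite support, so expectations of real functions need no integrability
  argument; potentials are \<^typ>\<open>ennreal\<close>-valued and infinite off \<open>dom r\<close>.\<close>


section \<open>Gradients and subdifferentials\<close>

lemma gderiv_gradient:
  fixes f :: "'a::euclidean_space \<Rightarrow> real"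
  assumes "f differentiable (at x)"
  shows "GDERIV f x :> gradient f x"
proof -
  obtain D where D: "(f has_derivative D) (at x)"
    using assms by (auto simp: differentiable_def)
  then interpret D: bounded_linear D by (rule has_derivative_bounded_linear)
  have "D h = h \<bullet> (\<Sum>b\<in>Basis. D b *\<^sub>R b)" for h
  proof -
    have "D h = D (\<Sum>b\<in>Basis. (h \<bullet> b) *\<^sub>R b)" by (simp add: euclidean_representation)
    also have "\<dots> = (\<Sum>b\<in>Basis. (h \<bullet> b) * D b)" by (simp add: D.sum D.scaleR)
    finally show ?thesis by (simp add: inner_sum_right mult.commute)
  qed
  then have "GDERIV f x :> (\<Sum>b\<in>Basis. D b *\<^sub>R b)"
    using D unfolding gderiv_def by (metis (no_types, lifting) ext)
  moreover have "D1 = D2" if "GDERIV f x :> D1" "GDERIV f x :> D2" for D1 D2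
  proof -
    have "(\<lambda>h. h \<bullet> D1) = (\<lambda>h. h \<bullet> D2)"
      using that unfolding gderiv_def by (rule has_derivative_unique)
    then show ?thesis by (metis inner_commute vector_eq_ldot)
  qed
  ultimately show ?thesis unfolding gradient_def by (metis theI')
qed

lemma gradient_eqI:
  fixes f :: "'a::euclidean_space \<Rightarrow> real"
  assumes "GDERIV f x :> D"
  shows "gradient f x = D"
proof -
  have "f differentiable (at x)" using assms by (auto simp: gderiv_def differentiable_def)
  then have "GDERIV f x :> gradient f x" by (rule gderiv_gradient)
  then have "(\<lambda>h. h \<bullet> gradient f x) = (\<lambda>h. h \<bullet> D)"
    using assms unfolding gderiv_def by (rule has_derivative_unique)
  then show ?thesis by (metis inner_commute vector_eq_ldot)
qed

lemma gderiv_first_order: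
  fixes f :: "'a::euclidean_space \<Rightarrow> real"
  assumes "GDERIV f x :> D" "0 < e"
  shows "\<forall>\<^sub>F y in at x. \<bar>f y - f x - D \<bullet> (y - x)\<bar> \<le> e * norm (y - x)"
proof -
  obtain d where d: "0 < d"
    "\<And>y. norm (y - x) < d \<Longrightarrow> norm (f y - f x - (y - x) \<bullet> D) \<le> e * norm (y - x)"
    using assms unfolding gderiv_def has_derivative_at_alt by blast
  then show ?thesis
    unfolding eventually_at by (auto simp: dist_norm inner_commute intro!: exI[of _ d])
qed

text \<open>Multiplying out the difference quotient frees later arguments from quotients of extended
  reals.\<close>

lemma frechet_subdiff_iff:
  fixes g :: "'a::euclidean_space \<Rightarrow> ereal"
  assumes gx: "g x = ereal a" and g: "\<And>y. g y \<noteq> -\<infinity>"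
  shows "v \<in> frechet_subdiff g x \<longleftrightarrow>
    (\<forall>e>0. \<forall>\<^sub>F y in at x. ereal (a + v \<bullet> (y - x) - e * norm (y - x)) \<le> g y)"
proof -
  define Q where "Q y = (g y - g x - ereal (v \<bullet> (y - x))) / ereal (norm (y - x))" for y
  have Q: "ereal (- e) \<le> Q y \<longleftrightarrow> ereal (a + v \<bullet> (y - x) - e * norm (y - x)) \<le> g y"
    if "y \<noteq> x" for y e
    using that g[of y] by (cases "g y") (auto simp: Q_def gx field_simps)
  have "0 \<le> Liminf (at x) Q \<longleftrightarrow> (\<forall>e>0. \<forall>\<^sub>F y in at x. ereal (- e) \<le> Q y)"
  proof
    assume *: "0 \<le> Liminf (at x) Q"
    show "\<forall>e>0. \<forall>\<^sub>F y in at x. ereal (- e) \<le> Q y"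
    proof (intro allI impI)
      fix e :: real assume "0 < e"
      then have "ereal (- e) < 0" by simp
      with * have "\<forall>\<^sub>F y in at x. ereal (- e) < Q y" unfolding le_Liminf_iff by blast
      then show "\<forall>\<^sub>F y in at x. ereal (- e) \<le> Q y" by eventually_elim auto
    qed
  next
    assume *: "\<forall>e>0. \<forall>\<^sub>F y in at x. ereal (- e) \<le> Q y"
    show "0 \<le> Liminf (at x) Q"
      unfolding le_Liminf_iff
    proof (intro allI impI)
      fix c :: ereal assume "c < 0"
      then obtain e where e: "c < ereal e" "ereal e < 0" using ereal_dense2 by blast
      then have "\<forall>\<^sub>F y in at x. ereal (- (- e)) \<le> Q y" using *[rule_format, of "- e"] by simp
      then show "\<forall>\<^sub>F y in at x. c < Q y" by eventually_elim (use e in auto)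
    qed
  qed
  moreover have "(\<forall>\<^sub>F y in at x. ereal (- e) \<le> Q y) \<longleftrightarrow>
      (\<forall>\<^sub>F y in at x. ereal (a + v \<bullet> (y - x) - e * norm (y - x)) \<le> g y)" for e
  proof (rule eventually_subst)
    have "\<forall>\<^sub>F y in at x. y \<noteq> x" by (simp add: eventually_at_filter)
    then show "\<forall>\<^sub>F y in at x. (ereal (- e) \<le> Q y) =
        (ereal (a + v \<bullet> (y - x) - e * norm (y - x)) \<le> g y)"
      by eventually_elim (rule Q)
  qed
  moreover have "v \<in> frechet_subdiff g x \<longleftrightarrow> 0 \<le> Liminf (at x) Q"
    unfolding frechet_subdiff_def Q_def[abs_def] gx by simp
  ultimately show ?thesis by simp
qed

lemma frechet_subset_limiting: "frechet_subdiff g x \<subseteq> limiting_subdiff g x"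
proof
  fix v assume v: "v \<in> frechet_subdiff g x"
  then have "g x < \<infinity>" by (simp add: frechet_subdiff_def)
  moreover have "\<exists>X V. X \<longlonglongrightarrow> x \<and> (\<lambda>k. g (X k)) \<longlonglongrightarrow> g x \<and>
      (\<forall>k. V k \<in> frechet_subdiff g (X k)) \<and> V \<longlonglongrightarrow> v"
    by (rule exI[of _ "\<lambda>_. x"], rule exI[of _ "\<lambda>_. v"]) (use v in auto)
  ultimately show "v \<in> limiting_subdiff g x" unfolding limiting_subdiff_def by blast
qed

lemma frechet_subdiff_add_smooth:
  fixes f :: "'a::euclidean_space \<Rightarrow> real" and r :: "'a \<Rightarrow> ereal"
  assumes D: "GDERIV f x :> D" and r: "\<And>y. r y \<noteq> -\<infinity>" and v: "v \<in> frechet_subdiff r x"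
  shows "D + v \<in> frechet_subdiff (\<lambda>y. ereal (f y) + r y) x"
proof -
  have "r x < \<infinity>" using v by (simp add: frechet_subdiff_def)
  then obtain a where a: "r x = ereal a" using r[of x] by (cases "r x") auto
  have Fx: "ereal (f x) + r x = ereal (f x + a)" by (simp add: a)
  have "\<forall>\<^sub>F y in at x. ereal (f x + a + (D + v) \<bullet> (y - x) - e * norm (y - x)) \<le> ereal (f y) + r y"
    if "0 < e" for e
  proof -
    have "\<forall>\<^sub>F y in at x. ereal (a + v \<bullet> (y - x) - e / 2 * norm (y - x)) \<le> r y"
      using v that unfolding frechet_subdiff_iff[of r x a, OF a r] by (meson half_gt_zero)
    moreover have "\<forall>\<^sub>F y in at x. \<bar>f y - f x - D \<bullet> (y - x)\<bar> \<le> e / 2 * norm (y - x)"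
      using that by (intro gderiv_first_order[OF D]) auto
    ultimately show ?thesis
    proof eventually_elim
      case (elim y)
      have "f x + D \<bullet> (y - x) - e / 2 * norm (y - x) \<le> f y" using elim(2) by linarith
      then show ?case
        using r[of y] elim(1) by (cases "r y") (auto simp: inner_add_left)
    qed
  qed
  then show ?thesis
    by (subst frechet_subdiff_iff[of _ _ "f x + a"]) (use Fx r in auto)
qed

lemma limiting_subdiff_add_smooth:
  fixes f :: "'a::euclidean_space \<Rightarrow> real" and r :: "'a \<Rightarrow> ereal"
  assumes D: "\<And>x. GDERIV f x :> G x" and G: "continuous_on UNIV G"
    and r: "\<And>y. r y \<noteq> -\<infinity>" and v: "v \<in> limiting_subdiff r x"
  shows "G x + v \<in> limiting_subdiff (\<lambda>y. ereal (f y) + r y) x"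
proof -
  obtain X V where XV: "r x < \<infinity>" "X \<longlonglongrightarrow> x" "(\<lambda>k. r (X k)) \<longlonglongrightarrow> r x"
      "\<And>k. V k \<in> frechet_subdiff r (X k)" "V \<longlonglongrightarrow> v"
    using v unfolding limiting_subdiff_def by auto
  have "isCont f x"
    using D[of x] unfolding gderiv_def by (rule has_derivative_continuous)
  then have f: "(\<lambda>k. f (X k)) \<longlonglongrightarrow> f x" using XV(2) by (rule isCont_tendsto_compose)
  have GX: "(\<lambda>k. G (X k)) \<longlonglongrightarrow> G x"
    using G XV(2) by (auto simp: continuous_on_eq_continuous_at intro: isCont_tendsto_compose)
  have "(\<lambda>k. ereal (f (X k)) + r (X k)) \<longlonglongrightarrow> ereal (f x) + r x"
    using XV(1) r[of x] f XV(3) by (intro tendsto_add_ereal_general) auto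
  moreover have "\<forall>k. G (X k) + V k \<in> frechet_subdiff (\<lambda>y. ereal (f y) + r y) (X k)"
    using frechet_subdiff_add_smooth[OF D r XV(4)] by blast
  moreover have "(\<lambda>k. G (X k) + V k) \<longlonglongrightarrow> G x + v" using GX XV(5) by (rule tendsto_add)
  ultimately show ?thesis
    unfolding limiting_subdiff_def using XV(1,2) r[of x]
    by (intro CollectI conjI exI[of _ X] exI[of _ "\<lambda>k. G (X k) + V k"]) auto
qed

section \<open>Smooth functions\<close>

lemma quadratic_upper_model:
  fixes f :: "'a::euclidean_space \<Rightarrow> real"
  assumes D: "\<And>x. GDERIV f x :> G x" and L: "\<And>x y. norm (G x - G y) \<le> L * norm (x - y)"
  shows "f y \<le> f x + G x \<bullet> (y - x) + L / 2 * (norm (y - x))\<^sup>2"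
proof -
  define d where "d = y - x"
  define p where "p t = f (x + t *\<^sub>R d) - t * (G x \<bullet> d) - L / 2 * t\<^sup>2 * (norm d)\<^sup>2" for t :: real
  have der: "DERIV p t :> (G (x + t *\<^sub>R d) - G x) \<bullet> d - L * t * (norm d)\<^sup>2" for t
  proof -
    have "((\<lambda>s. x + s *\<^sub>R d) has_derivative (\<lambda>s. s *\<^sub>R d)) (at t)"
      by (auto intro!: derivative_eq_intros)
    then have "((\<lambda>s. f (x + s *\<^sub>R d)) has_derivative (\<lambda>s. (s *\<^sub>R d) \<bullet> G (x + t *\<^sub>R d))) (at t)"
      using D[of "x + t *\<^sub>R d"] unfolding gderiv_def by (rule has_derivative_compose)
    then have "DERIV (\<lambda>s. f (x + s *\<^sub>R d)) t :> G (x + t *\<^sub>R d) \<bullet> d"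
      by (simp add: has_field_derivative_def inner_commute mult_commute_abs)
    then show ?thesis
      unfolding p_def by (auto intro!: derivative_eq_intros simp: inner_diff_left power2_eq_square)
  qed
  have "p 1 \<le> p 0"
  proof (rule DERIV_nonpos_imp_nonincreasing[of 0 1])
    fix t :: real assume t: "0 \<le> t" "t \<le> 1"
    have "(G (x + t *\<^sub>R d) - G x) \<bullet> d \<le> norm (G (x + t *\<^sub>R d) - G x) * norm d"
      by (rule norm_cauchy_schwarz)
    also have "\<dots> \<le> (L * norm (x + t *\<^sub>R d - x)) * norm d" by (intro mult_right_mono L) auto
    also have "\<dots> = L * t * (norm d)\<^sup>2" using t by (simp add: power2_eq_square)
    finally show "\<exists>y. DERIV p t :> y \<and> y \<le> 0" using der[of t] by (intro exI conjI) auto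
  qed auto
  then show ?thesis by (simp add: p_def d_def)
qed

text \<open>Comparing \<open>f\<close> with its quadratic upper model at \<open>x\<close> and its quadratic lower model at
  \<open>y\<close>, at the point \<open>z = (x + y)/2 + h/(2L)\<close> that minimises the sum of the two bounds, improves the
  usual descent lemma by the square of \<open>h - L (y - x)\<close>, where \<open>h = G y - G x\<close>. The gain vanishes only where the gradient
  changes at the full rate \<open>L\<close> in the direction of the step.\<close>

lemma quadratic_upper_model_sharp:
  fixes f :: "'a::euclidean_space \<Rightarrow> real"
  assumes D: "\<And>x. GDERIV f x :> G x" and L: "\<And>x y. norm (G x - G y) \<le> L * norm (x - y)"
    and "0 < L"
  shows "f y \<le> f x + G x \<bullet> (y - x) + L / 2 * (norm (y - x))\<^sup>2
    - (norm (G y - G x - L *\<^sub>R (y - x)))\<^sup>2 / (4 * L)"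
proof -
  define d h where "d = y - x" and "h = G y - G x"
  define w where "w = (1 / (2 * L)) *\<^sub>R h"
  define z where "z = x + ((1/2) *\<^sub>R d + w)"
  have zy: "z - y = w - (1/2) *\<^sub>R d"
  proof -
    have "d = (1/2) *\<^sub>R d + (1/2) *\<^sub>R d" by (simp flip: scaleR_add_left)
    then show ?thesis unfolding z_def d_def by (simp add: algebra_simps)
  qed
  have "f z \<le> f x + G x \<bullet> (z - x) + L / 2 * (norm (z - x))\<^sup>2"
    by (rule quadratic_upper_model[OF D L])
  moreover have "- f z \<le> - f y + (- G y) \<bullet> (z - y) + L / 2 * (norm (z - y))\<^sup>2"
  proof (rule quadratic_upper_model[of "\<lambda>x. - f x" "\<lambda>x. - G x"])
    show "norm (- G a - - G b) \<le> L * norm (a - b)" for a b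
      using L[of b a] by (simp add: norm_minus_commute)
  qed (intro GDERIV_minus D)
  ultimately have "f y \<le> f x + G x \<bullet> (z - x) - G y \<bullet> (z - y)
      + L / 2 * ((norm (z - x))\<^sup>2 + (norm (z - y))\<^sup>2)"
    by (simp add: algebra_simps)
  also have "\<dots> = f x + G x \<bullet> d + h \<bullet> ((1/2) *\<^sub>R d - w) + L * ((norm d)\<^sup>2 / 4 + (norm w)\<^sup>2)"
    unfolding zy unfolding z_def h_def power2_norm_eq_inner
    by (simp add: inner_add_left inner_add_right inner_diff_left inner_diff_right
        inner_commute algebra_simps)
  also have "\<dots> = f x + G x \<bullet> d + L / 2 * (norm d)\<^sup>2 - (norm (h - L *\<^sub>R d))\<^sup>2 / (4 * L)"
    using \<open>0 < L\<close> unfolding w_def power2_norm_eq_inner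
    by (simp add: inner_diff_left inner_diff_right inner_commute field_simps power2_eq_square)
  finally show ?thesis by (simp add: d_def h_def)
qed

section \<open>Means and random batches\<close>

definition mean :: "nat \<Rightarrow> (nat \<Rightarrow> 'b::real_vector) \<Rightarrow> 'b" where
  "mean n z = (1 / real n) *\<^sub>R (\<Sum>i=1..n. z i)"

lemma mean_diff: "mean n (\<lambda>i. y i - z i) = mean n y - mean n z"
  by (simp add: mean_def sum_subtractf scaleR_diff_right)

lemma mean_add: "mean n (\<lambda>i. y i + z i) = mean n y + mean n z"
  by (simp add: mean_def sum.distrib scaleR_add_right)

lemma mean_const: "1 \<le> n \<Longrightarrow> mean n (\<lambda>i. c) = c"
  by (simp add: mean_def sum_constant_scaleR)

lemma mean_mult_left: "mean n (\<lambda>i. c * (z i :: real)) = c * mean n z"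
  by (simp add: mean_def sum_distrib_left mult_ac)

lemma mean_mono: "(\<And>i. y i \<le> (z i :: real)) \<Longrightarrow> mean n y \<le> mean n z"
  unfolding mean_def real_scaleR_def by (intro mult_left_mono sum_mono) auto

lemma mean_nonneg: "(\<And>i. 0 \<le> (z i :: real)) \<Longrightarrow> 0 \<le> mean n z"
  unfolding mean_def real_scaleR_def by (intro mult_nonneg_nonneg sum_nonneg) auto

lemma mean_inner_left: "mean n (\<lambda>i. z i \<bullet> c) = mean n z \<bullet> c"
  by (simp add: mean_def inner_sum_left)

definition var :: "nat \<Rightarrow> (nat \<Rightarrow> 'a::real_inner) \<Rightarrow> real" where
  "var n z = mean n (\<lambda>i. (norm (z i))\<^sup>2) - (norm (mean n z))\<^sup>2"

lemma var_eq_mean_deviation: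
  assumes "1 \<le> n"
  shows "mean n (\<lambda>i. (norm (z i - mean n z))\<^sup>2) = var n z"
proof -
  have "mean n (\<lambda>i. (norm (z i - mean n z))\<^sup>2)
      = mean n (\<lambda>i. (norm (z i))\<^sup>2 - (2 * (z i \<bullet> mean n z) - (norm (mean n z))\<^sup>2))"
    by (simp add: power2_norm_eq_inner inner_diff_left inner_diff_right inner_commute algebra_simps)
  also have "\<dots> = var n z"
    using assms
    by (simp add: mean_diff mean_mult_left mean_inner_left mean_const var_def power2_norm_eq_inner)
  finally show ?thesis .
qed

lemma var_nonneg: "1 \<le> n \<Longrightarrow> 0 \<le> var n z"
  by (subst var_eq_mean_deviation[symmetric]) (auto intro: mean_nonneg)

lemma expectation_bind_finite:
  fixes h :: "'b \<Rightarrow> 'c::{banach, second_countable_topology}"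
  assumes "finite (set_pmf p)" "\<And>x. x \<in> set_pmf p \<Longrightarrow> finite (set_pmf (k x))"
  shows "measure_pmf.expectation (p \<bind> k) h
    = measure_pmf.expectation p (\<lambda>x. measure_pmf.expectation (k x) h)"
  using assms by (subst pmf_expectation_bind[of "set_pmf p"]) (auto simp: integral_measure_pmf)

lemma finite_set_batch_pmf: "1 \<le> n \<Longrightarrow> finite (set_pmf (batch_pmf n b))"
  using finite_lists_length_eq[of "{1..n}" b] unfolding batch_pmf_def
  by (simp add: set_replicate_pmf lists_eq_set conj_commute)

lemma batch_pmf_0: "batch_pmf n 0 = return_pmf []"
  by (simp add: batch_pmf_def)

lemma expectation_uniform:
  "1 \<le> n \<Longrightarrow> measure_pmf.expectation (pmf_of_set {1..n}) h = mean n h"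
  for h :: "nat \<Rightarrow> real"
  by (simp add: integral_pmf_of_set mean_def)

lemma integrable_batch:
  fixes h :: "nat list \<Rightarrow> 'c::{banach, second_countable_topology}"
  shows "1 \<le> n \<Longrightarrow> integrable (batch_pmf n b) h"
  by (intro integrable_measure_pmf_finite finite_set_batch_pmf)

lemma expectation_batch_Suc:
  fixes h :: "nat list \<Rightarrow> real"
  assumes "1 \<le> n"
  shows "measure_pmf.expectation (batch_pmf n (Suc b)) h
    = mean n (\<lambda>i. measure_pmf.expectation (batch_pmf n b) (\<lambda>I. h (i # I)))"
proof -
  have fin: "finite (set_pmf (pmf_of_set {1..n}))" using assms by simp
  have fin': "finite (set_pmf (batch_pmf n b \<bind> (\<lambda>I. return_pmf (i # I))))" for i
    using finite_set_batch_pmf[OF assms, of b] by simp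
  have "batch_pmf n (Suc b)
      = pmf_of_set {1..n} \<bind> (\<lambda>i. batch_pmf n b \<bind> (\<lambda>I. return_pmf (i # I)))"
    by (simp add: batch_pmf_def)
  then show ?thesis
    using fin' fin finite_set_batch_pmf[OF assms, of b]
    by (simp add: expectation_bind_finite expectation_uniform[OF assms, simplified])
qed

lemma mean_cong: "(\<And>i. i \<in> {1..n} \<Longrightarrow> y i = z i) \<Longrightarrow> mean n y = mean n z"
  unfolding mean_def by (auto intro!: arg_cong[where f = "\<lambda>s. _ *\<^sub>R s"] sum.cong)

text \<open>Each of the \<open>b\<close> independent draws avoids \<open>i\<close> with probability \<open>1 - 1/n\<close>.\<close>

lemma prob_not_in_batch:
  assumes "i \<in> {1..n}"
  shows "measure_pmf.expectation (batch_pmf n b) (\<lambda>I. of_bool (i \<notin> set I)) = (1 - 1 / real n) ^ b"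
proof (induction b)
  case 0
  then show ?case by (simp add: batch_pmf_0)
next
  case (Suc b)
  have n: "1 \<le> n" using assms by auto
  have "measure_pmf.expectation (batch_pmf n b) (\<lambda>I. of_bool (i \<notin> set (j # I)))
      = of_bool (i \<noteq> j) * (1 - 1 / real n) ^ b" for j
    using Suc by (cases "i = j") auto
  then have "measure_pmf.expectation (batch_pmf n (Suc b)) (\<lambda>I. of_bool (i \<notin> set I))
      = mean n (\<lambda>j. of_bool (i \<noteq> j) * (1 - 1 / real n) ^ b)"
    by (simp only: expectation_batch_Suc[OF n])
  also have "\<dots> = (1 - 1 / real n) ^ b * mean n (\<lambda>j. of_bool (i \<noteq> j))"
    by (subst mean_mult_left[symmetric]) (simp only: mult.commute)
  also have "mean n (\<lambda>j. of_bool (i \<noteq> j) :: real) = mean n (\<lambda>j. 1 - of_bool (j = i))"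
    by (rule mean_cong) auto
  also have "\<dots> = 1 - 1 / real n"
    using assms n by (simp add: mean_diff mean_const) (simp add: mean_def of_bool_def sum.delta)
  finally show ?case by (simp add: mult.commute)
qed

text \<open>Independent deviations are orthogonal in mean square, so the variance of an average over a
  batch of size \<open>b\<close> is \<open>b\<close> times smaller than that of a single draw.\<close>

lemma batch_sum_centred:
  fixes z :: "nat \<Rightarrow> 'a::euclidean_space"
  assumes n: "1 \<le> n" and z: "mean n z = 0"
  shows "measure_pmf.expectation (batch_pmf n b) (\<lambda>I. sum_list (map z I) \<bullet> c) = 0"
    and "measure_pmf.expectation (batch_pmf n b) (\<lambda>I. (norm (sum_list (map z I)))\<^sup>2)
      = real b * mean n (\<lambda>i. (norm (z i))\<^sup>2)"
proof -
  show 1: "measure_pmf.expectation (batch_pmf n b) (\<lambda>I. sum_list (map z I) \<bullet> c) = 0" for b c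
  proof (induction b)
    case 0 then show ?case by (simp add: batch_pmf_0)
  next
    case (Suc b)
    then show ?case
      using n z
      by (simp add: expectation_batch_Suc[OF n] inner_add_left integrable_batch mean_inner_left)
  qed
  show "measure_pmf.expectation (batch_pmf n b) (\<lambda>I. (norm (sum_list (map z I)))\<^sup>2)
      = real b * mean n (\<lambda>i. (norm (z i))\<^sup>2)"
  proof (induction b)
    case 0 then show ?case by (simp add: batch_pmf_0)
  next
    case (Suc b)
    have sq: "(norm (sum_list (map z (i # I))))\<^sup>2
        = (norm (z i))\<^sup>2 + (2 * (sum_list (map z I) \<bullet> z i) + (norm (sum_list (map z I)))\<^sup>2)" for i I
      by (simp add: power2_norm_eq_inner inner_add_left inner_add_right inner_commute)
    have "measure_pmf.expectation (batch_pmf n b) (\<lambda>I. (norm (sum_list (map z (i # I))))\<^sup>2)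
        = (norm (z i))\<^sup>2 + real b * mean n (\<lambda>i. (norm (z i))\<^sup>2)" for i
      unfolding sq using Suc n 1[of b "z i"] by (simp add: integrable_batch)
    then show ?case
      unfolding expectation_batch_Suc[OF n] using n
      by (simp add: mean_add mean_const algebra_simps)
  qed
qed

definition batch_error :: "nat \<Rightarrow> nat \<Rightarrow> (nat \<Rightarrow> 'a::real_vector) \<Rightarrow> nat list \<Rightarrow> 'a" where
  "batch_error n b z I = (1 / real b) *\<^sub>R sum_list (map z I) - mean n z"

lemma
  fixes z :: "nat \<Rightarrow> 'a::euclidean_space"
  assumes n: "1 \<le> n" and b: "1 \<le> b"
  shows batch_error_unbiased:
      "measure_pmf.expectation (batch_pmf n b) (\<lambda>I. batch_error n b z I \<bullet> c) = 0"
    and batch_error_variance: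
      "measure_pmf.expectation (batch_pmf n b) (\<lambda>I. (norm (batch_error n b z I))\<^sup>2)
        = var n z / real b"
proof -
  define z' where "z' i = z i - mean n z" for i
  have z': "mean n z' = 0" unfolding z'_def using n by (simp add: mean_diff mean_const)
  have "sum_list (map z I) = sum_list (map z' I) + real (length I) *\<^sub>R mean n z" for I
    by (induction I) (auto simp: z'_def algebra_simps)
  then have e: "batch_error n b z I = (1 / real b) *\<^sub>R sum_list (map z' I)"
    if "I \<in> set_pmf (batch_pmf n b)" for I
    using that b unfolding batch_error_def batch_pmf_def set_replicate_pmf
    by (simp add: scaleR_add_right)
  have "measure_pmf.expectation (batch_pmf n b) (\<lambda>I. batch_error n b z I \<bullet> c)
      = measure_pmf.expectation (batch_pmf n b) (\<lambda>I. (1 / real b) * (sum_list (map z' I) \<bullet> c))"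
    by (rule integral_cong_AE) (auto simp: AE_measure_pmf_iff e)
  then show "measure_pmf.expectation (batch_pmf n b) (\<lambda>I. batch_error n b z I \<bullet> c) = 0"
    using batch_sum_centred(1)[OF n z'] by simp
  have "measure_pmf.expectation (batch_pmf n b) (\<lambda>I. (norm (batch_error n b z I))\<^sup>2)
      = measure_pmf.expectation (batch_pmf n b)
          (\<lambda>I. (1 / real b)\<^sup>2 * (norm (sum_list (map z' I)))\<^sup>2)"
    by (rule integral_cong_AE) (auto simp: AE_measure_pmf_iff e power_divide)
  then show "measure_pmf.expectation (batch_pmf n b) (\<lambda>I. (norm (batch_error n b z I))\<^sup>2)
      = var n z / real b"
    using batch_sum_centred(2)[OF n z', of b] b var_eq_mean_deviation[OF n, of z]
    by (simp add: z'_def power2_eq_square)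
qed

section \<open>Lower semicontinuity and minimisers\<close>

lemma lower_semicont_open_superlevel:
  fixes g :: "'a::topological_space \<Rightarrow> ereal"
  assumes "lower_semicont g"
  shows "open {x. c < g x}"
proof (subst open_subopen, intro ballI)
  fix x assume "x \<in> {x. c < g x}"
  then have x: "c < g x" by simp
  then have "\<forall>\<^sub>F y in at x. c < g y"
    using assms unfolding lower_semicont_def le_Liminf_iff by blast
  then have "\<forall>\<^sub>F y in nhds x. c < g y"
    using x unfolding eventually_at_filter by (auto elim!: eventually_mono)
  then show "\<exists>T. open T \<and> x \<in> T \<and> T \<subseteq> {x. c < g x}"
    unfolding eventually_nhds by auto
qed

lemma open_superlevel_add_continuous:
  fixes g :: "'a::topological_space \<Rightarrow> ereal" and a :: "'a \<Rightarrow> real"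
  assumes g: "\<And>c. open {x. c < g x}" and a: "continuous_on UNIV a"
  shows "open {x. ereal c < ereal (a x) + g x}"
proof -
  have "{x. ereal c < ereal (a x) + g x} = (\<Union>s. {x. ereal s < g x} \<inter> {x. c - s < a x})"
  proof (intro equalityI subsetI)
    fix x assume x: "x \<in> {x. ereal c < ereal (a x) + g x}"
    then have "ereal (c - a x) < g x" by (cases "g x") auto
    then obtain s where "ereal (c - a x) < ereal s" "ereal s < g x" using ereal_dense2 by blast
    then show "x \<in> (\<Union>s. {x. ereal s < g x} \<inter> {x. c - s < a x})" by auto
  next
    fix x assume "x \<in> (\<Union>s. {x. ereal s < g x} \<inter> {x. c - s < a x})"
    then obtain s where "ereal s < g x" "c - s < a x" by auto
    then show "x \<in> {x. ereal c < ereal (a x) + g x}" by (cases "g x") auto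
  qed
  moreover have "open {x. c - s < a x}" for s
    using a by (intro open_Collect_less) auto
  ultimately show ?thesis using g by (auto intro!: open_UN open_Int)
qed

text \<open>Without a minimiser, the sets of points with a larger value than some point of \<open>K\<close> would
  cover \<open>K\<close>; but a point with the smallest value in a finite subcover is not covered.\<close>

lemma compact_attains_min:
  fixes g :: "'a::topological_space \<Rightarrow> ereal"
  assumes K: "compact K" "K \<noteq> {}" and g: "\<And>z. open {x. g z < g x}"
  obtains z where "z \<in> K" "\<And>y. y \<in> K \<Longrightarrow> g z \<le> g y"
proof (rule ccontr)
  assume "\<not> thesis"
  with that have "\<forall>z\<in>K. \<exists>y\<in>K. g y < g z" by (meson not_le)
  then have "K \<subseteq> (\<Union>y\<in>K. {x. g y < g x})" by auto
  then obtain C where C: "C \<subseteq> K" "finite C" "K \<subseteq> (\<Union>y\<in>C. {x. g y < g x})"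
    using K(1) g by (metis (lifting) compactE_image)
  then have "C \<noteq> {}" using K(2) by auto
  then obtain z where z: "z \<in> C" "\<And>y. y \<in> C \<Longrightarrow> g z \<le> g y"
    using C(2) by (metis arg_min_if_finite(1) arg_min_least)
  then obtain y where "y \<in> C" "g y < g z" using C by blast
  then show False using z(2) by (meson not_le)
qed

section \<open>The majorisation-minimisation step\<close>

text \<open>A bound for the ratio between the squared distance to stationarity after a step and the
  progress made by the step, see \<open>update_dist_stationary\<close>.\<close>

definition dist_factor :: "real \<Rightarrow> real \<Rightarrow> real" where
  "dist_factor L Lu = 2 * (2 * L + \<bar>Lu\<bar>)\<^sup>2 / L + 2 * L"

locale mm_problem =
  fixes n :: nat and f :: "nat \<Rightarrow> 'a::euclidean_space \<Rightarrow> real" and r :: "'a \<Rightarrow> ereal"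
    and u :: "'a \<Rightarrow> 'a \<Rightarrow> ereal" and L :: real
  assumes setting: "mm_setting n f r u L"
begin

abbreviation grad :: "'a \<Rightarrow> 'a" where "grad \<equiv> gradient (finite_avg n f)"
abbreviation update :: "'a \<Rightarrow> 'a \<Rightarrow> 'a" where "update \<equiv> mm_update u L"

lemma n_ge_1: "1 \<le> n"
  and r_not_MInf: "r x \<noteq> -\<infinity>"
  and u_not_MInf: "u x y \<noteq> -\<infinity>"
  and u_diag: "u x x = r x"
  and r_le_u: "r x \<le> u x y"
  and L_pos: "0 < L"
  using setting by (auto simp: mm_setting_def surrogate_def assumption_A1_def)

lemma u_convex: "0 < t \<Longrightarrow> t < 1 \<Longrightarrow>
    u ((1 - t) *\<^sub>R a + t *\<^sub>R b) y \<le> ereal (1 - t) * u a y + ereal t * u b y"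
  using setting by (auto simp: mm_setting_def assumption_A2_def ext_convex_def)

lemma u_lower_semicont: "lower_semicont (\<lambda>x. u x y)"
  using setting by (auto simp: mm_setting_def assumption_A2_def)

lemma gderiv_component: "i \<in> {1..n} \<Longrightarrow> GDERIV (f i) x :> gradient (f i) x"
  using setting by (auto simp: mm_setting_def assumption_A1_def intro!: gderiv_gradient)

lemma mean_sq_lipschitz:
  "mean n (\<lambda>i. (norm (gradient (f i) x - gradient (f i) y))\<^sup>2) \<le> L\<^sup>2 * (norm (x - y))\<^sup>2"
  using setting by (auto simp: mm_setting_def assumption_A1_def mean_def)

lemma gderiv_finite_avg_mean: "GDERIV (finite_avg n f) x :> mean n (\<lambda>i. gradient (f i) x)"
proof -
  have "((\<lambda>x. (1 / real n) * (\<Sum>i=1..n. f i x)) has_derivative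
      (\<lambda>h. (1 / real n) * (\<Sum>i=1..n. h \<bullet> gradient (f i) x))) (at x)"
    using gderiv_component unfolding gderiv_def
    by (intro has_derivative_mult_right has_derivative_sum) auto
  then show ?thesis
    unfolding gderiv_def finite_avg_def[abs_def] mean_def
    by (simp add: inner_sum_right)
qed

lemma grad_eq_mean: "grad x = mean n (\<lambda>i. gradient (f i) x)"
  by (rule gradient_eqI[OF gderiv_finite_avg_mean])

lemma gderiv_finite_avg: "GDERIV (finite_avg n f) x :> grad x"
  using gderiv_finite_avg_mean by (simp add: grad_eq_mean)

lemma grad_diff: "grad x - grad y = mean n (\<lambda>i. gradient (f i) x - gradient (f i) y)"
  by (simp add: grad_eq_mean mean_diff)

lemma grad_lipschitz: "norm (grad x - grad y) \<le> L * norm (x - y)"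
proof -
  have "(norm (grad x - grad y))\<^sup>2 \<le> mean n (\<lambda>i. (norm (gradient (f i) x - gradient (f i) y))\<^sup>2)"
    using var_nonneg[OF n_ge_1] unfolding grad_diff var_def by (simp add: le_diff_eq)
  also have "\<dots> \<le> (L * norm (x - y))\<^sup>2" using mean_sq_lipschitz by (simp add: power_mult_distrib)
  finally show ?thesis using L_pos by (auto intro: power2_le_imp_le)
qed

lemma continuous_grad: "continuous_on UNIV grad"
proof (rule continuous_on_subset[OF lipschitz_on_continuous_on])
  show "L-lipschitz_on UNIV grad"
    using grad_lipschitz L_pos by (intro lipschitz_onI) (auto simp: dist_norm)
qed simp

definition Finf :: real where
  "Finf = real_of_ereal (INF x. objective n f r x)"

lemma INF_objective: "(INF x. objective n f r x) = ereal Finf"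
proof -
  obtain x where x: "objective n f r x < \<infinity>"
    using setting by (auto simp: mm_setting_def assumption_A1_def)
  have "(INF x. objective n f r x) \<le> objective n f r x" by (rule INF_lower) simp
  then have "(INF x. objective n f r x) < \<infinity>" using x by (rule le_less_trans)
  moreover have "(INF x. objective n f r x) > -\<infinity>"
    using setting by (auto simp: mm_setting_def assumption_A1_def)
  ultimately show ?thesis
    unfolding Finf_def by (cases "INF x. objective n f r x") auto
qed

lemma Finf_le: "ereal Finf \<le> ereal (finite_avg n f x) + r x"
proof -
  have "(INF x. objective n f r x) \<le> objective n f r x" by (rule INF_lower) simp
  then show ?thesis unfolding INF_objective by (simp add: objective_def)
qed

text \<open>Real values of \<open>r\<close> and of the optimality gap \<open>F - F\<^sup>*\<close>, to be used on \<open>dom r\<close> only.\<close>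

definition rr :: "'a \<Rightarrow> real" where "rr x = real_of_ereal (r x)"

definition gap :: "'a \<Rightarrow> real" where "gap x = finite_avg n f x + rr x - Finf"

lemma ereal_rr: "r x < \<infinity> \<Longrightarrow> r x = ereal (rr x)"
  using r_not_MInf[of x] by (cases "r x") (auto simp: rr_def)

lemma gap_nonneg: "r x < \<infinity> \<Longrightarrow> 0 \<le> gap x"
  using Finf_le[of x] ereal_rr[of x] by (simp add: gap_def)

lemma initial_gap_eq: "r x < \<infinity> \<Longrightarrow> initial_gap n f r x = gap x"
  unfolding initial_gap_def INF_objective by (simp add: objective_def ereal_rr gap_def)

definition model :: "'a \<Rightarrow> 'a \<Rightarrow> 'a \<Rightarrow> ereal" where
  "model x g z = ereal (L / 2 * (norm (z - x))\<^sup>2 + g \<bullet> z) + u z x"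

lemma model_strongly_convex:
  assumes ua: "u a x < \<infinity>" and ub: "u b x < \<infinity>" and t: "0 < t" "t < 1"
  shows "model x g ((1 - t) *\<^sub>R a + t *\<^sub>R b)
    \<le> ereal ((1 - t) * (L / 2 * (norm (a - x))\<^sup>2 + g \<bullet> a + real_of_ereal (u a x))
      + t * (L / 2 * (norm (b - x))\<^sup>2 + g \<bullet> b + real_of_ereal (u b x))
      - L / 2 * t * (1 - t) * (norm (a - b))\<^sup>2)"
proof -
  define z where "z = (1 - t) *\<^sub>R a + t *\<^sub>R b"
  obtain A B where AB: "u a x = ereal A" "u b x = ereal B"
    using ua ub u_not_MInf by (metis ereal_cases less_irrefl)
  have "u z x \<le> ereal ((1 - t) * A + t * B)" using u_convex[OF t, of a b x] by (simp add: AB z_def)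
  moreover have "L / 2 * (norm (z - x))\<^sup>2 = (1 - t) * (L / 2 * (norm (a - x))\<^sup>2)
      + t * (L / 2 * (norm (b - x))\<^sup>2) - L / 2 * t * (1 - t) * (norm (a - b))\<^sup>2"
  proof -
    have ab: "a - b = (a - x) - (b - x)" by simp
    have zx: "z - x = (1 - t) *\<^sub>R (a - x) + t *\<^sub>R (b - x)" by (simp add: z_def algebra_simps)
    have "(norm (z - x))\<^sup>2 = (1 - t) * (norm (a - x))\<^sup>2 + t * (norm (b - x))\<^sup>2
        - t * (1 - t) * (norm (a - b))\<^sup>2"
      unfolding ab zx power2_norm_eq_inner
      by (simp add: inner_add_left inner_add_right inner_diff_left inner_diff_right inner_commute
          algebra_simps power2_eq_square)
    then have "L / 2 * (norm (z - x))\<^sup>2 = L / 2 * ((1 - t) * (norm (a - x))\<^sup>2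
        + t * (norm (b - x))\<^sup>2 - t * (1 - t) * (norm (a - b))\<^sup>2)" by simp
    then show ?thesis by (simp add: field_simps)
  qed
  moreover have "g \<bullet> z = (1 - t) * (g \<bullet> a) + t * (g \<bullet> b)" by (simp add: z_def inner_add_right)
  ultimately show ?thesis
    using u_not_MInf[of z x] unfolding model_def z_def[symmetric]
    by (cases "u z x") (auto simp: AB algebra_simps)
qed

text \<open>The lower bound \<open>u \<ge> r \<ge> F\<^sup>* - f\<close> alone lets \<open>u\<close> decrease like \<open>-L/2\<close> times the squared
  distance, which just cancels the proximal term. At the midpoint of \<open>x\<close> and \<open>z\<close> that loss is only
  a quarter as large; convexity transports the better bound to \<open>z\<close>, where the loss is
  \<open>L/4\<close> times the squared distance.\<close>

lemma u_lower_bound: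
  assumes x: "r x < \<infinity>"
  shows "ereal (2 * (Finf - finite_avg n f x) - rr x - norm (grad x) * norm (z - x)
    - L / 4 * (norm (z - x))\<^sup>2) \<le> u z x"
proof (cases "u z x")
  case (real A)
  define w where "w = x + (1/2) *\<^sub>R (z - x)"
  define T S where "T = L * (norm (z - x))\<^sup>2" and "S = norm (grad x) * norm (z - x)"
  have w: "w = (1 - 1/2) *\<^sub>R x + (1/2) *\<^sub>R z" by (simp add: w_def algebra_simps flip: scaleR_add_left)
  have "u w x \<le> ereal (rr x / 2 + A / 2)"
    using u_convex[of "1/2" x z x] unfolding w by (simp add: u_diag ereal_rr[OF x] real)
  then have "r w \<le> ereal (rr x / 2 + A / 2)" using r_le_u order_trans by blast
  then have "Finf \<le> finite_avg n f w + (rr x / 2 + A / 2)"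
    using Finf_le[of w] r_not_MInf[of w] by (cases "r w") auto
  moreover have "finite_avg n f w \<le> finite_avg n f x + grad x \<bullet> (w - x) + T / 8"
    using quadratic_upper_model[OF gderiv_finite_avg grad_lipschitz, of w x]
    by (simp add: w_def T_def power2_eq_square)
  moreover have "grad x \<bullet> (w - x) \<le> S / 2"
    using norm_cauchy_schwarz[of "grad x" "z - x"] by (simp add: w_def S_def)
  ultimately have "2 * (Finf - finite_avg n f x) - rr x - S - T / 4 \<le> A" by argo
  then show ?thesis by (simp add: real T_def S_def)
qed (use u_not_MInf in auto)

lemma model_attains_min:
  fixes x g
  assumes x: "r x < \<infinity>"
  obtains z where "\<And>y. model x g z \<le> model x g y"
proof -
  define c where "c = norm g + norm (grad x)"
  define e where "e = 2 * (finite_avg n f x - Finf) + 2 * rr x"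
  define R where "R = 4 / L * (c + \<bar>e\<bar>) + 1"
  have c: "0 \<le> c" by (simp add: c_def)
  have R1: "1 \<le> R" using L_pos c by (simp add: R_def)
  have mx: "model x g x = ereal (g \<bullet> x + rr x)" by (simp add: model_def u_diag ereal_rr[OF x])
  have far: "model x g x \<le> model x g y" if y: "R < norm (y - x)" for y
  proof -
    define s where "s = norm (y - x)"
    have "c + \<bar>e\<bar> \<le> L / 4 * s"
      using y L_pos by (simp add: R_def s_def field_simps)
    then have "(c + \<bar>e\<bar>) * s \<le> L / 4 * s * s" using y R1 by (intro mult_right_mono) (auto simp: s_def)
    moreover have "\<bar>e\<bar> * 1 \<le> \<bar>e\<bar> * s" using y R1 by (intro mult_left_mono) (auto simp: s_def)
    ultimately have "c * s + e \<le> L / 4 * s\<^sup>2" by (simp add: power2_eq_square algebra_simps)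
    moreover have "g \<bullet> x - g \<bullet> y \<le> norm g * s"
      using norm_cauchy_schwarz[of g "x - y"] by (simp add: s_def inner_diff_right norm_minus_commute)
    moreover note u_lower_bound[OF x, of y]
    ultimately show ?thesis
      unfolding mx using u_not_MInf[of y x]
      by (cases "u y x") (auto simp: model_def s_def[symmetric] c_def e_def algebra_simps)
  qed
  have cont: "continuous_on UNIV (\<lambda>z. L / 2 * (norm (z - x))\<^sup>2 + g \<bullet> z)"
    by (intro continuous_intros)
  have "open {y. model x g z < model x g y}" for z
  proof (cases "model x g z")
    case (real m)
    show ?thesis
      unfolding real unfolding model_def
      by (intro open_superlevel_add_continuous lower_semicont_open_superlevel u_lower_semicont cont)
  next
    case MInf
    then show ?thesis using u_not_MInf[of z x] by (simp add: model_def)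
  qed simp
  then obtain z where z: "z \<in> cball x R" "\<And>y. y \<in> cball x R \<Longrightarrow> model x g z \<le> model x g y"
    using compact_attains_min[of "cball x R" "model x g"] R1 by auto
  have "model x g z \<le> model x g y" for y
  proof (cases "y \<in> cball x R")
    case False
    then have "model x g x \<le> model x g y" by (intro far) (simp add: dist_norm norm_minus_commute)
    moreover have "model x g z \<le> model x g x" using R1 by (intro z) simp
    ultimately show ?thesis by simp
  qed (rule z)
  then show thesis by (rule that)
qed

lemma update_minimises:
  assumes "r x < \<infinity>"
  shows "model x g (update x g) \<le> model x g y"
proof -
  obtain z where z: "\<And>y. model x g z \<le> model x g y" using model_attains_min[OF assms, where g = g] by blast
  have "update x g = arg_min (model x g) (\<lambda>_. True)"
    by (simp add: mm_update_def model_def[abs_def])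
  then have "is_arg_min (model x g) (\<lambda>_. True) (update x g)"
    unfolding arg_min_def
    using z someI[of "is_arg_min (model x g) (\<lambda>_. True)" z] by (simp add: is_arg_min_def not_less)
  then show ?thesis by (simp add: is_arg_min_def not_less)
qed

lemma u_update_finite:
  assumes "r x < \<infinity>"
  shows "u (update x g) x < \<infinity>"
proof -
  have "model x g (update x g) \<le> model x g x" by (rule update_minimises[OF assms])
  also have "\<dots> < \<infinity>" using assms by (simp add: model_def u_diag ereal_rr)
  finally show ?thesis by (auto simp: model_def)
qed

lemma r_update_finite: "r x < \<infinity> \<Longrightarrow> r (update x g) < \<infinity>"
  using r_le_u u_update_finite by (rule le_less_trans)

definition ur :: "'a \<Rightarrow> 'a \<Rightarrow> real" where "ur z x = real_of_ereal (u z x)"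

lemma ereal_ur: "u z x < \<infinity> \<Longrightarrow> u z x = ereal (ur z x)"
  using u_not_MInf[of z x] by (cases "u z x") (auto simp: ur_def)

text \<open>Minimality is compared with the points at parameter \<open>t\<close> of the segment from \<open>p\<close> to \<open>z\<close>,
  where strong convexity gains \<open>t (1 - t)\<close> times the last term on the left; after division by \<open>t\<close>,
  let \<open>t\<close> tend to \<open>0\<close>.\<close>

lemma update_three_point:
  fixes x g
  assumes x: "r x < \<infinity>" and z: "u z x < \<infinity>"
  defines "p \<equiv> update x g"
  shows "L / 2 * (norm (p - x))\<^sup>2 + g \<bullet> p + ur p x + L / 2 * (norm (z - p))\<^sup>2
    \<le> L / 2 * (norm (z - x))\<^sup>2 + g \<bullet> z + ur z x" (is "?p + ?q \<le> ?z")
proof -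
  have p: "u p x < \<infinity>" unfolding p_def by (rule u_update_finite[OF x])
  have scale: "t * (P + (1 - t) * Q) \<le> t * Z" if "P \<le> (1 - t) * P + t * Z - t * (1 - t) * Q"
    for P Q Z t :: real
    using that by (simp add: algebra_simps)
  have bound: "?p + (1 - t) * ?q \<le> ?z" if t: "0 < t" "t < 1" for t
  proof -
    have "ereal ?p = model x g p" by (simp add: model_def ereal_ur[OF p])
    also have "\<dots> \<le> model x g ((1 - t) *\<^sub>R p + t *\<^sub>R z)"
      unfolding p_def by (rule update_minimises[OF x])
    also have "\<dots> \<le> ereal ((1 - t) * ?p + t * ?z - t * (1 - t) * ?q)"
      using model_strongly_convex[OF p z t, of g]
      by (simp add: ur_def norm_minus_commute[of p z] mult_ac)
    finally have "?p \<le> (1 - t) * ?p + t * ?z - t * (1 - t) * ?q" by (simp only: ereal_less_eq(3))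
    then have "t * (?p + (1 - t) * ?q) \<le> t * ?z" by (rule scale)
    then show ?thesis using t by (simp only: mult_le_cancel_left_pos)
  qed
  have "((\<lambda>t. ?p + (1 - t) * ?q) \<longlongrightarrow> ?p + (1 - 0) * ?q) (at_right 0)"
    by (intro tendsto_intros)
  moreover have "\<forall>\<^sub>F t in at_right 0. ?p + (1 - t) * ?q \<le> ?z"
    unfolding eventually_at_right_field by (intro exI[of _ 1]) (use bound in auto)
  ultimately show ?thesis
    by (intro tendsto_upperbound[of _ _ "at_right (0::real)"]) auto
qed

lemma update_lipschitz:
  assumes x: "r x < \<infinity>"
  shows "norm (update x g - update x g') \<le> norm (g - g') / L"
proof -
  define p p' where "p = update x g" and "p' = update x g'"
  have "L * (norm (p - p'))\<^sup>2 \<le> (g' - g) \<bullet> (p - p')"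
    using update_three_point[OF x u_update_finite[OF x, of g'], of g]
      update_three_point[OF x u_update_finite[OF x, of g], of g']
    by (simp add: p_def p'_def inner_diff_left inner_diff_right norm_minus_commute)
  also have "\<dots> \<le> norm (g - g') * norm (p - p')"
    by (metis norm_cauchy_schwarz norm_minus_commute)
  finally have "norm (p - p') * (L * norm (p - p')) \<le> norm (p - p') * norm (g - g')"
    by (simp add: power2_eq_square mult_ac)
  then have "L * norm (p - p') \<le> norm (g - g')"
    by (cases "p = p'") (auto simp: mult_le_cancel_left)
  then show ?thesis using L_pos by (simp add: p_def p'_def field_simps)
qed

lemma update_descent:
  fixes x g
  defines "p \<equiv> update x g"
  assumes x: "r x < \<infinity>"
  shows "gap p \<le> gap x + (grad x - g) \<bullet> (p - x) - L / 2 * (norm (p - x))\<^sup>2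
    - (norm (grad p - grad x - L *\<^sub>R (p - x)))\<^sup>2 / (4 * L)"
proof -
  have "rr p \<le> ur p x"
    using r_le_u[of p x] ereal_rr[OF r_update_finite[OF x]] ereal_ur[OF u_update_finite[OF x]]
    by (simp add: p_def)
  moreover have "ur x x = rr x" by (simp add: ur_def rr_def u_diag)
  moreover have "L / 2 * (norm (p - x))\<^sup>2 + g \<bullet> p + ur p x + L / 2 * (norm (x - p))\<^sup>2
      \<le> L / 2 * (norm (x - x))\<^sup>2 + g \<bullet> x + ur x x"
    unfolding p_def by (rule update_three_point) (use x in \<open>simp_all add: u_diag\<close>)
  moreover have "finite_avg n f p \<le> finite_avg n f x + grad x \<bullet> (p - x) + L / 2 * (norm (p - x))\<^sup>2
      - (norm (grad p - grad x - L *\<^sub>R (p - x)))\<^sup>2 / (4 * L)"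
    by (rule quadratic_upper_model_sharp[OF gderiv_finite_avg grad_lipschitz L_pos])
  ultimately show ?thesis
    by (simp add: gap_def norm_minus_commute inner_diff_left inner_diff_right algebra_simps)
qed

text \<open>Comparing the model at the new point with the model elsewhere shows that
  \<open>-g - L (p - x)\<close> is a subgradient of the surrogate at the new point.\<close>

lemma update_subgradient:
  fixes x g
  defines "p \<equiv> update x g"
  assumes x: "r x < \<infinity>"
  shows "- g - L *\<^sub>R (p - x) \<in> limiting_subdiff (\<lambda>z. u z x) p"
proof -
  have p: "u p x < \<infinity>" unfolding p_def by (rule u_update_finite[OF x])
  have lower: "ereal (ur p x + (- g - L *\<^sub>R (p - x)) \<bullet> (y - p) - L / 2 * (norm (y - p))\<^sup>2) \<le> u y x"
    for y
  proof -
    have "ereal (L / 2 * (norm (p - x))\<^sup>2 + g \<bullet> p + ur p x) \<le> model x g y"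
      using update_minimises[OF x, of g y] by (simp add: p_def model_def ereal_ur[OF p[unfolded p_def]])
    moreover have "(norm (y - x))\<^sup>2 = (norm (p - x))\<^sup>2 + 2 * ((p - x) \<bullet> (y - p)) + (norm (y - p))\<^sup>2"
      unfolding power2_norm_eq_inner by (simp add: inner_diff_left inner_diff_right inner_commute)
    ultimately show ?thesis
      using u_not_MInf[of y x]
      by (cases "u y x")
        (auto simp: model_def inner_diff_left inner_diff_right algebra_simps inner_commute)
  qed
  have "- g - L *\<^sub>R (p - x) \<in> frechet_subdiff (\<lambda>z. u z x) p"
  proof (subst frechet_subdiff_iff[of _ _ "ur p x"])
    show "\<forall>e>0. \<forall>\<^sub>F y in at p.
        ereal (ur p x + (- g - L *\<^sub>R (p - x)) \<bullet> (y - p) - e * norm (y - p)) \<le> u y x"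
    proof (intro allI impI)
      fix e :: real assume "0 < e"
      then have "0 < 2 * e / L" using L_pos by simp
      then have "\<forall>\<^sub>F y in at p. dist y p < 2 * e / L"
        unfolding eventually_at by (auto intro: exI[of _ "2 * e / L"])
      then show "\<forall>\<^sub>F y in at p.
          ereal (ur p x + (- g - L *\<^sub>R (p - x)) \<bullet> (y - p) - e * norm (y - p)) \<le> u y x"
      proof eventually_elim
        case (elim y)
        then have "L / 2 * norm (y - p) \<le> e" using L_pos by (simp add: dist_norm field_simps)
        then have "L / 2 * norm (y - p) * norm (y - p) \<le> e * norm (y - p)"
          by (intro mult_right_mono) auto
        then show ?case
          by (intro order_trans[OF _ lower]) (simp add: power2_eq_square)
      qed
    qed
  qed (use p u_not_MInf in \<open>auto simp: ereal_ur\<close>)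
  then show ?thesis using frechet_subset_limiting by blast
qed

lemma dist_factor_pos: "0 < dist_factor L Lu"
  using L_pos by (auto simp: dist_factor_def intro!: add_nonneg_pos)

text \<open>The unit in which the decrease of the potentials is measured.\<close>

definition progress :: "'a \<Rightarrow> 'a \<Rightarrow> 'a \<Rightarrow> real" where
  "progress x g p = L * (norm (p - x))\<^sup>2 + (norm (g - grad x))\<^sup>2 / L"

lemma progress_nonneg: "0 \<le> progress x g p"
  using L_pos by (simp add: progress_def)

lemma update_dist_stationary:
  fixes x g
  defines "p \<equiv> update x g"
  assumes x: "r x < \<infinity>" and \<Omega>: "x \<in> \<Omega>" "p \<in> \<Omega>" and Lu: "subdiff_constant_on r u \<Omega> Lu"
  shows "(dist_zero (limiting_subdiff (objective n f r) p))\<^sup>2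
    \<le> ennreal (dist_factor L Lu * progress x g p)"
proof -
  define \<nu> where "\<nu> = - g - L *\<^sub>R (p - x)"
  have "\<nu> \<in> limiting_subdiff (\<lambda>z. u z x) p"
    unfolding \<nu>_def p_def by (rule update_subgradient[OF x])
  then obtain \<zeta> where \<zeta>: "\<zeta> \<in> limiting_subdiff r p" "norm (\<nu> - \<zeta>) \<le> Lu * norm (p - x)"
    using Lu \<Omega> unfolding subdiff_constant_on_def by blast
  have "grad p + \<zeta> \<in> limiting_subdiff (objective n f r) p"
    using limiting_subdiff_add_smooth[OF gderiv_finite_avg continuous_grad r_not_MInf \<zeta>(1)]
    by (simp add: objective_def[abs_def])
  then have "dist_zero (limiting_subdiff (objective n f r) p) \<le> ennreal (norm (grad p + \<zeta>))"
    unfolding dist_zero_def by (rule INF_lower)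
  then have "(dist_zero (limiting_subdiff (objective n f r) p))\<^sup>2 \<le> (ennreal (norm (grad p + \<zeta>)))\<^sup>2"
    by (rule power_mono) simp
  also have "\<dots> = ennreal ((norm (grad p + \<zeta>))\<^sup>2)" by (simp add: ennreal_power)
  also have "(norm (grad p + \<zeta>))\<^sup>2 \<le> dist_factor L Lu * progress x g p"
  proof -
    define D E where "D = norm (p - x)" and "E = norm (g - grad x)"
    have triangle: "norm (A - B - C - D) \<le> norm A + norm B + norm C + norm D" for A B C D :: 'a
      using norm_triangle_ineq4[of A B] norm_triangle_ineq4[of "A - B" C]
        norm_triangle_ineq4[of "A - B - C" D] by linarith
    have "grad p + \<zeta> = (grad p - grad x) - (g - grad x) - L *\<^sub>R (p - x) - (\<nu> - \<zeta>)"
      by (simp add: \<nu>_def)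
    then have "norm (grad p + \<zeta>) \<le> norm (grad p - grad x) + E + norm (L *\<^sub>R (p - x)) + norm (\<nu> - \<zeta>)"
      unfolding E_def by (simp only: triangle)
    moreover have "norm (grad p - grad x) \<le> L * D" unfolding D_def by (rule grad_lipschitz)
    moreover have "norm (L *\<^sub>R (p - x)) = L * D" using L_pos by (simp add: D_def)
    moreover have "norm (\<nu> - \<zeta>) \<le> \<bar>Lu\<bar> * D"
      using \<zeta>(2) mult_right_mono[OF abs_ge_self[of Lu], of D] by (simp add: D_def)
    ultimately have "norm (grad p + \<zeta>) \<le> (2 * L + \<bar>Lu\<bar>) * D + E" by (simp add: algebra_simps)
    then have "(norm (grad p + \<zeta>))\<^sup>2 \<le> ((2 * L + \<bar>Lu\<bar>) * D + E)\<^sup>2" by (rule power_mono) simp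
    also have "\<dots> \<le> 2 * ((2 * L + \<bar>Lu\<bar>) * D)\<^sup>2 + 2 * E\<^sup>2"
      using sum_squares_bound[of "(2 * L + \<bar>Lu\<bar>) * D" E] by (simp add: power2_sum)
    also have "\<dots> = 2 * (2 * L + \<bar>Lu\<bar>)\<^sup>2 / L * (L * D\<^sup>2) + 2 * L * (E\<^sup>2 / L)"
      using L_pos by (simp add: power_mult_distrib)
    also have "\<dots> \<le> dist_factor L Lu * (L * D\<^sup>2) + dist_factor L Lu * (E\<^sup>2 / L)"
      using L_pos by (intro add_mono mult_right_mono) (auto simp: dist_factor_def)
    finally show ?thesis by (simp add: progress_def D_def E_def distrib_left)
  qed
  finally show ?thesis by (simp add: ennreal_leI)
qed

end

section \<open>Potential decrease in one iteration\<close>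

text \<open>Young's inequality, with the weights of a convex combination.\<close>

lemma norm_add_sq_le:
  fixes a d :: "'a::real_inner"
  assumes t: "0 < t" "t < 1"
  shows "(norm (a + d))\<^sup>2 \<le> (norm a)\<^sup>2 / t + (norm d)\<^sup>2 / (1 - t)"
proof -
  have "0 \<le> (norm ((1 - t) *\<^sub>R a - t *\<^sub>R d))\<^sup>2" by simp
  also have "\<dots> = (1 - t) * (norm a)\<^sup>2 + t * (norm d)\<^sup>2 - t * (1 - t) * (norm (a + d))\<^sup>2"
    unfolding power2_norm_eq_inner
    by (simp add: inner_add_left inner_add_right inner_diff_left inner_diff_right inner_commute
        algebra_simps power2_eq_square)
  finally show ?thesis using t by (simp add: field_simps)
qed

text \<open>The second moment with a part of the squared mean removed. Only the variance enters the
  error of a batch estimator, but the memory of SAGA shifts means into variances, so neither the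
  variance nor the second moment alone obeys a recursion that is sharp enough for every \<open>n\<close>.\<close>

definition moment :: "real \<Rightarrow> nat \<Rightarrow> (nat \<Rightarrow> 'a::real_inner) \<Rightarrow> real" where
  "moment \<eta> n y = mean n (\<lambda>i. (norm (y i))\<^sup>2) - \<eta> * (norm (mean n y))\<^sup>2"

lemma moment_eq: "moment \<eta> n y = (1 - \<eta>) * mean n (\<lambda>i. (norm (y i))\<^sup>2) + \<eta> * var n y"
  by (simp add: moment_def var_def algebra_simps)

lemma moment_nonneg: "1 \<le> n \<Longrightarrow> 0 \<le> \<eta> \<Longrightarrow> \<eta> \<le> 1 \<Longrightarrow> 0 \<le> moment \<eta> n y"
  by (auto simp: moment_eq intro!: add_nonneg_nonneg mult_nonneg_nonneg mean_nonneg var_nonneg)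

lemma moment_le_mean: "0 \<le> \<eta> \<Longrightarrow> moment \<eta> n y \<le> mean n (\<lambda>i. (norm (y i))\<^sup>2)"
  by (simp add: moment_def)

lemma mean_norm_add_sq_le:
  fixes a d :: "nat \<Rightarrow> 'a::real_inner"
  assumes "0 < t" "t < 1"
  shows "mean n (\<lambda>i. (norm (a i + d i))\<^sup>2)
    \<le> mean n (\<lambda>i. (norm (a i))\<^sup>2) / t + mean n (\<lambda>i. (norm (d i))\<^sup>2) / (1 - t)"
proof -
  have "mean n (\<lambda>i. (norm (a i + d i))\<^sup>2)
      \<le> mean n (\<lambda>i. (1 / t) * (norm (a i))\<^sup>2 + (1 / (1 - t)) * (norm (d i))\<^sup>2)"
    using norm_add_sq_le[OF assms] by (intro mean_mono) simp
  also have "\<dots> = mean n (\<lambda>i. (norm (a i))\<^sup>2) / t + mean n (\<lambda>i. (norm (d i))\<^sup>2) / (1 - t)"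
    unfolding mean_add mean_mult_left by simp
  finally show ?thesis .
qed

lemma moment_add_le:
  fixes a d :: "nat \<Rightarrow> 'a::real_inner"
  assumes n: "1 \<le> n" and \<eta>: "0 \<le> \<eta>" "\<eta> \<le> 1" and t: "0 < t" "t < 1"
  shows "moment \<eta> n (\<lambda>i. a i + d i) \<le> moment \<eta> n a / t + moment \<eta> n d / (1 - t)"
proof -
  have "var n (\<lambda>i. a i + d i)
      = mean n (\<lambda>i. (norm ((a i - mean n a) + (d i - mean n d)))\<^sup>2)"
    by (subst var_eq_mean_deviation[OF n, symmetric]) (simp add: mean_add algebra_simps)
  also have "\<dots> \<le> var n a / t + var n d / (1 - t)"
    using mean_norm_add_sq_le[OF t, of n "\<lambda>i. a i - mean n a" "\<lambda>i. d i - mean n d"]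
    by (simp add: var_eq_mean_deviation[OF n])
  finally have "\<eta> * var n (\<lambda>i. a i + d i) \<le> \<eta> * (var n a / t + var n d / (1 - t))"
    using \<eta> by (intro mult_left_mono)
  moreover have "(1 - \<eta>) * mean n (\<lambda>i. (norm (a i + d i))\<^sup>2) \<le> (1 - \<eta>) *
      (mean n (\<lambda>i. (norm (a i))\<^sup>2) / t + mean n (\<lambda>i. (norm (d i))\<^sup>2) / (1 - t))"
    using \<eta> mean_norm_add_sq_le[OF t] by (intro mult_left_mono) auto
  ultimately have "moment \<eta> n (\<lambda>i. a i + d i) \<le> (1 - \<eta>) *
      (mean n (\<lambda>i. (norm (a i))\<^sup>2) / t + mean n (\<lambda>i. (norm (d i))\<^sup>2) / (1 - t))
      + \<eta> * (var n a / t + var n d / (1 - t))"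
    unfolding moment_eq by (intro add_mono)
  also have "\<dots> = moment \<eta> n a / t + moment \<eta> n d / (1 - t)"
    by (simp add: moment_eq add_divide_distrib distrib_left)
  finally show ?thesis .
qed

text \<open>\<open>K\<close> measures how strongly the squared step feeds the potential: the step pays for it with
  its own squared length \<open>d\<close> and with the deviation of the gradient change \<open>h\<close> from the extreme
  case \<open>h = d\<close>. The term with \<open>1/250\<close> is the margin that becomes the progress.\<close>

definition absorbs :: "real \<Rightarrow> real \<Rightarrow> 'a::real_inner itself \<Rightarrow> bool" where
  "absorbs K \<eta> TYPE('a) \<longleftrightarrow> (\<forall>h d :: 'a. K * ((norm d)\<^sup>2 - \<eta> * (norm h)\<^sup>2) + (norm d)\<^sup>2 / 250
     \<le> (norm d)\<^sup>2 / 2 + (norm (h - d))\<^sup>2 / 4)"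

lemma norm_sq_le_twice_sum: "(norm d)\<^sup>2 \<le> 2 * (norm h)\<^sup>2 + 2 * (norm (h - d))\<^sup>2"
  for h d :: "'a::real_inner"
  using norm_add_sq_le[of "1/2" h "d - h"] by (simp add: norm_minus_commute)

lemma absorbs_0: "K \<le> 49 / 100 \<Longrightarrow> absorbs K 0 TYPE('a::real_inner)"
  unfolding absorbs_def
proof (intro allI)
  fix h d :: 'a
  assume "K \<le> 49 / 100"
  then have "K * (norm d)\<^sup>2 \<le> 49 / 100 * (norm d)\<^sup>2" by (intro mult_right_mono) auto
  then show "K * ((norm d)\<^sup>2 - 0 * (norm h)\<^sup>2) + (norm d)\<^sup>2 / 250
      \<le> (norm d)\<^sup>2 / 2 + (norm (h - d))\<^sup>2 / 4"
    using zero_le_power2[of "norm (h - d)"] zero_le_power2[of "norm d"] by argo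
qed

text \<open>A little above \<open>1/2\<close>, the excess is covered by the removed squared mean if \<open>h\<close> is large and
  by the deviation from \<open>d\<close> if \<open>h\<close> is small.\<close>

lemma absorbs_two_fifths:
  assumes "0 \<le> K" "K \<le> 53 / 100"
  shows "absorbs K (2 / 5) TYPE('a::real_inner)"
  unfolding absorbs_def
proof (intro allI)
  fix h d :: 'a
  have combine: "T + D / 250 \<le> D / 2 + X / 4"
    if "T \<le> 0 \<or> T \<le> 53 / 100 * (D - 2 / 5 * H)" "D \<le> 2 * H + 2 * X" "0 \<le> D" "0 \<le> H" "0 \<le> X"
    for T D H X :: real
    using that by argo
  have "K * ((norm d)\<^sup>2 - 2 / 5 * (norm h)\<^sup>2) \<le> 0 \<or>
      K * ((norm d)\<^sup>2 - 2 / 5 * (norm h)\<^sup>2) \<le> 53 / 100 * ((norm d)\<^sup>2 - 2 / 5 * (norm h)\<^sup>2)"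
    using assms mult_right_mono[of K "53 / 100" "(norm d)\<^sup>2 - 2 / 5 * (norm h)\<^sup>2"]
      mult_nonneg_nonpos[of K "(norm d)\<^sup>2 - 2 / 5 * (norm h)\<^sup>2"]
    by (meson linear)
  then show "K * ((norm d)\<^sup>2 - 2 / 5 * (norm h)\<^sup>2) + (norm d)\<^sup>2 / 250
      \<le> (norm d)\<^sup>2 / 2 + (norm (h - d))\<^sup>2 / 4"
    by (rule combine) (use norm_sq_le_twice_sum[of d h] in auto)
qed

context mm_problem
begin

lemma grad_change_le: "(norm (grad p - grad x))\<^sup>2 \<le> L\<^sup>2 * (norm (p - x))\<^sup>2"
  using power_mono[OF grad_lipschitz[of p x], of 2] by (simp add: power_mult_distrib)

text \<open>Averaging the descent inequality over the batch, the error of the estimator is orthogonal to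
  every fixed vector. Only its correlation with the random part of the step remains, and that part
  is at most \<open>1/L\<close> times as long as the error itself.\<close>

lemma unbiased_step:
  fixes z :: "nat \<Rightarrow> 'a"
  assumes x: "r x < \<infinity>" and b: "1 \<le> b" and K: "absorbs K \<eta> TYPE('a)"
  defines "g \<equiv> \<lambda>I. grad x + batch_error n b z I"
  defines "p \<equiv> \<lambda>I. update x (g I)"
  shows "measure_pmf.expectation (batch_pmf n b) (\<lambda>I. gap (p I)
      + K / L * (L\<^sup>2 * (norm (p I - x))\<^sup>2 - \<eta> * (norm (grad (p I) - grad x))\<^sup>2)
      + progress x (g I) (p I) / 250)
    \<le> gap x + (251 / 250) * var n z / (L * real b)"
    (is "measure_pmf.expectation ?M ?\<psi> \<le> _")
proof -
  define e where "e = batch_error n b z"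
  define q where "q = update x (grad x)"
  have pw: "?\<psi> I \<le> gap x + (251 / 250) / L * (norm (e I))\<^sup>2 - e I \<bullet> (q - x)" for I
  proof -
    define d h where "d = p I - x" and "h = grad (p I) - grad x"
    have combine: "G' + T + P \<le> G + E' - j"
      if "- c \<le> E" "G' \<le> G - i - Q - R" "i = c + j" "T + D \<le> Q + R" "P = D + E / 250"
        "E' = E + E / 250"
      for G G' T P E' i j c E Q R D :: real
      using that by argo
    have e: "grad x - g I = - e I" by (simp add: g_def e_def)
    have "norm (p I - q) \<le> norm (e I) / L"
      using update_lipschitz[OF x, of "g I" "grad x"] by (simp add: p_def q_def g_def e_def)
    then have "norm (e I) * norm (p I - q) \<le> norm (e I) * (norm (e I) / L)"
      by (rule mult_left_mono) simp
    then have "- (e I \<bullet> (p I - q)) \<le> (norm (e I))\<^sup>2 / L"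
      using Cauchy_Schwarz_ineq2[of "e I" "p I - q"] by (simp add: power2_eq_square)
    moreover have "gap (p I) \<le> gap x - e I \<bullet> d - L / 2 * (norm d)\<^sup>2
        - (norm (h - L *\<^sub>R d))\<^sup>2 / (4 * L)"
      using update_descent[OF x, of "g I"] e by (simp add: p_def d_def h_def)
    moreover have "e I \<bullet> d = e I \<bullet> (p I - q) + e I \<bullet> (q - x)"
      by (simp add: d_def inner_diff_right)
    moreover have "K / L * (L\<^sup>2 * (norm d)\<^sup>2 - \<eta> * (norm h)\<^sup>2) + L * (norm d)\<^sup>2 / 250
        \<le> L / 2 * (norm d)\<^sup>2 + (norm (h - L *\<^sub>R d))\<^sup>2 / (4 * L)"
    proof -
      have "K * ((norm (L *\<^sub>R d))\<^sup>2 - \<eta> * (norm h)\<^sup>2) + (norm (L *\<^sub>R d))\<^sup>2 / 250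
          \<le> (norm (L *\<^sub>R d))\<^sup>2 / 2 + (norm (h - L *\<^sub>R d))\<^sup>2 / 4"
        using K unfolding absorbs_def by blast
      then have "(K * (L\<^sup>2 * (norm d)\<^sup>2 - \<eta> * (norm h)\<^sup>2) + L\<^sup>2 * (norm d)\<^sup>2 / 250) / L
          \<le> (L\<^sup>2 * (norm d)\<^sup>2 / 2 + (norm (h - L *\<^sub>R d))\<^sup>2 / 4) / L"
        using L_pos by (intro divide_right_mono) (auto simp: power_mult_distrib)
      then show ?thesis using L_pos by (simp add: add_divide_distrib power2_eq_square)
    qed
    moreover have "progress x (g I) (p I) / 250 = L * (norm d)\<^sup>2 / 250 + (norm (e I))\<^sup>2 / L / 250"
      by (simp add: progress_def d_def g_def e_def add_divide_distrib)
    moreover have "(251 / 250) / L * (norm (e I))\<^sup>2 = (norm (e I))\<^sup>2 / L + (norm (e I))\<^sup>2 / L / 250"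
      using L_pos by (simp add: field_simps)
    ultimately show ?thesis unfolding d_def[symmetric] h_def[symmetric] by (rule combine)
  qed
  have int: "integrable ?M h" for h :: "nat list \<Rightarrow> real" by (rule integrable_batch[OF n_ge_1])
  have "measure_pmf.expectation ?M ?\<psi> \<le> measure_pmf.expectation ?M
      (\<lambda>I. gap x + (251 / 250) / L * (norm (e I))\<^sup>2 - e I \<bullet> (q - x))"
    by (intro integral_mono int pw)
  also have "\<dots> = gap x + (251 / 250) / L * (var n z / real b)"
    using batch_error_unbiased[OF n_ge_1 b, of z "q - x"] batch_error_variance[OF n_ge_1 b, of z]
    by (simp add: int e_def)
  finally show ?thesis by simp
qed

text \<open>A SAGA iteration. An index keeps its table entry with probability \<open>(1 - 1/n)\<^sup>b \<le> t\<^sup>2\<close>, so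
  the second moment of the table errors contracts by \<open>t\<^sup>2\<close>; Young's inequality with the factor
  \<open>1/t\<close> leaves a contraction by \<open>t\<close>. Of the remaining share \<open>1 - t\<close>, the variance
  pays for the batch error, and at most \<open>\<eta>\<close> is spent on the removed squared mean.\<close>

lemma saga_potential_step:
  fixes w :: "nat \<Rightarrow> 'a"
  assumes x: "r x < \<infinity>" and b: "1 \<le> b" and t: "0 < t" "t < 1" "(1 - 1 / real n) ^ b \<le> t\<^sup>2"
    and \<eta>: "0 \<le> \<eta>" "\<eta> \<le> 1 - t" and \<kappa>: "251 / 250 \<le> \<kappa> * (1 - t) * real b"
    and K: "absorbs (\<kappa> / (1 - t)) \<eta> TYPE('a)"
  defines "z \<equiv> \<lambda>i. gradient (f i) x - gradient (f i) (w i)"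
  defines "g \<equiv> \<lambda>I. grad x + batch_error n b z I"
  defines "p \<equiv> \<lambda>I. update x (g I)"
  defines "w' \<equiv> \<lambda>I i. if i \<in> set I then x else w i"
  shows "measure_pmf.expectation (batch_pmf n b) (\<lambda>I. gap (p I)
      + \<kappa> / L * moment \<eta> n (\<lambda>i. gradient (f i) (p I) - gradient (f i) (w' I i))
      + progress x (g I) (p I) / 250)
    \<le> gap x + \<kappa> / L * moment \<eta> n z"
    (is "measure_pmf.expectation ?M ?\<psi> \<le> _")
proof -
  define V where "V = mean n (\<lambda>i. (norm (z i))\<^sup>2)"
  define W where "W I = mean n (\<lambda>i. (norm (z i))\<^sup>2 * of_bool (i \<notin> set I))" for I
  have \<kappa>0: "0 < \<kappa>" using \<kappa> t b by (smt (verit) mult_nonneg_nonneg mult_nonpos_nonneg of_nat_0_le_iff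
        divide_pos_pos)
  have V0: "0 \<le> V" unfolding V_def by (intro mean_nonneg) auto
  have int: "integrable ?M h" for h :: "nat list \<Rightarrow> real" by (rule integrable_batch[OF n_ge_1])
  have pw: "?\<psi> I \<le> (gap (p I)
      + \<kappa> / (1 - t) / L * (L\<^sup>2 * (norm (p I - x))\<^sup>2 - \<eta> * (norm (grad (p I) - grad x))\<^sup>2)
      + progress x (g I) (p I) / 250) + \<kappa> / (L * t) * W I" for I
  proof -
    define a where "a i = (if i \<in> set I then 0 else z i)" for i
    define \<delta> where "\<delta> i = gradient (f i) (p I) - gradient (f i) x" for i
    have split: "(\<lambda>i. gradient (f i) (p I) - gradient (f i) (w' I i)) = (\<lambda>i. a i + \<delta> i)"
      by (auto simp: a_def \<delta>_def z_def w'_def fun_eq_iff)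
    have "moment \<eta> n a \<le> mean n (\<lambda>i. (norm (a i))\<^sup>2)" by (rule moment_le_mean[OF \<eta>(1)])
    also have "\<dots> = W I" unfolding W_def by (rule mean_cong) (simp add: a_def)
    finally have a: "moment \<eta> n a / t \<le> W I / t" using t by (intro divide_right_mono) auto
    have "mean n \<delta> = grad (p I) - grad x" unfolding \<delta>_def by (rule grad_diff[symmetric])
    then have "moment \<eta> n \<delta> \<le> L\<^sup>2 * (norm (p I - x))\<^sup>2 - \<eta> * (norm (grad (p I) - grad x))\<^sup>2"
      using mean_sq_lipschitz[of "p I" x] by (simp add: moment_def \<delta>_def)
    then have "moment \<eta> n \<delta> / (1 - t)
        \<le> (L\<^sup>2 * (norm (p I - x))\<^sup>2 - \<eta> * (norm (grad (p I) - grad x))\<^sup>2) / (1 - t)"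
      using t by (intro divide_right_mono) auto
    with a moment_add_le[OF n_ge_1 \<eta>(1) _ t(1,2), of a \<delta>] \<eta>(2) t(1)
    have "moment \<eta> n (\<lambda>i. a i + \<delta> i) \<le> W I / t
        + (L\<^sup>2 * (norm (p I - x))\<^sup>2 - \<eta> * (norm (grad (p I) - grad x))\<^sup>2) / (1 - t)"
      by linarith
    then have "\<kappa> / L * moment \<eta> n (\<lambda>i. a i + \<delta> i) \<le> \<kappa> / L * (W I / t
        + (L\<^sup>2 * (norm (p I - x))\<^sup>2 - \<eta> * (norm (grad (p I) - grad x))\<^sup>2) / (1 - t))"
      using \<kappa>0 L_pos by (intro mult_left_mono) auto
    then show ?thesis unfolding split by (simp add: distrib_left mult.commute)
  qed
  have EW: "measure_pmf.expectation ?M W \<le> t\<^sup>2 * V"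
  proof -
    have "measure_pmf.expectation ?M W
        = mean n (\<lambda>i. measure_pmf.expectation ?M (\<lambda>I. (norm (z i))\<^sup>2 * of_bool (i \<notin> set I)))"
      unfolding W_def mean_def
      by (simp only: integral_scaleR_right Bochner_Integration.integral_sum int)
    also have "\<dots> = mean n (\<lambda>i. (norm (z i))\<^sup>2 * (1 - 1 / real n) ^ b)"
      by (rule mean_cong) (simp only: integral_mult_right_zero prob_not_in_batch)
    also have "\<dots> = (1 - 1 / real n) ^ b * V"
      unfolding V_def mean_mult_left[symmetric] by (simp only: mult.commute)
    also have "\<dots> \<le> t\<^sup>2 * V" using t(3) V0 by (rule mult_right_mono)
    finally show ?thesis .
  qed
  have "measure_pmf.expectation ?M ?\<psi> \<le> measure_pmf.expectation ?M (\<lambda>I. (gap (p I)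
      + \<kappa> / (1 - t) / L * (L\<^sup>2 * (norm (p I - x))\<^sup>2 - \<eta> * (norm (grad (p I) - grad x))\<^sup>2)
      + progress x (g I) (p I) / 250) + \<kappa> / (L * t) * W I)"
    by (intro integral_mono int pw)
  also have "\<dots> = measure_pmf.expectation ?M (\<lambda>I. gap (p I)
      + \<kappa> / (1 - t) / L * (L\<^sup>2 * (norm (p I - x))\<^sup>2 - \<eta> * (norm (grad (p I) - grad x))\<^sup>2)
      + progress x (g I) (p I) / 250) + \<kappa> / (L * t) * measure_pmf.expectation ?M W"
    by (subst Bochner_Integration.integral_add) (auto intro: int)
  also have "\<dots> \<le> (gap x + (251 / 250) * var n z / (L * real b)) + \<kappa> / (L * t) * (t\<^sup>2 * V)"
    using EW \<kappa>0 L_pos t unfolding p_def g_def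
    by (intro add_mono unbiased_step[OF x b K] mult_left_mono) auto
  also have "\<dots> = gap x + ((251 / 250) / real b * var n z + \<kappa> * t * V) / L"
    using t L_pos by (simp add: field_simps power2_eq_square)
  also have "\<dots> \<le> gap x + \<kappa> * moment \<eta> n z / L"
  proof -
    have "(251 / 250) / real b \<le> \<kappa> * (1 - t)" using \<kappa> b by (simp add: field_simps)
    then have "(251 / 250) / real b * var n z \<le> \<kappa> * (1 - t) * var n z"
      using var_nonneg[OF n_ge_1] by (rule mult_right_mono)
    also have "\<dots> + \<kappa> * t * V \<le> \<kappa> * moment \<eta> n z"
    proof -
      have "\<kappa> * (\<eta> * (norm (mean n z))\<^sup>2) \<le> \<kappa> * ((1 - t) * (norm (mean n z))\<^sup>2)"
        using \<kappa>0 \<eta>(2) by (intro mult_left_mono mult_right_mono) auto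
      then show ?thesis by (simp add: var_def moment_def V_def algebra_simps)
    qed
    finally have "(251 / 250) / real b * var n z + \<kappa> * t * V \<le> \<kappa> * moment \<eta> n z" by simp
    then show ?thesis using L_pos by (intro add_left_mono divide_right_mono) auto
  qed
  finally show ?thesis by simp
qed

text \<open>An SVRG iteration: the reference point survives with probability \<open>1 - 1/m \<le> t\<^sup>2\<close>, which
  takes the part of \<open>(1 - 1/n)\<^sup>b\<close>; after a renewal the estimator is exact.\<close>

lemma svrg_potential_step:
  fixes x y :: 'a
  assumes x: "r x < \<infinity>" and b: "1 \<le> b" and m: "1 \<le> m"
    and t: "0 < t" "t < 1" "1 - 1 / real m \<le> t\<^sup>2"
    and \<kappa>: "251 / 250 \<le> \<kappa> * (1 - t) * real b" and K: "absorbs (\<kappa> / (1 - t)) 0 TYPE('a)"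
  defines "y' \<equiv> \<lambda>renew. if renew then x else y"
  defines "g \<equiv> \<lambda>I renew. grad x
    + batch_error n b (\<lambda>i. gradient (f i) x - gradient (f i) (y' renew)) I"
  defines "p \<equiv> \<lambda>I renew. update x (g I renew)"
  shows "measure_pmf.expectation (pair_pmf (batch_pmf n b) (bernoulli_pmf (1 / real m)))
      (\<lambda>(I, renew). gap (p I renew)
      + \<kappa> / L * mean n (\<lambda>i. (norm (gradient (f i) (p I renew) - gradient (f i) (y' renew)))\<^sup>2)
      + progress x (g I renew) (p I renew) / 250)
    \<le> gap x + \<kappa> / L * mean n (\<lambda>i. (norm (gradient (f i) x - gradient (f i) y))\<^sup>2)"
    (is "measure_pmf.expectation ?P (\<lambda>(I, renew). ?\<psi> I renew) \<le> _")
proof -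
  let ?M = "batch_pmf n b"
  define V where "V = mean n (\<lambda>i. (norm (gradient (f i) x - gradient (f i) y))\<^sup>2)"
  define V' where "V' renew = mean n (\<lambda>i. (norm (gradient (f i) x - gradient (f i) (y' renew)))\<^sup>2)"
    for renew
  have V0: "0 \<le> V" unfolding V_def by (intro mean_nonneg) auto
  have \<kappa>0: "0 < \<kappa>" using \<kappa> t b by (smt (verit) mult_nonneg_nonneg mult_nonpos_nonneg of_nat_0_le_iff
        divide_pos_pos)
  have int: "integrable ?M h" for h :: "nat list \<Rightarrow> real" by (rule integrable_batch[OF n_ge_1])
  have E: "measure_pmf.expectation ?M (\<lambda>I. ?\<psi> I renew)
      \<le> gap x + ((251 / 250) / real b + \<kappa> / t) * V' renew / L" for renew
  proof -
    define z where "z i = gradient (f i) x - gradient (f i) (y' renew)" for i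
    have V': "V' renew = mean n (\<lambda>i. (norm (z i))\<^sup>2)" by (simp add: V'_def z_def)
    have pw: "?\<psi> I renew \<le> (gap (p I renew)
      + \<kappa> / (1 - t) / L * (L\<^sup>2 * (norm (p I renew - x))\<^sup>2
          - 0 * (norm (grad (p I renew) - grad x))\<^sup>2)
      + progress x (g I renew) (p I renew) / 250) + \<kappa> / (L * t) * V' renew" for I
    proof -
      define \<delta> where "\<delta> i = gradient (f i) (p I renew) - gradient (f i) x" for i
      have split: "gradient (f i) (p I renew) - gradient (f i) (y' renew) = z i + \<delta> i" for i
        by (simp add: z_def \<delta>_def)
      have "mean n (\<lambda>i. (norm (\<delta> i))\<^sup>2) / (1 - t) \<le> L\<^sup>2 * (norm (p I renew - x))\<^sup>2 / (1 - t)"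
        using mean_sq_lipschitz[of "p I renew" x] t by (intro divide_right_mono) (auto simp: \<delta>_def)
      with mean_norm_add_sq_le[OF t(1,2), of n z \<delta>]
      have "mean n (\<lambda>i. (norm (z i + \<delta> i))\<^sup>2)
          \<le> V' renew / t + L\<^sup>2 * (norm (p I renew - x))\<^sup>2 / (1 - t)"
        unfolding V' by linarith
      then have "\<kappa> / L * mean n (\<lambda>i. (norm (z i + \<delta> i))\<^sup>2)
          \<le> \<kappa> / L * (V' renew / t + L\<^sup>2 * (norm (p I renew - x))\<^sup>2 / (1 - t))"
        using \<kappa>0 L_pos by (intro mult_left_mono) auto
      then show ?thesis unfolding split by (simp add: distrib_left mult.commute)
    qed
    have "measure_pmf.expectation ?M (\<lambda>I. ?\<psi> I renew) \<le> measure_pmf.expectation ?M (\<lambda>I.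
      (gap (p I renew) + \<kappa> / (1 - t) / L * (L\<^sup>2 * (norm (p I renew - x))\<^sup>2
          - 0 * (norm (grad (p I renew) - grad x))\<^sup>2)
      + progress x (g I renew) (p I renew) / 250) + \<kappa> / (L * t) * V' renew)"
      by (intro integral_mono int pw)
    also have "\<dots> = measure_pmf.expectation ?M (\<lambda>I.
      gap (p I renew) + \<kappa> / (1 - t) / L * (L\<^sup>2 * (norm (p I renew - x))\<^sup>2
          - 0 * (norm (grad (p I renew) - grad x))\<^sup>2)
      + progress x (g I renew) (p I renew) / 250) + \<kappa> / (L * t) * V' renew"
      by (subst Bochner_Integration.integral_add) (auto intro: int)
    also have "\<dots> \<le> gap x + (251 / 250) * var n z / (L * real b) + \<kappa> / (L * t) * V' renew"
      unfolding p_def g_def z_def[symmetric]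
      by (intro add_right_mono unbiased_step[OF x b K])
    also have "\<dots> \<le> gap x + (251 / 250) * V' renew / (L * real b) + \<kappa> / (L * t) * V' renew"
      using L_pos b unfolding V'
      by (intro add_mono divide_right_mono mult_left_mono) (use \<kappa>0 t in \<open>auto simp: var_def\<close>)
    finally show ?thesis using L_pos b t by (simp add: field_simps)
  qed
  have V'_eq: "V' True = 0" "V' False = V" by (simp_all add: V'_def y'_def V_def mean_def)
  have "measure_pmf.expectation ?P (\<lambda>(I, renew). ?\<psi> I renew)
      = measure_pmf.expectation ?M (\<lambda>I. ?\<psi> I True * (1 / real m) + ?\<psi> I False * (1 - 1 / real m))"
    unfolding pair_pmf_def using m
    by (subst expectation_bind_finite)
      (auto simp: finite_set_batch_pmf[OF n_ge_1] expectation_bind_finite intro: finite_subset)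
  also have "\<dots> = measure_pmf.expectation ?M (\<lambda>I. ?\<psi> I True) * (1 / real m)
      + measure_pmf.expectation ?M (\<lambda>I. ?\<psi> I False) * (1 - 1 / real m)"
    by (subst Bochner_Integration.integral_add) (auto intro: int)
  also have "\<dots> \<le> (gap x + ((251 / 250) / real b + \<kappa> / t) * V' True / L) * (1 / real m)
      + (gap x + ((251 / 250) / real b + \<kappa> / t) * V' False / L) * (1 - 1 / real m)"
    using m by (intro add_mono mult_right_mono E) auto
  also have "\<dots> = gap x + ((251 / 250) / real b + \<kappa> / t) * (1 - 1 / real m) * V / L"
    unfolding V'_eq by (simp add: algebra_simps)
  also have "\<dots> \<le> gap x + \<kappa> * V / L"
  proof -
    have "(251 / 250) / real b \<le> \<kappa> * (1 - t)" using \<kappa> b by (simp add: field_simps)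
    moreover have "0 \<le> \<kappa> * (1 - t) + \<kappa> / t" using \<kappa>0 t by (intro add_nonneg_nonneg) auto
    ultimately have "((251 / 250) / real b + \<kappa> / t) * (1 - 1 / real m)
        \<le> (\<kappa> * (1 - t) + \<kappa> / t) * t\<^sup>2"
      using t(3) m by (intro mult_mono) auto
    also have "\<dots> = \<kappa> * ((1 - t) * t\<^sup>2 + t)"
      using t by (simp add: field_simps power2_eq_square)
    also have "\<dots> \<le> \<kappa> * ((1 - t) * 1 + t)"
      using t \<kappa>0 by (intro mult_left_mono add_right_mono) (auto simp: power_le_one)
    finally have "((251 / 250) / real b + \<kappa> / t) * (1 - 1 / real m) \<le> \<kappa>" by simp
    then show ?thesis using V0 L_pos by (intro add_left_mono divide_right_mono mult_right_mono) auto
  qed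
  finally show ?thesis by (simp add: V_def)
qed

text \<open>An upper bound for the mean square of what a batch adds to the error of the SARAH estimator:
  the variance of the gradient differences divided by \<open>b\<close>.\<close>

definition increment :: "nat \<Rightarrow> 'a \<Rightarrow> 'a \<Rightarrow> real" where
  "increment b x y = (L\<^sup>2 * (norm (x - y))\<^sup>2 - (norm (grad x - grad y))\<^sup>2) / real b"

lemma increment_nonneg: "0 \<le> increment b x y"
  unfolding increment_def using grad_change_le by (intro divide_nonneg_nonneg) auto

text \<open>In a SARAH iteration the error is not centred, so the step is charged with the full
  inequality of Young, half of the descent. The variance of the next increment is proportional to
  \<open>L\<^sup>2 d\<^sup>2 - h\<^sup>2\<close> with \<open>h\<close> the change of the gradient, whereas the sharp descent lemma gains the
  square of \<open>h - L d\<close>. For every \<open>h\<close> one of the two is a saving proportional to the squared step.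
  For \<open>m\<close> close to \<open>b/4\<close> the rest of the inequality balances with a margin of order \<open>1/m\<close> only.\<close>

lemma sarah_pointwise:
  fixes x g :: 'a
  assumes x: "r x < \<infinity>" and m: "1 \<le> m" "4 * m \<le> b"
  defines "p \<equiv> update x g" and "A \<equiv> 5 / 4 * (real m - 1)"
  shows "gap p + A / L * ((norm (g - grad x))\<^sup>2 + increment b p x) + progress x g p / 250
    \<le> gap x + (1 + A + 1 / 250) * (norm (g - grad x))\<^sup>2 / L"
proof -
  define e d h where "e = g - grad x" and "d = p - x" and "h = grad p - grad x"
  have combine: "G' + (F + T) + P \<le> G + S"
    if "- c \<le> E + R" "G' \<le> G - c - Q - H" "T + D \<le> R + H" "P = D + E / 250"
      "S = E + F + E / 250" "Q = 2 * R" for G G' F T P S c E R Q H D :: real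
    using that by argo
  have A: "0 \<le> A" "A \<le> 5 / 16 * real b" using m by (auto simp: A_def)
  have "(norm (e + (L / 2) *\<^sub>R d))\<^sup>2 \<ge> 0" by simp
  also have "(norm (e + (L / 2) *\<^sub>R d))\<^sup>2 = (norm e)\<^sup>2 + L * (e \<bullet> d) + (L\<^sup>2 / 4) * (norm d)\<^sup>2"
    unfolding power2_norm_eq_inner
    by (simp add: inner_add_left inner_add_right inner_commute power2_eq_square)
  finally have "- (e \<bullet> d) \<le> (norm e)\<^sup>2 / L + L / 4 * (norm d)\<^sup>2"
    using L_pos by (simp add: field_simps power2_eq_square)
  moreover have "gap p \<le> gap x - e \<bullet> d - L / 2 * (norm d)\<^sup>2 - (norm (h - L *\<^sub>R d))\<^sup>2 / (4 * L)"
    using update_descent[OF x, of g] by (simp add: p_def e_def d_def h_def inner_diff_left)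
  moreover have "A / L * increment b p x + L * (norm d)\<^sup>2 / 250
      \<le> L / 4 * (norm d)\<^sup>2 + (norm (h - L *\<^sub>R d))\<^sup>2 / (4 * L)"
  proof -
    define D where "D = L\<^sup>2 * (norm d)\<^sup>2"
    have D: "D = (norm (L *\<^sub>R d))\<^sup>2" by (simp add: D_def power_mult_distrib)
    have "A * increment b p x \<le> (5 / 16 * real b) * increment b p x"
      using A by (intro mult_right_mono increment_nonneg)
    also have "\<dots> = 5 / 16 * (D - (norm h)\<^sup>2)"
      using m by (simp add: increment_def D_def d_def h_def)
    finally have "A * increment b p x + D / 250 \<le> D / 4 + (norm (h - L *\<^sub>R d))\<^sup>2 / 4"
      using norm_sq_le_twice_sum[of "L *\<^sub>R d" h] unfolding D[symmetric]
      using zero_le_power2[of "norm h"] zero_le_power2[of "norm (h - L *\<^sub>R d)"] by argo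
    then have "(A * increment b p x + D / 250) / L \<le> (D / 4 + (norm (h - L *\<^sub>R d))\<^sup>2 / 4) / L"
      using L_pos by (intro divide_right_mono) auto
    then show ?thesis using L_pos by (simp add: D_def add_divide_distrib power2_eq_square)
  qed
  moreover have "progress x g p / 250 = L * (norm d)\<^sup>2 / 250 + (norm e)\<^sup>2 / L / 250"
    by (simp add: progress_def d_def e_def add_divide_distrib)
  moreover have "(1 + A + 1 / 250) * (norm e)\<^sup>2 / L
      = (norm e)\<^sup>2 / L + A / L * (norm e)\<^sup>2 + (norm e)\<^sup>2 / L / 250"
    using L_pos by (simp add: field_simps)
  ultimately show ?thesis unfolding e_def[symmetric] distrib_left by (rule combine) simp
qed

text \<open>The weight \<open>A\<close> solves \<open>(1 - 1/m) (1 + A + 1/4) = A\<close>: the old error survives with probability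
  \<open>1 - 1/m\<close> and then has to pay for its weight, the descent and the progress. The last item is
  covered by \<open>1/4\<close> in place of \<open>1/250\<close>.\<close>

lemma sarah_potential_step:
  fixes x y g :: 'a
  assumes x: "r x < \<infinity>" and m: "1 \<le> m" "4 * m \<le> b"
  defines "A \<equiv> 5 / 4 * (real m - 1)"
  defines "g' \<equiv> \<lambda>I reset. if reset then grad x
    else grad x + batch_error n b (\<lambda>i. gradient (f i) x - gradient (f i) y) I + (g - grad y)"
  defines "p \<equiv> \<lambda>I reset. update x (g' I reset)"
  shows "measure_pmf.expectation (pair_pmf (batch_pmf n b) (bernoulli_pmf (1 / real m)))
      (\<lambda>(I, reset). gap (p I reset)
      + A / L * ((norm (g' I reset - grad x))\<^sup>2 + increment b (p I reset) x)
      + progress x (g' I reset) (p I reset) / 250)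
    \<le> gap x + A / L * ((norm (g - grad y))\<^sup>2 + increment b x y)"
    (is "measure_pmf.expectation ?P (\<lambda>(I, reset). ?\<psi> I reset) \<le> _")
proof -
  let ?M = "batch_pmf n b"
  define z where "z i = gradient (f i) x - gradient (f i) y" for i
  define S where "S = (norm (g - grad y))\<^sup>2 + increment b x y"
  have S0: "0 \<le> S" unfolding S_def using increment_nonneg by (intro add_nonneg_nonneg) auto
  have b: "1 \<le> b" using m by simp
  have int: "integrable ?M h" for h :: "nat list \<Rightarrow> real" by (rule integrable_batch[OF n_ge_1])
  have pw: "?\<psi> I reset \<le> gap x + (1 + A + 1 / 250) * (norm (g' I reset - grad x))\<^sup>2 / L" for I reset
    unfolding p_def A_def by (rule sarah_pointwise[OF x m])
  have reset: "measure_pmf.expectation ?M (\<lambda>I. ?\<psi> I True) \<le> gap x"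
  proof -
    have "measure_pmf.expectation ?M (\<lambda>I. ?\<psi> I True) \<le> measure_pmf.expectation ?M (\<lambda>I. gap x)"
      using pw[of _ True] by (intro integral_mono int) (simp add: g'_def)
    then show ?thesis by simp
  qed
  have keep: "measure_pmf.expectation ?M (\<lambda>I. ?\<psi> I False) \<le> gap x + (1 + A + 1 / 250) / L * S"
  proof -
    have sq: "(norm (g' I False - grad x))\<^sup>2 = (norm (batch_error n b z I))\<^sup>2
        + (2 * (batch_error n b z I \<bullet> (g - grad y)) + (norm (g - grad y))\<^sup>2)" for I
      unfolding power2_norm_eq_inner g'_def
      by (simp add: z_def[abs_def, symmetric] inner_add_left inner_add_right inner_diff_left
          inner_diff_right inner_commute)
    have "measure_pmf.expectation ?M (\<lambda>I. (norm (g' I False - grad x))\<^sup>2)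
        = var n z / real b + (norm (g - grad y))\<^sup>2"
      unfolding sq using batch_error_unbiased[OF n_ge_1 b, of z "g - grad y"]
        batch_error_variance[OF n_ge_1 b, of z] by (simp add: int)
    also have "var n z / real b \<le> increment b x y"
      unfolding increment_def var_def
      using mean_sq_lipschitz[of x y] grad_diff[of x y]
      by (intro divide_right_mono diff_mono) (auto simp: z_def[abs_def])
    finally have Eg: "measure_pmf.expectation ?M (\<lambda>I. (norm (g' I False - grad x))\<^sup>2) \<le> S"
      by (simp add: S_def)
    have "measure_pmf.expectation ?M (\<lambda>I. ?\<psi> I False) \<le> measure_pmf.expectation ?M
        (\<lambda>I. gap x + (1 + A + 1 / 250) / L * (norm (g' I False - grad x))\<^sup>2)"
      using pw[of _ False] by (intro integral_mono int) simp
    also have "\<dots> = gap x + (1 + A + 1 / 250) / L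
        * measure_pmf.expectation ?M (\<lambda>I. (norm (g' I False - grad x))\<^sup>2)"
      by (subst Bochner_Integration.integral_add) (auto intro: int)
    also have "\<dots> \<le> gap x + (1 + A + 1 / 250) / L * S"
      using Eg m L_pos by (intro add_left_mono mult_left_mono) (auto simp: A_def)
    finally show ?thesis .
  qed
  have "measure_pmf.expectation ?P (\<lambda>(I, reset). ?\<psi> I reset)
      = measure_pmf.expectation ?M (\<lambda>I. ?\<psi> I True * (1 / real m) + ?\<psi> I False * (1 - 1 / real m))"
    unfolding pair_pmf_def using m
    by (subst expectation_bind_finite)
      (auto simp: finite_set_batch_pmf[OF n_ge_1] expectation_bind_finite intro: finite_subset)
  also have "\<dots> = measure_pmf.expectation ?M (\<lambda>I. ?\<psi> I True) * (1 / real m)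
      + measure_pmf.expectation ?M (\<lambda>I. ?\<psi> I False) * (1 - 1 / real m)"
    by (subst Bochner_Integration.integral_add) (auto intro: int)
  also have "\<dots> \<le> gap x * (1 / real m)
      + (gap x + (1 + A + 1 / 250) / L * S) * (1 - 1 / real m)"
    using m by (intro add_mono mult_right_mono keep reset) auto
  also have "\<dots> = gap x + (1 - 1 / real m) * (1 + A + 1 / 250) * (S / L)"
  proof -
    have "g * q + (g + k / L * S) * (1 - q) = g + (1 - q) * k * (S / L)" for g q k :: real
      by (simp add: algebra_simps diff_divide_distrib)
    then show ?thesis .
  qed
  also have "\<dots> \<le> gap x + A * (S / L)"
  proof -
    have "1 + A + 1 / 250 \<le> 5 / 4 * real m" unfolding A_def by argo
    moreover have "(1 - 1 / real m) * (1 + A + 1 / 250) = (real m - 1) * (1 + A + 1 / 250) / real m"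
      using m by (simp add: field_simps)
    ultimately have "(1 - 1 / real m) * (1 + A + 1 / 250)
        \<le> (real m - 1) * (5 / 4 * real m) / real m"
      using m by (simp only:) (intro divide_right_mono mult_left_mono, auto)
    also have "\<dots> = A" using m by (simp add: A_def)
    finally show ?thesis using S0 L_pos by (intro add_left_mono mult_right_mono) auto
  qed
  finally show ?thesis by (simp add: S_def)
qed

end

section \<open>From one-step decrease to complexity\<close>

lemma markov_chain_telescope:
  fixes M :: "nat \<Rightarrow> 's pmf" and step :: "'s \<Rightarrow> 's pmf" and \<Phi> H :: "'s \<Rightarrow> ennreal"
  assumes M: "\<And>k. M (Suc k) = M k \<bind> step"
    and dec: "\<And>k s. k < N \<Longrightarrow> s \<in> set_pmf (M k) \<Longrightarrow> (\<integral>\<^sup>+s'. \<Phi> s' + H s' \<partial>step s) \<le> \<Phi> s"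
  shows "(\<integral>\<^sup>+s. \<Phi> s \<partial>M N) + (\<Sum>k=1..N. \<integral>\<^sup>+s. H s \<partial>M k) \<le> (\<integral>\<^sup>+s. \<Phi> s \<partial>M 0)"
  using dec
proof (induction N)
  case 0
  then show ?case by simp
next
  case (Suc N)
  have "(\<integral>\<^sup>+s. \<Phi> s \<partial>M (Suc N)) + (\<integral>\<^sup>+s. H s \<partial>M (Suc N))
      = (\<integral>\<^sup>+s. (\<integral>\<^sup>+s'. \<Phi> s' + H s' \<partial>step s) \<partial>M N)"
    by (simp add: M nn_integral_add)
  also have "\<dots> \<le> (\<integral>\<^sup>+s. \<Phi> s \<partial>M N)"
    by (intro nn_integral_mono_AE) (auto simp: AE_measure_pmf_iff intro!: Suc.prems[of N])
  finally have "(\<integral>\<^sup>+s. \<Phi> s \<partial>M (Suc N)) + (\<integral>\<^sup>+s. H s \<partial>M (Suc N)) + (\<Sum>k=1..N. \<integral>\<^sup>+s. H s \<partial>M k)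
      \<le> (\<integral>\<^sup>+s. \<Phi> s \<partial>M N) + (\<Sum>k=1..N. \<integral>\<^sup>+s. H s \<partial>M k)"
    by (rule add_right_mono)
  then have "(\<integral>\<^sup>+s. \<Phi> s \<partial>M (Suc N)) + (\<Sum>k=1..Suc N. \<integral>\<^sup>+s. H s \<partial>M k)
      \<le> (\<integral>\<^sup>+s. \<Phi> s \<partial>M N) + (\<Sum>k=1..N. \<integral>\<^sup>+s. H s \<partial>M k)"
    by (simp only: sum.cl_ivl_Suc) (simp add: ac_simps del: nn_integral_bind_pmf)
  also have "\<dots> \<le> (\<integral>\<^sup>+s. \<Phi> s \<partial>M 0)" by (rule Suc.IH) (rule Suc.prems, auto)
  finally show ?case .
qed

text \<open>If the smallest of \<open>N > X/\<epsilon>\<^sup>2\<close> summands exceeded \<open>\<epsilon>\<^sup>2\<close>, the sum would exceed \<open>X\<close>.\<close>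

lemma complexity_le:
  fixes F :: "'a::real_inner \<Rightarrow> ereal" and P :: "nat \<Rightarrow> ('a \<times> nat) pmf"
  assumes \<epsilon>: "0 < \<epsilon>" "\<epsilon> \<le> 1" and X: "0 \<le> X" and B: "0 \<le> B"
    and sum: "\<And>N. (\<And>k. k \<le> N \<Longrightarrow> fst ` set_pmf (P k) \<subseteq> \<Omega>) \<Longrightarrow>
      (\<Sum>k=1..N. expected_dist_sq F P k) \<le> ennreal X"
    and iterates: "iterates_in F P \<epsilon> \<Omega>"
    and cost: "\<And>k. (\<integral>\<^sup>+(x, c). of_nat c \<partial>measure_pmf (P k)) \<le> ennreal (real k * B)"
  shows "complexity F P \<epsilon> \<le> ennreal (B * (X + 1) / \<epsilon>\<^sup>2)"
proof -
  define N where "N = nat \<lfloor>X / \<epsilon>\<^sup>2\<rfloor> + 1"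
  have XN: "X / \<epsilon>\<^sup>2 < real N" "real N \<le> X / \<epsilon>\<^sup>2 + 1"
    using X \<epsilon> unfolding N_def by (auto simp: of_nat_nat) linarith+
  have "\<exists>K\<le>N. stationary_by F P \<epsilon> K"
  proof (rule ccontr)
    assume none: "\<not> (\<exists>K\<le>N. stationary_by F P \<epsilon> K)"
    then have "fst ` set_pmf (P k) \<subseteq> \<Omega>" if "k \<le> N" for k
      using iterates that unfolding iterates_in_def by auto
    then have "(\<Sum>k=1..N. expected_dist_sq F P k) \<le> ennreal X" by (rule sum)
    moreover have "ennreal (\<epsilon>\<^sup>2) \<le> expected_dist_sq F P k" if "k \<in> {1..N}" for k
    proof -
      have "\<not> stationary_by F P \<epsilon> N" and "1 \<le> N" using none that by auto
      then have "\<not> (MIN k\<in>{1..N}. expected_dist_sq F P k) \<le> ennreal (\<epsilon>\<^sup>2)"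
        unfolding stationary_by_def by blast
      then have "ennreal (\<epsilon>\<^sup>2) < (MIN k\<in>{1..N}. expected_dist_sq F P k)" by (simp only: not_le)
      also have "\<dots> \<le> expected_dist_sq F P k" using that by (intro Min_le) auto
      finally show ?thesis by simp
    qed
    then have "(\<Sum>k=1..N. ennreal (\<epsilon>\<^sup>2)) \<le> (\<Sum>k=1..N. expected_dist_sq F P k)" by (rule sum_mono)
    ultimately have "ennreal (real N * \<epsilon>\<^sup>2) \<le> ennreal X"
      by (simp add: ennreal_mult ennreal_of_nat_eq_real_of_nat)
    then have "real N * \<epsilon>\<^sup>2 \<le> X" using X by (simp add: ennreal_le_iff)
    then show False using XN(1) \<epsilon> by (simp add: field_simps)
  qed
  then obtain K0 where K0: "K0 \<le> N" "stationary_by F P \<epsilon> K0" by blast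
  define K where "K = (LEAST K. stationary_by F P \<epsilon> K)"
  have "K \<le> N" unfolding K_def using K0 by (meson Least_le order_trans)
  have "1 \<le> 1 / \<epsilon>\<^sup>2" using \<epsilon> by (simp add: power_le_one)
  then have KX: "real K \<le> (X + 1) / \<epsilon>\<^sup>2" using XN(2) \<open>K \<le> N\<close> by (simp add: add_divide_distrib)
  have "complexity F P \<epsilon> = (\<integral>\<^sup>+(x, c). of_nat c \<partial>measure_pmf (P K))"
    using K0 unfolding complexity_def K_def by auto
  also have "\<dots> \<le> ennreal (real K * B)" by (rule cost)
  also have "\<dots> \<le> ennreal (B * (X + 1) / \<epsilon>\<^sup>2)"
    using mult_right_mono[OF KX B] by (intro ennreal_leI) (simp add: mult.commute)
  finally show ?thesis .
qed

text \<open>The hidden constant is \<open>\<gamma> (X + 1) + 1\<close>: the inner summand accounts for rounding the number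
  of iterations up, at the price of \<open>\<epsilon> \<le> 1\<close>, and the outer one for the preliminary evaluations.\<close>

lemma complexity_bigoI:
  fixes alg :: "nat \<Rightarrow> (nat \<Rightarrow> 'a::euclidean_space \<Rightarrow> real) \<Rightarrow> ('a \<Rightarrow> 'a \<Rightarrow> ereal) \<Rightarrow> real \<Rightarrow> 'a \<Rightarrow>
      nat \<Rightarrow> ('a \<times> nat) pmf"
  assumes \<gamma>: "0 \<le> \<gamma>" and \<phi>: "\<And>n. 0 \<le> \<phi> n"
    and sum: "\<And>n f r u L x0 \<Omega> Lu N. \<lbrakk>mm_setting n f r u L; adm n; r x0 < \<infinity>;
      subdiff_constant_on r u \<Omega> Lu; \<And>k. k \<le> N \<Longrightarrow> fst ` set_pmf (alg n f u L x0 k) \<subseteq> \<Omega>\<rbrakk> \<Longrightarrow>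
      (\<Sum>k=1..N. expected_dist_sq (objective n f r) (alg n f u L x0) k)
        \<le> ennreal (250 * dist_factor L Lu * initial_gap n f r x0)"
    and cost: "\<And>n f r u L x0 k. mm_setting n f r u L \<Longrightarrow> adm n \<Longrightarrow>
      (\<integral>\<^sup>+(x, c). of_nat c \<partial>measure_pmf (alg n f u L x0 k)) \<le> ennreal (real k * (\<gamma> * \<phi> n))"
  shows "complexity_bigo alg adm \<phi>"
  unfolding complexity_bigo_def Let_def
proof (intro exI allI impI, elim conjE)
  fix n f r and u :: "'a \<Rightarrow> 'a \<Rightarrow> ereal" and L x0 \<epsilon> \<Omega> Lu
  assume hyps: "mm_setting n f r u L" "adm n" "objective n f r x0 < \<infinity>" "0 < \<epsilon>" "\<epsilon> \<le> 1" "bounded \<Omega>"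
    and iterates: "iterates_in (objective n f r) (alg n f u L x0) \<epsilon> \<Omega>"
    and Lu: "subdiff_constant_on r u \<Omega> Lu"
  interpret mm_problem n f r u L by (unfold_locales) (rule hyps(1))
  define X where "X = 250 * dist_factor L Lu * initial_gap n f r x0"
  define Q where "Q = \<phi> n / \<epsilon>\<^sup>2"
  have x0: "r x0 < \<infinity>" using hyps(3) by (simp add: objective_def)
  have X0: "0 \<le> X"
    using dist_factor_pos[of Lu] gap_nonneg[OF x0] by (simp add: X_def initial_gap_eq[OF x0])
  have Q0: "0 \<le> Q" using \<phi>[of n] by (simp add: Q_def)
  have c: "complexity (objective n f r) (alg n f u L x0) \<epsilon> \<le> ennreal (\<gamma> * \<phi> n * (X + 1) / \<epsilon>\<^sup>2)"
  proof (rule complexity_le[where \<Omega> = \<Omega>])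
    show "(\<Sum>k=1..N. expected_dist_sq (objective n f r) (alg n f u L x0) k) \<le> ennreal X"
      if "\<And>k. k \<le> N \<Longrightarrow> fst ` set_pmf (alg n f u L x0 k) \<subseteq> \<Omega>" for N
      unfolding X_def using hyps(1,2) x0 Lu that by (rule sum)
  qed (use hyps X0 \<gamma> \<phi> iterates cost[OF hyps(1,2)] in auto)
  have bound: "(\<gamma> * (X + 1) + 1) * \<phi> n / \<epsilon>\<^sup>2 = Q + \<gamma> * \<phi> n * (X + 1) / \<epsilon>\<^sup>2"
    by (simp add: Q_def algebra_simps add_divide_distrib)
  let ?bound = "ennreal ((\<gamma> * (250 * dist_factor L Lu * initial_gap n f r x0 + 1) + 1) * \<phi> n / \<epsilon>\<^sup>2)"
  have nonneg: "0 \<le> \<gamma> * \<phi> n * (X + 1) / \<epsilon>\<^sup>2" using \<gamma> \<phi>[of n] X0 by simp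
  have eq: "?bound = ennreal Q + ennreal (\<gamma> * \<phi> n * (X + 1) / \<epsilon>\<^sup>2)"
    unfolding X_def[symmetric] bound using Q0 nonneg by (rule ennreal_plus)
  have "of_nat n + complexity (objective n f r) (alg n f u L x0) \<epsilon> \<le> ?bound"
    if "real n \<le> \<phi> n / \<epsilon>\<^sup>2"
  proof -
    have "of_nat n \<le> ennreal Q"
      using that by (simp add: Q_def ennreal_of_nat_eq_real_of_nat ennreal_leI)
    then show ?thesis unfolding eq using c by (rule add_mono)
  qed
  moreover have "complexity (objective n f r) (alg n f u L x0) \<epsilon> \<le> ?bound"
    unfolding eq using c by (rule add_increasing[OF zero_le])
  ultimately show "complexity (objective n f r) (alg n f u L x0) \<epsilon> \<le> ?bound \<and>
      (real n \<le> \<phi> n / \<epsilon>\<^sup>2 \<longrightarrow> of_nat n + complexity (objective n f r) (alg n f u L x0) \<epsilon> \<le> ?bound)"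
    by blast
qed

lemma chain_expected_cost:
  fixes M :: "nat \<Rightarrow> 's pmf" and step :: "'s \<Rightarrow> 's pmf"
  assumes M0: "M 0 = return_pmf s0" and M: "\<And>k. M (Suc k) = M k \<bind> step"
    and c0: "cost s0 = 0" and B: "0 \<le> B"
    and step: "\<And>s. (\<integral>\<^sup>+s'. of_nat (cost s') \<partial>step s) \<le> of_nat (cost s) + ennreal B"
  shows "(\<integral>\<^sup>+s. of_nat (cost s) \<partial>M k) \<le> ennreal (real k * B)"
proof (induction k)
  case 0
  then show ?case by (simp add: M0 c0)
next
  case (Suc k)
  have "(\<integral>\<^sup>+s. of_nat (cost s) \<partial>M (Suc k)) \<le> (\<integral>\<^sup>+s. of_nat (cost s) + ennreal B \<partial>M k)"
    unfolding M nn_integral_bind_pmf by (intro nn_integral_mono step)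
  also have "\<dots> = (\<integral>\<^sup>+s. of_nat (cost s) \<partial>M k) + ennreal B"
    by (simp add: nn_integral_add measure_pmf.emeasure_space_1[simplified])
  also have "\<dots> \<le> ennreal (real k * B) + ennreal B" using Suc by (rule add_right_mono)
  also have "\<dots> = ennreal (real (Suc k) * B)"
    using B by (simp add: algebra_simps flip: ennreal_plus)
  finally show ?case .
qed

context mm_problem
begin

text \<open>The potential is infinite off \<open>dom r\<close>, which makes the decrease trivial at states that are
  never reached.\<close>

definition potential :: "'a \<Rightarrow> real \<Rightarrow> ennreal" where
  "potential p v = (if r p < \<infinity> then ennreal (gap p + v) else \<infinity>)"

definition dist_sq :: "'a \<Rightarrow> ennreal" where
  "dist_sq p = (dist_zero (limiting_subdiff (objective n f r) p))\<^sup>2"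

lemma potential_decrease:
  fixes Q :: "'w pmf" and g :: "'w \<Rightarrow> 'a"
  assumes fin: "finite (set_pmf Q)" and Lu: "subdiff_constant_on r u \<Omega> Lu"
    and x\<Omega>: "x \<in> \<Omega>" and p\<Omega>: "\<And>\<omega>. \<omega> \<in> set_pmf Q \<Longrightarrow> update x (g \<omega>) \<in> \<Omega>"
    and v: "\<And>\<omega>. 0 \<le> v \<omega>"
    and le: "r x < \<infinity> \<Longrightarrow> measure_pmf.expectation Q
      (\<lambda>\<omega>. gap (update x (g \<omega>)) + v \<omega> + progress x (g \<omega>) (update x (g \<omega>)) / 250) \<le> gap x + V"
  shows "(\<integral>\<^sup>+\<omega>. potential (update x (g \<omega>)) (v \<omega>)
      + ennreal (1 / (250 * dist_factor L Lu)) * dist_sq (update x (g \<omega>)) \<partial>Q) \<le> potential x V"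
proof (cases "r x < \<infinity>")
  case x: True
  let ?\<psi> = "\<lambda>\<omega>. gap (update x (g \<omega>)) + v \<omega> + progress x (g \<omega>) (update x (g \<omega>)) / 250"
  have gap0: "0 \<le> gap (update x (g \<omega>))" for \<omega> by (intro gap_nonneg r_update_finite x)
  have "(\<integral>\<^sup>+\<omega>. potential (update x (g \<omega>)) (v \<omega>)
      + ennreal (1 / (250 * dist_factor L Lu)) * dist_sq (update x (g \<omega>)) \<partial>Q)
      \<le> (\<integral>\<^sup>+\<omega>. ennreal (?\<psi> \<omega>) \<partial>Q)"
  proof (intro nn_integral_mono_AE, unfold AE_measure_pmf_iff, intro ballI)
    fix \<omega> assume \<omega>: "\<omega> \<in> set_pmf Q"
    let ?p = "update x (g \<omega>)"
    have "ennreal (1 / (250 * dist_factor L Lu)) * dist_sq ?p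
        \<le> ennreal (1 / (250 * dist_factor L Lu)) * ennreal (dist_factor L Lu * progress x (g \<omega>) ?p)"
      unfolding dist_sq_def
      by (intro mult_left_mono update_dist_stationary[OF x x\<Omega> p\<Omega>[OF \<omega>] Lu]) simp
    also have "\<dots> = ennreal (progress x (g \<omega>) ?p / 250)"
      using dist_factor_pos[of Lu] progress_nonneg[of x "g \<omega>" ?p]
      by (simp flip: ennreal_mult')
    finally have "potential ?p (v \<omega>) + ennreal (1 / (250 * dist_factor L Lu)) * dist_sq ?p
        \<le> ennreal (gap ?p + v \<omega>) + ennreal (progress x (g \<omega>) ?p / 250)"
      using r_update_finite[OF x, of "g \<omega>"] by (intro add_mono) (auto simp: potential_def)
    also have "\<dots> = ennreal (?\<psi> \<omega>)"
      using gap0[of \<omega>] v[of \<omega>] progress_nonneg[of x "g \<omega>" ?p] by (simp flip: ennreal_plus)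
    finally show "potential ?p (v \<omega>) + ennreal (1 / (250 * dist_factor L Lu)) * dist_sq ?p
        \<le> ennreal (?\<psi> \<omega>)" .
  qed
  also have "\<dots> = ennreal (measure_pmf.expectation Q ?\<psi>)"
    using gap0 v progress_nonneg
    by (intro nn_integral_eq_integral integrable_measure_pmf_finite fin AE_I2 add_nonneg_nonneg) auto
  also have "\<dots> \<le> potential x V" using le[OF x] x by (auto simp: potential_def intro: ennreal_leI)
  finally show ?thesis .
qed (simp add: potential_def)

lemma chain_expected_dist:
  fixes M :: "nat \<Rightarrow> 's pmf" and step :: "'s \<Rightarrow> 's pmf" and pr :: "'s \<Rightarrow> 'a \<times> nat"
  assumes M0: "M 0 = return_pmf s0" and M: "\<And>k. M (Suc k) = M k \<bind> step"
    and \<Phi>0: "\<Phi> s0 \<le> ennreal (gap x0)"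
    and dec: "\<And>s. fst (pr s) \<in> \<Omega> \<Longrightarrow> (\<And>s'. s' \<in> set_pmf (step s) \<Longrightarrow> fst (pr s') \<in> \<Omega>) \<Longrightarrow>
      (\<integral>\<^sup>+s'. \<Phi> s' + ennreal (1 / (250 * dist_factor L Lu)) * dist_sq (fst (pr s')) \<partial>step s) \<le> \<Phi> s"
    and \<Omega>: "\<And>k. k \<le> N \<Longrightarrow> fst ` set_pmf (map_pmf pr (M k)) \<subseteq> \<Omega>"
    and x0: "r x0 < \<infinity>"
  shows "(\<Sum>k=1..N. expected_dist_sq (objective n f r) (\<lambda>k. map_pmf pr (M k)) k)
    \<le> ennreal (250 * dist_factor L Lu * initial_gap n f r x0)"
proof -
  define a where "a = 1 / (250 * dist_factor L Lu)"
  have a: "0 < a" using dist_factor_pos[of Lu] by (simp add: a_def)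
  let ?E = "expected_dist_sq (objective n f r) (\<lambda>k. map_pmf pr (M k))"
  have E: "?E k = (\<integral>\<^sup>+s. dist_sq (fst (pr s)) \<partial>M k)" for k
    by (simp add: expected_dist_sq_def dist_sq_def case_prod_beta)
  have tele: "(\<integral>\<^sup>+s. \<Phi> s \<partial>M N) + (\<Sum>k=1..N. \<integral>\<^sup>+s. ennreal a * dist_sq (fst (pr s)) \<partial>M k)
      \<le> (\<integral>\<^sup>+s. \<Phi> s \<partial>M 0)"
  proof (rule markov_chain_telescope[where M = M and step = step, OF M])
    fix k s assume k: "k < N" and s: "s \<in> set_pmf (M k)"
    have "fst (pr s) \<in> \<Omega>" using \<Omega>[of k] k s by auto
    moreover have "fst (pr s') \<in> \<Omega>" if "s' \<in> set_pmf (step s)" for s'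
      using \<Omega>[of "Suc k"] k s that by (auto simp: M)
    ultimately show "(\<integral>\<^sup>+s'. \<Phi> s' + ennreal a * dist_sq (fst (pr s')) \<partial>step s) \<le> \<Phi> s"
      unfolding a_def by (rule dec)
  qed
  have "(\<Sum>k=1..N. ennreal a * ?E k)
      \<le> (\<integral>\<^sup>+s. \<Phi> s \<partial>M N) + (\<Sum>k=1..N. \<integral>\<^sup>+s. ennreal a * dist_sq (fst (pr s)) \<partial>M k)"
    by (simp add: E nn_integral_cmult add_increasing)
  also have "\<dots> \<le> (\<integral>\<^sup>+s. \<Phi> s \<partial>M 0)" by (rule tele)
  also have "\<dots> \<le> ennreal (gap x0)" using \<Phi>0 by (simp add: M0)
  finally have le: "ennreal a * (\<Sum>k=1..N. ?E k) \<le> ennreal (gap x0)" by (simp add: sum_distrib_left)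
  have "(\<Sum>k=1..N. ?E k) = ennreal (1 / a) * (ennreal a * (\<Sum>k=1..N. ?E k))"
    using a by (simp add: mult.assoc[symmetric] flip: ennreal_mult')
  also have "\<dots> \<le> ennreal (1 / a) * ennreal (gap x0)" using le by (rule mult_left_mono) simp
  also have "\<dots> = ennreal (250 * dist_factor L Lu * initial_gap n f r x0)"
    using a by (simp add: a_def initial_gap_eq[OF x0] flip: ennreal_mult')
  finally show ?thesis .
qed

end

section \<open>Parameters\<close>

lemma nat_floor_bounds:
  fixes x :: real
  assumes "1 \<le> nat \<lfloor>x\<rfloor>"
  shows "real (nat \<lfloor>x\<rfloor>) \<le> x" and "x < real (nat \<lfloor>x\<rfloor>) + 1" and "x / 2 \<le> real (nat \<lfloor>x\<rfloor>)"
  using assms by linarith+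

lemma cube_root_floor_unique:
  fixes b c N :: nat
  assumes "b ^ 3 \<le> N" "N < (b + 1) ^ 3" "c ^ 3 \<le> N" "N < (c + 1) ^ 3"
  shows "b = c"
proof -
  have "b < c + 1" using le_less_trans[OF assms(1,4)] by (rule power_less_imp_less_base) simp
  moreover have "c < b + 1" using le_less_trans[OF assms(3,2)] by (rule power_less_imp_less_base) simp
  ultimately show ?thesis by simp
qed

lemma saga_batch_cube:
  assumes "1 \<le> saga_batch n"
  shows "saga_batch n ^ 3 \<le> 16 * n\<^sup>2" and "16 * n\<^sup>2 < (saga_batch n + 1) ^ 3"
proof -
  define x where "x = 4 powr (2/3) * real n powr (2/3)"
  have x3: "x ^ 3 = real (16 * n\<^sup>2)"
  proof (cases "n = 0")
    case False
    have "x ^ 3 = (4 powr (2/3)) ^ 3 * (real n powr (2/3)) ^ 3" by (simp add: x_def power_mult_distrib)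
    also have "\<dots> = 4 powr 2 * real n powr 2" using False by (simp add: powr_power)
    finally show ?thesis using False by simp
  qed (simp add: x_def)
  have b: "real (saga_batch n) \<le> x" "x < real (saga_batch n) + 1"
    using assms nat_floor_bounds[of x] unfolding saga_batch_def x_def by auto
  have "real (saga_batch n ^ 3) \<le> x ^ 3" using power_mono[OF b(1), of 3] by simp
  then show "saga_batch n ^ 3 \<le> 16 * n\<^sup>2" unfolding x3 by (simp only: of_nat_le_iff)
  have "x ^ 3 < real ((saga_batch n + 1) ^ 3)"
    using power_strict_mono[OF b(2), of 3] by (simp add: x_def add.commute)
  then show "16 * n\<^sup>2 < (saga_batch n + 1) ^ 3" unfolding x3 by (simp only: of_nat_less_iff)
qed

text \<open>What the SAGA analysis asks of a contraction factor \<open>t\<close>: the two alternatives lead to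
  \<open>absorbs_0\<close> and to \<open>absorbs_two_fifths\<close>.\<close>

definition saga_factor :: "nat \<Rightarrow> nat \<Rightarrow> real \<Rightarrow> bool" where
  "saga_factor n b t \<longleftrightarrow> 0 < t \<and> t < 1 \<and> (1 - 1 / real n) ^ b \<le> t\<^sup>2 \<and>
     (21 / 10 \<le> real b * (1 - t)\<^sup>2 \<or> 19 / 10 \<le> real b * (1 - t)\<^sup>2 \<and> 2 / 5 \<le> 1 - t)"

text \<open>For small \<open>n\<close>, where the rounding of the batch size matters, the triples \<open>(n, b, 100 t)\<close>
  list the batch size and a factor. For \<open>n = 1\<close> and for \<open>n = 9\<close> no factor reaches
  \<open>b (1 - t)\<^sup>2 = 2\<close>, so the second alternative cannot be dispensed with.\<close>

definition small_saga_factors :: "(nat \<times> nat \<times> nat) list" where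
  "small_saga_factors = [(1, 2, 1), (2, 4, 25), (3, 5, 37), (4, 6, 43), (5, 7, 46), (6, 8, 49),
     (7, 9, 50), (8, 10, 52), (9, 10, 56), (10, 11, 57), (11, 12, 57), (12, 13, 57), (13, 13, 60),
     (14, 14, 60), (15, 15, 60), (16, 16, 60), (17, 16, 62), (18, 17, 62), (19, 17, 64),
     (20, 18, 64), (21, 19, 63), (22, 19, 65), (23, 20, 65), (24, 20, 66)]"

lemma small_saga_factors_valid:
  "list_all (\<lambda>(n, b, k). 1 \<le> n \<and> b ^ 3 \<le> 16 * n\<^sup>2 \<and> 16 * n\<^sup>2 < (b + 1) ^ 3 \<and> 0 < k \<and> k < 100 \<and>
     (n - 1) ^ b * 10000 \<le> k\<^sup>2 * n ^ b \<and>
     (21000 \<le> b * (100 - k)\<^sup>2 \<or> 19000 \<le> b * (100 - k)\<^sup>2 \<and> k \<le> 60)) small_saga_factors"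
  by (simp add: small_saga_factors_def)

lemma saga_factor_small:
  assumes "1 \<le> n" "n \<le> 24" "1 \<le> saga_batch n"
  shows "\<exists>t. saga_factor n (saga_batch n) t"
proof -
  have "n \<in> {1..24}" using assms by simp
  also have "{1..24} = fst ` set small_saga_factors"
    by (simp add: small_saga_factors_def atLeastAtMost_insertL[symmetric] numeral_eq_Suc
        atLeastAtMostSuc_conv insert_commute)
  finally obtain b k where mem: "(n, b, k) \<in> set small_saga_factors" by force
  then have v: "b ^ 3 \<le> 16 * n\<^sup>2" "16 * n\<^sup>2 < (b + 1) ^ 3" "0 < k" "k < 100"
      "(n - 1) ^ b * 10000 \<le> k\<^sup>2 * n ^ b"
      "21000 \<le> b * (100 - k)\<^sup>2 \<or> 19000 \<le> b * (100 - k)\<^sup>2 \<and> k \<le> 60"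
    using small_saga_factors_valid by (auto simp: list_all_iff)
  have b: "saga_batch n = b"
    using saga_batch_cube[OF assms(3)] v(1,2) by (rule cube_root_floor_unique)
  define t where "t = real k / 100"
  have "real ((n - 1) ^ b * 10000) \<le> real (k\<^sup>2 * n ^ b)" using v(5) by (simp only: of_nat_le_iff)
  then have "(real n - 1) ^ b * 10000 \<le> (real k)\<^sup>2 * real n ^ b" using assms(1) by (simp add: of_nat_diff)
  moreover have "1 - 1 / real n = (real n - 1) / real n" using assms(1) by (simp add: field_simps)
  ultimately have q: "(1 - 1 / real n) ^ b \<le> t\<^sup>2"
    using assms(1) by (simp add: t_def power_divide field_simps)
  have bt: "real b * (1 - t)\<^sup>2 = real (b * (100 - k)\<^sup>2) / 10000"
    using v(4) by (simp add: t_def of_nat_diff power2_eq_square field_simps)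
  have "21 / 10 \<le> real b * (1 - t)\<^sup>2 \<or> 19 / 10 \<le> real b * (1 - t)\<^sup>2 \<and> 2 / 5 \<le> 1 - t"
    using v(6)
  proof
    assume "21000 \<le> b * (100 - k)\<^sup>2"
    then have "real 21000 \<le> real (b * (100 - k)\<^sup>2)" by (simp only: of_nat_le_iff)
    then show ?thesis unfolding bt by simp
  next
    assume "19000 \<le> b * (100 - k)\<^sup>2 \<and> k \<le> 60"
    then have "real 19000 \<le> real (b * (100 - k)\<^sup>2)" "k \<le> 60" by (simp_all only: of_nat_le_iff)
    then show ?thesis unfolding bt by (simp add: t_def)
  qed
  with q have "saga_factor n b t" using v(3,4) by (simp add: saga_factor_def t_def)
  then show ?thesis unfolding b by blast
qed

lemma exp_minus_le:
  fixes x :: real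
  assumes "0 \<le> x"
  shows "exp (- x) \<le> 1 - x + x\<^sup>2 / 2"
proof -
  have "1 \<le> (1 - x + x\<^sup>2 / 2) * (1 + x + x\<^sup>2 / 2)"
  proof -
    have "(1 - x + x\<^sup>2 / 2) * (1 + x + x\<^sup>2 / 2) = 1 + (x\<^sup>2)\<^sup>2 / 4"
      by (simp add: algebra_simps power2_eq_square)
    then show ?thesis by simp
  qed
  also have "\<dots> \<le> (1 - x + x\<^sup>2 / 2) * exp x"
  proof (rule mult_left_mono)
    show "1 + x + x\<^sup>2 / 2 \<le> exp x" by (rule exp_lower_Taylor_quadratic[OF assms])
    have "1 - x + x\<^sup>2 / 2 = ((1 - x)\<^sup>2 + 1) / 2" by (simp add: power2_eq_square algebra_simps)
    also have "0 \<le> \<dots>" by (intro divide_nonneg_nonneg add_nonneg_nonneg) auto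
    finally show "0 \<le> 1 - x + x\<^sup>2 / 2" .
  qed
  finally show ?thesis by (simp add: exp_minus field_simps)
qed

text \<open>For large \<open>n\<close>, \<open>(1 - 1/n)\<^sup>b \<le> exp (- b/n)\<close> has a square root close to \<open>1 - b/(2n)\<close>, so
  \<open>b (1 - t)\<^sup>2\<close> is close to \<open>b\<^sup>3/(4 n\<^sup>2)\<close>, which is nearly \<open>4\<close>.\<close>

lemma saga_factor_large:
  assumes n: "25 \<le> n" and b1: "1 \<le> saga_batch n"
  shows "\<exists>t. saga_factor n (saga_batch n) t"
proof -
  define b where "b = saga_batch n"
  define N B where "N = real n" and "B = real b"
  define s where "s = B / (4 * N)"
  define t where "t = 1 - 2 * s + 2 * s\<^sup>2"
  have N: "25 \<le> N" using n by (simp add: N_def)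
  have "16 * 25\<^sup>2 \<le> 16 * n\<^sup>2" using n by (intro mult_left_mono power_mono) auto
  then have "21 ^ 3 < (b + 1) ^ 3" using saga_batch_cube(2)[OF b1] unfolding b_def by simp
  then have "21 < b + 1" by (rule power_less_imp_less_base) simp
  then have B: "21 \<le> B" by (simp add: B_def)
  have "real (b ^ 3) \<le> real (16 * n\<^sup>2)"
    using saga_batch_cube(1)[OF b1] unfolding b_def by (simp only: of_nat_le_iff)
  then have up: "B ^ 3 \<le> 16 * N\<^sup>2" by (simp add: B_def N_def)
  have "real (16 * n\<^sup>2) \<le> real ((b + 1) ^ 3)"
    using saga_batch_cube(2)[OF b1] unfolding b_def by (simp only: of_nat_le_iff)
  then have low: "16 * N\<^sup>2 \<le> (B + 1) ^ 3" by (simp add: B_def N_def add.commute)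
  have s0: "0 < s" using B N by (simp add: s_def)
  \<comment> \<open>\<open>0.2155\<close> is just above the cube root of \<open>1/100\<close>.\<close>
  have s1: "s \<le> 2155 / 10000"
  proof -
    have "s ^ 3 = B ^ 3 / (64 * N ^ 3)" by (simp add: s_def power_divide power_mult_distrib)
    also have "\<dots> \<le> 16 * N\<^sup>2 / (64 * N ^ 3)" using up N by (intro divide_right_mono) auto
    also have "\<dots> = 1 / (4 * N)" using N by (simp add: power3_eq_cube power2_eq_square)
    also have "\<dots> \<le> 1 / 100" using N by (simp add: field_simps)
    also have "\<dots> \<le> (2155 / 10000) ^ 3" by (simp add: power_divide)
    finally show ?thesis by (rule power_le_imp_le_base[of _ 2, simplified]) simp
  qed
  have t01: "0 < t" "t < 1"
  proof -
    have "t = (1 - s)\<^sup>2 + s\<^sup>2" by (simp add: t_def power2_eq_square algebra_simps)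
    then show "0 < t" using s0 by (simp add: add_nonneg_pos)
    have "s * s < 1 * s" using s0 s1 by (intro mult_strict_right_mono) auto
    then show "t < 1" by (simp add: t_def power2_eq_square)
  qed
  have q: "(1 - 1 / real n) ^ b \<le> t\<^sup>2"
  proof -
    have "(1 - 1 / N) ^ b \<le> exp (- 1 / N) ^ b"
      using N exp_ge_add_one_self[of "- 1 / N"] by (intro power_mono) auto
    also have "\<dots> = exp (- (2 * s)) ^ 2"
      using N by (simp add: s_def B_def field_simps flip: exp_of_nat_mult)
    also have "\<dots> \<le> t ^ 2"
      using exp_minus_le[of "2 * s"] s0 by (intro power_mono) (auto simp: t_def power_mult_distrib)
    finally show ?thesis by (simp add: N_def)
  qed
  have ratio: "86 / 100 * (B + 1) ^ 3 \<le> B ^ 3"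
  proof -
    have "21 / 22 * (B + 1) \<le> B" using B by simp
    then have "(21 / 22 * (B + 1)) ^ 3 \<le> B ^ 3" using B by (intro power_mono) auto
    moreover have "86 / 100 * (B + 1) ^ 3 \<le> (21 / 22 * (B + 1)) ^ 3"
      unfolding power_mult_distrib using B by (intro mult_right_mono) (auto simp: power_divide)
    ultimately show ?thesis by linarith
  qed
  \<comment> \<open>\<open>3.44 = 4 \<cdot> 0.86\<close> bounds \<open>b\<^sup>3/(4 n\<^sup>2)\<close> from below.\<close>
  have "(21 / 10 :: real) \<le> 344 / 100 * (1 - 2155 / 10000)\<^sup>2" by (simp add: power2_eq_square)
  also have "\<dots> \<le> 344 / 100 * (1 - s)\<^sup>2" using s1 s0 by (intro mult_left_mono power_mono) auto
  also have "\<dots> \<le> B ^ 3 / (4 * N\<^sup>2) * (1 - s)\<^sup>2"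
  proof (rule mult_right_mono)
    have "344 / 100 * (4 * N\<^sup>2) \<le> B ^ 3" using ratio low by linarith
    then show "344 / 100 \<le> B ^ 3 / (4 * N\<^sup>2)" using N by (simp add: field_simps)
  qed simp
  also have "\<dots> = B * (1 - t)\<^sup>2"
  proof -
    have "1 - t = 2 * s * (1 - s)" by (simp add: t_def power2_eq_square algebra_simps)
    then have "B * (1 - t)\<^sup>2 = B * (4 * s\<^sup>2) * (1 - s)\<^sup>2" by (simp add: power_mult_distrib)
    also have "B * (4 * s\<^sup>2) = B ^ 3 / (4 * N\<^sup>2)"
      using N by (simp add: s_def power_divide power_mult_distrib power2_eq_square power3_eq_cube)
    finally show ?thesis by simp
  qed
  finally show ?thesis
    using t01 q unfolding saga_factor_def B_def b_def by blast
qed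

lemma svrg_period_square:
  assumes "1 \<le> svrg_batch n" "1 \<le> svrg_period n"
  shows "16 * (real (svrg_period n))\<^sup>2 \<le> real (svrg_batch n)"
proof -
  have "real (svrg_period n) \<le> sqrt (real (svrg_batch n)) / 4"
    using assms(2) unfolding svrg_period_def by (rule nat_floor_bounds)
  then have "4 * real (svrg_period n) \<le> sqrt (real (svrg_batch n))" by simp
  then have "(4 * real (svrg_period n))\<^sup>2 \<le> (sqrt (real (svrg_batch n)))\<^sup>2" by (intro power_mono) auto
  then show ?thesis by (simp add: power_mult_distrib)
qed

lemma sarah_period_le:
  assumes "1 \<le> sarah_batch n" "1 \<le> sarah_period n"
  shows "4 * sarah_period n \<le> sarah_batch n"
proof -
  have "real (sarah_period n) \<le> real (sarah_batch n) / 4"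
    using assms(2) unfolding sarah_period_def by (rule nat_floor_bounds)
  then show ?thesis by simp
qed

lemma saga_cost_bound:
  assumes "1 \<le> saga_batch n"
  shows "real (saga_batch n) \<le> 18 * real n powr (2/3)"
proof -
  have "real (saga_batch n) \<le> 4 powr (2/3) * real n powr (2/3)"
    using assms unfolding saga_batch_def by (rule nat_floor_bounds)
  also have "\<dots> \<le> 18 * real n powr (2/3)"
  proof (rule mult_right_mono)
    have "4 powr (2/3) \<le> (4::real) powr 1" by (rule powr_mono) auto
    then show "4 powr (2/3) \<le> (18::real)" by simp
  qed simp
  finally show ?thesis .
qed

lemma svrg_cost_bound:
  assumes "1 \<le> svrg_batch n" "1 \<le> svrg_period n"
  shows "2 * real (svrg_batch n) + real n / real (svrg_period n) \<le> 18 * real n powr (2/3)"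
proof -
  define c where "c = real n powr (1/3)"
  have n: "0 < n" using assms(1) by (cases n) (auto simp: svrg_batch_def)
  have c: "0 < c" "c\<^sup>2 = real n powr (2/3)" "c ^ 3 = real n"
    using n by (auto simp: c_def powr_power)
  have b: "real (svrg_batch n) \<le> c\<^sup>2" "c\<^sup>2 / 2 \<le> real (svrg_batch n)"
    using nat_floor_bounds[of "c\<^sup>2"] assms(1) c(2) unfolding svrg_batch_def by auto
  have "(c / 2)\<^sup>2 \<le> real (svrg_batch n)"
    using b(2) zero_le_power2[of c] by (simp add: power_divide del: zero_le_power2)
  then have "c / 2 \<le> sqrt (real (svrg_batch n))" by (rule real_le_rsqrt)
  moreover have "sqrt (real (svrg_batch n)) / 4 / 2 \<le> real (svrg_period n)"
    using assms(2) unfolding svrg_period_def by (rule nat_floor_bounds)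
  ultimately have m: "c / 16 \<le> real (svrg_period n)" by simp
  have "real n / real (svrg_period n) \<le> real n / (c / 16)"
    using m c(1) assms(2) by (intro divide_left_mono) auto
  also have "\<dots> = 16 * c\<^sup>2" using c(1) by (simp add: c(3)[symmetric] power3_eq_cube power2_eq_square)
  finally show ?thesis using b(1) c(2) by simp
qed

lemma sarah_cost_bound:
  assumes "1 \<le> sarah_batch n" "1 \<le> sarah_period n"
  shows "2 * real (sarah_batch n) + real n / real (sarah_period n) \<le> 18 * real n powr (1/2)"
proof -
  define c where "c = real n powr (1/2)"
  have n: "0 < n" using assms(1) by (cases n) (auto simp: sarah_batch_def)
  have c: "0 < c" "c\<^sup>2 = real n"
    using n by (auto simp: c_def powr_power)
  have b: "real (sarah_batch n) \<le> c" "c / 2 \<le> real (sarah_batch n)"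
    using nat_floor_bounds[of c] assms(1) unfolding sarah_batch_def c_def by auto
  have "real (sarah_batch n) / 4 / 2 \<le> real (sarah_period n)"
    using assms(2) unfolding sarah_period_def by (rule nat_floor_bounds)
  then have m: "c / 16 \<le> real (sarah_period n)" using b(2) by simp
  have "real n / real (sarah_period n) \<le> real n / (c / 16)"
    using m c(1) assms(2) by (intro divide_left_mono) auto
  also have "\<dots> = 16 * c" using c(1) by (simp add: c(2)[symmetric] power2_eq_square)
  finally show ?thesis using b(1) unfolding c_def by simp
qed

section \<open>The three algorithms\<close>

lemma potential_weight:
  assumes "1 \<le> b" "t < 1"
  obtains \<kappa> where "0 < \<kappa>" "251 / 250 \<le> \<kappa> * (1 - t) * real b"
    "\<kappa> / (1 - t) = (251 / 250) / (real b * (1 - t)\<^sup>2)"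
proof (rule that[of "(251 / 250) / (real b * (1 - t))"])
  have nz: "0 < real b * (1 - t)" using assms by simp
  then show "0 < (251 / 250) / (real b * (1 - t))" by (rule divide_pos_pos[rotated]) simp
  have "(251 / 250) / (real b * (1 - t)) * (real b * (1 - t)) = 251 / 250"
    using nz by (metis less_irrefl nonzero_divide_eq_eq)
  then show "251 / 250 \<le> (251 / 250) / (real b * (1 - t)) * (1 - t) * real b"
    by (simp only: mult.assoc mult.commute[of "1 - t"] order_refl)
qed (simp add: power2_eq_square)

lemma finite_set_sample:
  "1 \<le> n \<Longrightarrow> finite (set_pmf (pair_pmf (batch_pmf n b) (bernoulli_pmf q)))"
  using finite_set_batch_pmf by (simp add: finite_subset[OF subset_UNIV])

context mm_problem
begin

lemma saga_step_eq:
  "saga_step n f u L b (x, w, c) = map_pmf (\<lambda>I. (update x (grad x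
      + batch_error n b (\<lambda>i. gradient (f i) x - gradient (f i) (w i)) I),
      \<lambda>i. if i \<in> set I then x else w i, c + b)) (batch_pmf n b)"
  unfolding saga_step_def map_pmf_def Let_def
  by (simp add: batch_error_def mean_diff grad_eq_mean[of x] mean_def[of n "\<lambda>i. gradient (f i) (w i)"]
      algebra_simps)

lemma svrg_step_eq:
  "svrg_step n f u L b m (x, y, c) = map_pmf (\<lambda>(I, renew). (update x (grad x
      + batch_error n b (\<lambda>i. gradient (f i) x - gradient (f i) (if renew then x else y)) I),
      if renew then x else y, c + 2 * b + (if renew then n else 0)))
      (pair_pmf (batch_pmf n b) (bernoulli_pmf (1 / real m)))"
  unfolding svrg_step_def map_pmf_def pair_pmf_def Let_def
  by (simp add: batch_error_def mean_diff grad_eq_mean bind_assoc_pmf bind_return_pmf algebra_simps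
      cong: if_cong)

lemma sarah_step_eq:
  "sarah_step n f u L b m (x, y, g, c) = map_pmf (\<lambda>(I, reset).
      let g' = if reset then grad x
        else grad x + batch_error n b (\<lambda>i. gradient (f i) x - gradient (f i) y) I + (g - grad y)
      in (update x g', x, g', c + (if reset then n else 2 * b)))
      (pair_pmf (batch_pmf n b) (bernoulli_pmf (1 / real m)))"
  unfolding sarah_step_def map_pmf_def pair_pmf_def Let_def
  by (simp add: batch_error_def grad_diff[symmetric] bind_assoc_pmf bind_return_pmf algebra_simps
      cong: if_cong)

text \<open>At the start the memory of each algorithm agrees with \<open>x\<^sup>0\<close>, so the initial potential is the
  initial gap.\<close>

lemma saga_sum_dist:
  assumes b: "1 \<le> b" and t: "saga_factor n b t" and x0: "r x0 < \<infinity>"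
    and Lu: "subdiff_constant_on r u \<Omega> Lu"
  defines "P \<equiv> \<lambda>k. map_pmf (\<lambda>(x, w, c). (x, c)) (mm_saga n f u L b x0 k)"
  assumes \<Omega>: "\<And>k. k \<le> N \<Longrightarrow> fst ` set_pmf (P k) \<subseteq> \<Omega>"
  shows "(\<Sum>k=1..N. expected_dist_sq (objective n f r) P k)
    \<le> ennreal (250 * dist_factor L Lu * initial_gap n f r x0)"
proof -
  have t': "0 < t" "t < 1" "(1 - 1 / real n) ^ b \<le> t\<^sup>2" using t by (auto simp: saga_factor_def)
  obtain \<kappa> where \<kappa>0: "0 < \<kappa>" and \<kappa>: "251 / 250 \<le> \<kappa> * (1 - t) * real b"
    and K: "\<kappa> / (1 - t) = (251 / 250) / (real b * (1 - t)\<^sup>2)"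
    using potential_weight[OF b t'(2)] .
  \<comment> \<open>\<open>251/250\<close> divided by \<open>21/10\<close> is below \<open>49/100\<close>, and divided by \<open>19/10\<close> below \<open>53/100\<close>.\<close>
  obtain \<eta> where \<eta>: "0 \<le> \<eta>" "\<eta> \<le> 1 - t" and abs: "absorbs (\<kappa> / (1 - t)) \<eta> TYPE('a)"
  proof (cases "21 / 10 \<le> real b * (1 - t)\<^sup>2")
    case True
    then have "(251 / 250) / (real b * (1 - t)\<^sup>2) \<le> (251 / 250) / (21 / 10)"
      by (intro divide_left_mono) auto
    then have "absorbs (\<kappa> / (1 - t)) 0 TYPE('a)" unfolding K by (intro absorbs_0) simp
    then show thesis using t' by (intro that[of 0]) auto
  next
    case False
    then have c: "19 / 10 \<le> real b * (1 - t)\<^sup>2" "2 / 5 \<le> 1 - t"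
      using t by (auto simp: saga_factor_def)
    then have "(251 / 250) / (real b * (1 - t)\<^sup>2) \<le> (251 / 250) / (19 / 10)"
      by (intro divide_left_mono) auto
    then have "absorbs (\<kappa> / (1 - t)) (2 / 5) TYPE('a)"
      unfolding K by (intro absorbs_two_fifths) auto
    then show thesis using c by (intro that[of "2 / 5"]) auto
  qed
  define \<Phi> where "\<Phi> = (\<lambda>(x, w, c :: nat). potential x (\<kappa> / L
    * moment \<eta> n (\<lambda>i. gradient (f i) x - gradient (f i) (w i))))"
  show ?thesis
    unfolding P_def
  proof (rule chain_expected_dist[where step = "saga_step n f u L b" and \<Phi> = \<Phi> and \<Omega> = \<Omega>])
    fix s :: "'a \<times> (nat \<Rightarrow> 'a) \<times> nat"
    obtain x w c where s: "s = (x, w, c)" by (cases s)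
    assume x\<Omega>: "fst (case s of (x, w, c) \<Rightarrow> (x, c)) \<in> \<Omega>"
      and p\<Omega>: "\<And>s'. s' \<in> set_pmf (saga_step n f u L b s) \<Longrightarrow> fst (case s' of (x, w, c) \<Rightarrow> (x, c)) \<in> \<Omega>"
    show "(\<integral>\<^sup>+s'. \<Phi> s' + ennreal (1 / (250 * dist_factor L Lu))
        * dist_sq (fst (case s' of (x, w, c) \<Rightarrow> (x, c))) \<partial>saga_step n f u L b s) \<le> \<Phi> s"
    proof -
      define W G where "W I i = (if i \<in> set I then x else w i)"
        and "G I = grad x + batch_error n b (\<lambda>i. gradient (f i) x - gradient (f i) (w i)) I"
        for I :: "nat list" and i
      have step: "saga_step n f u L b s
          = map_pmf (\<lambda>I. (update x (G I), W I, c + b)) (batch_pmf n b)"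
        unfolding s saga_step_eq G_def W_def ..
      show ?thesis
        unfolding step nn_integral_map_pmf
        unfolding s \<Phi>_def prod.case fst_conv
      proof (rule potential_decrease[OF finite_set_batch_pmf[OF n_ge_1] Lu])
        show "x \<in> \<Omega>" using x\<Omega> s by simp
        show "update x (G I) \<in> \<Omega>" if "I \<in> set_pmf (batch_pmf n b)" for I
          using p\<Omega> that unfolding step set_map_pmf by force
        show "0 \<le> \<kappa> / L * moment \<eta> n (\<lambda>i. gradient (f i) (update x (G I)) - gradient (f i) (W I i))"
          for I
          using \<kappa>0 L_pos \<eta> t' n_ge_1 by (intro mult_nonneg_nonneg moment_nonneg) auto
      next
        assume "r x < \<infinity>"
        then show "measure_pmf.expectation (batch_pmf n b) (\<lambda>I. gap (update x (G I)) + \<kappa> / L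
              * moment \<eta> n (\<lambda>i. gradient (f i) (update x (G I)) - gradient (f i) (W I i))
              + progress x (G I) (update x (G I)) / 250)
            \<le> gap x + \<kappa> / L * moment \<eta> n (\<lambda>i. gradient (f i) x - gradient (f i) (w i))"
          unfolding G_def W_def by (rule saga_potential_step[OF _ b t' \<eta> \<kappa> abs])
      qed
    qed
  next
    show "\<Phi> (x0, \<lambda>i. x0, 0) \<le> ennreal (gap x0)"
      using x0 by (simp add: \<Phi>_def potential_def moment_def mean_def)
  qed (use \<Omega> x0 in \<open>auto simp: P_def\<close>)
qed

lemma svrg_sum_dist:
  assumes b: "1 \<le> b" and m: "1 \<le> m" "16 * (real m)\<^sup>2 \<le> real b" and x0: "r x0 < \<infinity>"
    and Lu: "subdiff_constant_on r u \<Omega> Lu"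
  defines "P \<equiv> \<lambda>k. map_pmf (\<lambda>(x, y, c). (x, c)) (mm_svrg n f u L b m x0 k)"
  assumes \<Omega>: "\<And>k. k \<le> N \<Longrightarrow> fst ` set_pmf (P k) \<subseteq> \<Omega>"
  shows "(\<Sum>k=1..N. expected_dist_sq (objective n f r) P k)
    \<le> ennreal (250 * dist_factor L Lu * initial_gap n f r x0)"
proof -
  define t where "t = 1 - 1 / (2 * real m)"
  have t: "0 < t" "t < 1" "1 - 1 / real m \<le> t\<^sup>2"
    using m(1) by (auto simp: t_def power2_eq_square algebra_simps)
  obtain \<kappa> where \<kappa>0: "0 < \<kappa>" and \<kappa>: "251 / 250 \<le> \<kappa> * (1 - t) * real b"
    and K: "\<kappa> / (1 - t) = (251 / 250) / (real b * (1 - t)\<^sup>2)"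
    using potential_weight[OF b t(2)] .
  have "4 \<le> real b * (1 - t)\<^sup>2"
    using m by (simp add: t_def power2_eq_square field_simps)
  then have "(251 / 250) / (real b * (1 - t)\<^sup>2) \<le> (251 / 250) / 4"
    by (intro divide_left_mono) auto
  also have "\<dots> \<le> (49 / 100 :: real)" by simp
  finally have abs: "absorbs (\<kappa> / (1 - t)) 0 TYPE('a)" unfolding K by (rule absorbs_0)
  define \<Phi> where "\<Phi> = (\<lambda>(x, y, c :: nat). potential x (\<kappa> / L
    * mean n (\<lambda>i. (norm (gradient (f i) x - gradient (f i) y))\<^sup>2)))"
  show ?thesis
    unfolding P_def
  proof (rule chain_expected_dist[where step = "svrg_step n f u L b m" and \<Phi> = \<Phi> and \<Omega> = \<Omega>])
    fix s :: "'a \<times> 'a \<times> nat"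
    obtain x y c where s: "s = (x, y, c)" by (cases s)
    assume x\<Omega>: "fst (case s of (x, y, c) \<Rightarrow> (x, c)) \<in> \<Omega>"
      and p\<Omega>: "\<And>s'. s' \<in> set_pmf (svrg_step n f u L b m s) \<Longrightarrow> fst (case s' of (x, y, c) \<Rightarrow> (x, c)) \<in> \<Omega>"
    show "(\<integral>\<^sup>+s'. \<Phi> s' + ennreal (1 / (250 * dist_factor L Lu))
        * dist_sq (fst (case s' of (x, y, c) \<Rightarrow> (x, c))) \<partial>svrg_step n f u L b m s) \<le> \<Phi> s"
    proof -
      let ?Q = "pair_pmf (batch_pmf n b) (bernoulli_pmf (1 / real m))"
      define Y G where "Y \<omega> = (if snd \<omega> then x else y)"
        and "G \<omega> = grad x + batch_error n b (\<lambda>i. gradient (f i) x - gradient (f i) (Y \<omega>)) (fst \<omega>)"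
        for \<omega> :: "nat list \<times> bool"
      have step: "svrg_step n f u L b m s
          = map_pmf (\<lambda>\<omega>. (update x (G \<omega>), Y \<omega>, c + 2 * b + (if snd \<omega> then n else 0))) ?Q"
        unfolding s svrg_step_eq G_def Y_def case_prod_beta ..
      show ?thesis
        unfolding step nn_integral_map_pmf
        unfolding s \<Phi>_def prod.case fst_conv
      proof (rule potential_decrease[OF finite_set_sample[OF n_ge_1] Lu])
        show "x \<in> \<Omega>" using x\<Omega> s by simp
        show "update x (G \<omega>) \<in> \<Omega>" if "\<omega> \<in> set_pmf ?Q" for \<omega>
          using p\<Omega> that unfolding step set_map_pmf by force
      next
        assume "r x < \<infinity>"
        from svrg_potential_step[OF this b m(1) t \<kappa> abs, of y]
        show "measure_pmf.expectation ?Q (\<lambda>\<omega>. gap (update x (G \<omega>)) + \<kappa> / L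
              * mean n (\<lambda>i. (norm (gradient (f i) (update x (G \<omega>)) - gradient (f i) (Y \<omega>)))\<^sup>2)
              + progress x (G \<omega>) (update x (G \<omega>)) / 250)
            \<le> gap x + \<kappa> / L * mean n (\<lambda>i. (norm (gradient (f i) x - gradient (f i) y))\<^sup>2)"
          unfolding case_prod_beta G_def Y_def .
      qed (use \<kappa>0 L_pos in \<open>intro mult_nonneg_nonneg mean_nonneg; simp\<close>)
    qed
  next
    show "\<Phi> (x0, x0, 0) \<le> ennreal (gap x0)"
      using x0 by (simp add: \<Phi>_def potential_def mean_def)
  qed (use \<Omega> x0 in \<open>auto simp: P_def\<close>)
qed

lemma sarah_sum_dist:
  assumes m: "1 \<le> m" "4 * m \<le> b" and x0: "r x0 < \<infinity>"
    and Lu: "subdiff_constant_on r u \<Omega> Lu"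
  defines "P \<equiv> \<lambda>k. map_pmf (\<lambda>(x, xp, g, c). (x, c)) (mm_sarah n f u L b m x0 k)"
  assumes \<Omega>: "\<And>k. k \<le> N \<Longrightarrow> fst ` set_pmf (P k) \<subseteq> \<Omega>"
  shows "(\<Sum>k=1..N. expected_dist_sq (objective n f r) P k)
    \<le> ennreal (250 * dist_factor L Lu * initial_gap n f r x0)"
proof -
  define A where "A = 5 / 4 * (real m - 1)"
  have A: "0 \<le> A" using m by (simp add: A_def)
  define \<Phi> where "\<Phi> = (\<lambda>(x, y, g, c :: nat). potential x (A / L
    * ((norm (g - grad y))\<^sup>2 + increment b x y)))"
  show ?thesis
    unfolding P_def
  proof (rule chain_expected_dist[where step = "sarah_step n f u L b m" and \<Phi> = \<Phi> and \<Omega> = \<Omega>])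
    fix s :: "'a \<times> 'a \<times> 'a \<times> nat"
    obtain x y g c where s: "s = (x, y, g, c)" by (cases s)
    assume x\<Omega>: "fst (case s of (x, y, g, c) \<Rightarrow> (x, c)) \<in> \<Omega>"
      and p\<Omega>: "\<And>s'. s' \<in> set_pmf (sarah_step n f u L b m s) \<Longrightarrow>
        fst (case s' of (x, y, g, c) \<Rightarrow> (x, c)) \<in> \<Omega>"
    show "(\<integral>\<^sup>+s'. \<Phi> s' + ennreal (1 / (250 * dist_factor L Lu))
        * dist_sq (fst (case s' of (x, y, g, c) \<Rightarrow> (x, c))) \<partial>sarah_step n f u L b m s) \<le> \<Phi> s"
    proof -
      let ?Q = "pair_pmf (batch_pmf n b) (bernoulli_pmf (1 / real m))"
      define G where "G \<omega> = (if snd \<omega> then grad x else grad x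
          + batch_error n b (\<lambda>i. gradient (f i) x - gradient (f i) y) (fst \<omega>) + (g - grad y))"
        for \<omega> :: "nat list \<times> bool"
      have step: "sarah_step n f u L b m s
          = map_pmf (\<lambda>\<omega>. (update x (G \<omega>), x, G \<omega>, c + (if snd \<omega> then n else 2 * b))) ?Q"
        unfolding s sarah_step_eq G_def case_prod_beta Let_def ..
      show ?thesis
        unfolding step nn_integral_map_pmf
        unfolding s \<Phi>_def prod.case fst_conv
      proof (rule potential_decrease[OF finite_set_sample[OF n_ge_1] Lu])
        show "x \<in> \<Omega>" using x\<Omega> s by simp
        show "update x (G \<omega>) \<in> \<Omega>" if "\<omega> \<in> set_pmf ?Q" for \<omega>
          using p\<Omega> that unfolding step set_map_pmf by force
      next
        assume "r x < \<infinity>"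
        from sarah_potential_step[OF this m, where y = y and g = g]
        show "measure_pmf.expectation ?Q (\<lambda>\<omega>. gap (update x (G \<omega>)) + A / L
              * ((norm (G \<omega> - grad x))\<^sup>2 + increment b (update x (G \<omega>)) x)
              + progress x (G \<omega>) (update x (G \<omega>)) / 250)
            \<le> gap x + A / L * ((norm (g - grad y))\<^sup>2 + increment b x y)"
          unfolding case_prod_beta G_def A_def .
      qed (use A L_pos increment_nonneg in \<open>auto intro!: mult_nonneg_nonneg add_nonneg_nonneg\<close>)
    qed
  next
    show "\<Phi> (x0, x0, grad x0, 0) \<le> ennreal (gap x0)"
      using x0 by (simp add: \<Phi>_def potential_def increment_def)
  qed (use \<Omega> x0 in \<open>auto simp: P_def\<close>)
qed

end

text \<open>An iteration with two possible costs, chosen by a coin of bias \<open>1/m\<close>.\<close>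

lemma nn_integral_bernoulli_cost:
  assumes "1 \<le> m"
  shows "(\<integral>\<^sup>+\<omega>. of_nat (c + (if snd \<omega> then p else q)) \<partial>pair_pmf Q (bernoulli_pmf (1 / real m)))
    \<le> of_nat c + ennreal (real q + real p / real m)"
proof -
  have "(\<integral>\<^sup>+z. of_nat (c + (if z then p else q)) \<partial>bernoulli_pmf (1 / real m))
      = of_nat (c + p) * ennreal (1 / real m) + of_nat (c + q) * ennreal (1 - 1 / real m)"
    using assms by simp
  also have "\<dots> = ennreal (real (c + p) * (1 / real m)) + ennreal (real (c + q) * (1 - 1 / real m))"
    using assms by (simp only: ennreal_of_nat_eq_real_of_nat ennreal_mult' of_nat_0_le_iff)
  also have "\<dots> = ennreal (real (c + p) * (1 / real m) + real (c + q) * (1 - 1 / real m))"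
    using assms by (intro ennreal_plus[symmetric] mult_nonneg_nonneg) auto
  also have "\<dots> \<le> ennreal (real c + (real q + real p / real m))"
    using assms by (intro ennreal_leI) (simp add: field_simps)
  also have "\<dots> = of_nat c + ennreal (real q + real p / real m)"
    by (subst ennreal_plus) (auto simp: ennreal_of_nat_eq_real_of_nat)
  finally show ?thesis
    by (simp add: nn_integral_pair_pmf' measure_pmf.emeasure_space_1[simplified])
qed

context mm_problem
begin

lemma saga_expected_cost:
  "(\<integral>\<^sup>+(x, c). of_nat c \<partial>map_pmf (\<lambda>(x, w, c). (x, c)) (mm_saga n f u L b x0 k))
    \<le> ennreal (real k * real b)"
proof -
  have "(\<integral>\<^sup>+s. of_nat (snd (snd s)) \<partial>mm_saga n f u L b x0 k) \<le> ennreal (real k * real b)"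
  proof (rule chain_expected_cost[where step = "saga_step n f u L b" and ?s0.0 = "(x0, \<lambda>i. x0, 0)"])
    fix s :: "'a \<times> (nat \<Rightarrow> 'a) \<times> nat"
    show "(\<integral>\<^sup>+s'. of_nat (snd (snd s')) \<partial>saga_step n f u L b s)
        \<le> of_nat (snd (snd s)) + ennreal (real b)"
      by (cases s) (simp add: saga_step_eq measure_pmf.emeasure_space_1[simplified]
          ennreal_of_nat_eq_real_of_nat)
  qed simp_all
  then show ?thesis by (simp add: case_prod_beta)
qed

lemma svrg_expected_cost:
  assumes "1 \<le> m"
  shows "(\<integral>\<^sup>+(x, c). of_nat c \<partial>map_pmf (\<lambda>(x, y, c). (x, c)) (mm_svrg n f u L b m x0 k))
    \<le> ennreal (real k * (2 * real b + real n / real m))"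
proof -
  have "(\<integral>\<^sup>+s. of_nat (snd (snd s)) \<partial>mm_svrg n f u L b m x0 k)
      \<le> ennreal (real k * (2 * real b + real n / real m))"
  proof (rule chain_expected_cost[where step = "svrg_step n f u L b m" and ?s0.0 = "(x0, x0, 0)"])
    fix s :: "'a \<times> 'a \<times> nat"
    obtain x y c where s: "s = (x, y, c)" by (cases s)
    have "(\<integral>\<^sup>+s'. of_nat (snd (snd s')) \<partial>svrg_step n f u L b m s)
        = (\<integral>\<^sup>+\<omega>. of_nat (c + 2 * b + (if snd \<omega> then n else 0))
            \<partial>pair_pmf (batch_pmf n b) (bernoulli_pmf (1 / real m)))"
      unfolding s svrg_step_eq nn_integral_map_pmf case_prod_beta snd_conv ..
    also have "\<dots> \<le> of_nat (c + 2 * b) + ennreal (real 0 + real n / real m)"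
      by (rule nn_integral_bernoulli_cost[OF assms])
    also have "\<dots> = of_nat c + ennreal (2 * real b + real n / real m)"
      by (subst ennreal_plus) (auto simp: ennreal_of_nat_eq_real_of_nat add.assoc ennreal_plus)
    finally show "(\<integral>\<^sup>+s'. of_nat (snd (snd s')) \<partial>svrg_step n f u L b m s)
        \<le> of_nat (snd (snd s)) + ennreal (2 * real b + real n / real m)" by (simp add: s)
  qed simp_all
  then show ?thesis by (simp add: case_prod_beta)
qed

lemma sarah_expected_cost:
  assumes "1 \<le> m"
  shows "(\<integral>\<^sup>+(x, c). of_nat c \<partial>map_pmf (\<lambda>(x, xp, g, c). (x, c)) (mm_sarah n f u L b m x0 k))
    \<le> ennreal (real k * (2 * real b + real n / real m))"
proof -
  have "(\<integral>\<^sup>+s. of_nat (snd (snd (snd s))) \<partial>mm_sarah n f u L b m x0 k)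
      \<le> ennreal (real k * (2 * real b + real n / real m))"
  proof (rule chain_expected_cost[where step = "sarah_step n f u L b m"
        and ?s0.0 = "(x0, x0, grad x0, 0)"])
    fix s :: "'a \<times> 'a \<times> 'a \<times> nat"
    obtain x y g c where s: "s = (x, y, g, c)" by (cases s)
    have "(\<integral>\<^sup>+s'. of_nat (snd (snd (snd s'))) \<partial>sarah_step n f u L b m s)
        = (\<integral>\<^sup>+\<omega>. of_nat (c + (if snd \<omega> then n else 2 * b))
            \<partial>pair_pmf (batch_pmf n b) (bernoulli_pmf (1 / real m)))"
      unfolding s sarah_step_eq nn_integral_map_pmf case_prod_beta Let_def snd_conv ..
    also have "\<dots> \<le> of_nat c + ennreal (real (2 * b) + real n / real m)"
      by (rule nn_integral_bernoulli_cost[OF assms])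
    finally show "(\<integral>\<^sup>+s'. of_nat (snd (snd (snd s'))) \<partial>sarah_step n f u L b m s)
        \<le> of_nat (snd (snd (snd s))) + ennreal (2 * real b + real n / real m)" by (simp add: s)
  qed simp_all
  then show ?thesis by (simp add: case_prod_beta)
qed

end

lemma saga_factor_exists: "1 \<le> n \<Longrightarrow> 1 \<le> saga_batch n \<Longrightarrow> \<exists>t. saga_factor n (saga_batch n) t"
  using saga_factor_small[of n] saga_factor_large[of n] by (cases "n \<le> 24") auto

theorem corollary4p16:
  shows
    "complexity_bigo
       (\<lambda>n f u L (x0 :: real ^ 'd) k.
          map_pmf (\<lambda>(x, w, c). (x, c)) (mm_saga n f u L (saga_batch n) x0 k))
       (\<lambda>n. 1 \<le> saga_batch n)
       (\<lambda>n. real n powr (2/3)) \<and>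
     complexity_bigo
       (\<lambda>n f u L (x0 :: real ^ 'd) k.
          map_pmf (\<lambda>(x, y, c). (x, c)) (mm_svrg n f u L (svrg_batch n) (svrg_period n) x0 k))
       (\<lambda>n. 1 \<le> svrg_batch n \<and> 1 \<le> svrg_period n)
       (\<lambda>n. real n powr (2/3)) \<and>
     complexity_bigo
       (\<lambda>n f u L (x0 :: real ^ 'd) k.
          map_pmf (\<lambda>(x, xp, g, c). (x, c)) (mm_sarah n f u L (sarah_batch n) (sarah_period n) x0 k))
       (\<lambda>n. 1 \<le> sarah_batch n \<and> 1 \<le> sarah_period n)
       (\<lambda>n. real n powr (1/2))"
proof (intro conjI)
  show "complexity_bigo
       (\<lambda>n f u L (x0 :: real ^ 'd) k.
          map_pmf (\<lambda>(x, w, c). (x, c)) (mm_saga n f u L (saga_batch n) x0 k))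
       (\<lambda>n. 1 \<le> saga_batch n)
       (\<lambda>n. real n powr (2/3))"
  proof (rule complexity_bigoI[where \<gamma> = 18])
    fix n f u L and r :: "real ^ 'd \<Rightarrow> ereal" and x0 and \<Omega> Lu N
    assume s: "mm_setting n f r u L" and b: "1 \<le> saga_batch n"
      and h: "r x0 < \<infinity>" "subdiff_constant_on r u \<Omega> Lu"
        "\<And>k. k \<le> N \<Longrightarrow>
          fst ` set_pmf (map_pmf (\<lambda>(x, w, c). (x, c)) (mm_saga n f u L (saga_batch n) x0 k)) \<subseteq> \<Omega>"
    interpret mm_problem n f r u L by unfold_locales (rule s)
    obtain t where "saga_factor n (saga_batch n) t" using saga_factor_exists[OF n_ge_1 b] by blast
    then show "(\<Sum>k=1..N. expected_dist_sq (objective n f r)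
        (\<lambda>k. map_pmf (\<lambda>(x, w, c). (x, c)) (mm_saga n f u L (saga_batch n) x0 k)) k)
      \<le> ennreal (250 * dist_factor L Lu * initial_gap n f r x0)"
      by (rule saga_sum_dist[OF b _ h])
  next
    fix n f u L and r :: "real ^ 'd \<Rightarrow> ereal" and x0 and k
    assume s: "mm_setting n f r u L" and b: "1 \<le> saga_batch n"
    interpret mm_problem n f r u L by unfold_locales (rule s)
    show "(\<integral>\<^sup>+(x, c). of_nat c
        \<partial>map_pmf (\<lambda>(x, w, c). (x, c)) (mm_saga n f u L (saga_batch n) x0 k))
      \<le> ennreal (real k * (18 * real n powr (2/3)))"
      using saga_cost_bound[OF b]
      by (intro order_trans[OF saga_expected_cost] ennreal_leI mult_left_mono) auto
  qed simp_all
next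
  show "complexity_bigo
       (\<lambda>n f u L (x0 :: real ^ 'd) k.
          map_pmf (\<lambda>(x, y, c). (x, c)) (mm_svrg n f u L (svrg_batch n) (svrg_period n) x0 k))
       (\<lambda>n. 1 \<le> svrg_batch n \<and> 1 \<le> svrg_period n)
       (\<lambda>n. real n powr (2/3))"
  proof (rule complexity_bigoI[where \<gamma> = 18])
    fix n f u L and r :: "real ^ 'd \<Rightarrow> ereal" and x0 and \<Omega> Lu N
    assume s: "mm_setting n f r u L" and b: "1 \<le> svrg_batch n \<and> 1 \<le> svrg_period n"
      and h: "r x0 < \<infinity>" "subdiff_constant_on r u \<Omega> Lu"
        "\<And>k. k \<le> N \<Longrightarrow> fst ` set_pmf (map_pmf (\<lambda>(x, y, c). (x, c))
          (mm_svrg n f u L (svrg_batch n) (svrg_period n) x0 k)) \<subseteq> \<Omega>"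
    interpret mm_problem n f r u L by unfold_locales (rule s)
    show "(\<Sum>k=1..N. expected_dist_sq (objective n f r) (\<lambda>k. map_pmf (\<lambda>(x, y, c). (x, c))
        (mm_svrg n f u L (svrg_batch n) (svrg_period n) x0 k)) k)
      \<le> ennreal (250 * dist_factor L Lu * initial_gap n f r x0)"
      using b by (intro svrg_sum_dist[OF _ _ svrg_period_square h]) auto
  next
    fix n f u L and r :: "real ^ 'd \<Rightarrow> ereal" and x0 and k
    assume s: "mm_setting n f r u L" and b: "1 \<le> svrg_batch n \<and> 1 \<le> svrg_period n"
    interpret mm_problem n f r u L by unfold_locales (rule s)
    show "(\<integral>\<^sup>+(x, c). of_nat c \<partial>map_pmf (\<lambda>(x, y, c). (x, c))
        (mm_svrg n f u L (svrg_batch n) (svrg_period n) x0 k))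
      \<le> ennreal (real k * (18 * real n powr (2/3)))"
      using svrg_cost_bound b
      by (intro order_trans[OF svrg_expected_cost] ennreal_leI mult_left_mono) auto
  qed simp_all
next
  show "complexity_bigo
       (\<lambda>n f u L (x0 :: real ^ 'd) k.
          map_pmf (\<lambda>(x, xp, g, c). (x, c)) (mm_sarah n f u L (sarah_batch n) (sarah_period n) x0 k))
       (\<lambda>n. 1 \<le> sarah_batch n \<and> 1 \<le> sarah_period n)
       (\<lambda>n. real n powr (1/2))"
  proof (rule complexity_bigoI[where \<gamma> = 18])
    fix n f u L and r :: "real ^ 'd \<Rightarrow> ereal" and x0 and \<Omega> Lu N
    assume s: "mm_setting n f r u L" and b: "1 \<le> sarah_batch n \<and> 1 \<le> sarah_period n"
      and h: "r x0 < \<infinity>" "subdiff_constant_on r u \<Omega> Lu"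
        "\<And>k. k \<le> N \<Longrightarrow> fst ` set_pmf (map_pmf (\<lambda>(x, xp, g, c). (x, c))
          (mm_sarah n f u L (sarah_batch n) (sarah_period n) x0 k)) \<subseteq> \<Omega>"
    interpret mm_problem n f r u L by unfold_locales (rule s)
    show "(\<Sum>k=1..N. expected_dist_sq (objective n f r) (\<lambda>k. map_pmf (\<lambda>(x, xp, g, c). (x, c))
        (mm_sarah n f u L (sarah_batch n) (sarah_period n) x0 k)) k)
      \<le> ennreal (250 * dist_factor L Lu * initial_gap n f r x0)"
      using b by (intro sarah_sum_dist[OF _ sarah_period_le h]) auto
  next
    fix n f u L and r :: "real ^ 'd \<Rightarrow> ereal" and x0 and k
    assume s: "mm_setting n f r u L" and b: "1 \<le> sarah_batch n \<and> 1 \<le> sarah_period n"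
    interpret mm_problem n f r u L by unfold_locales (rule s)
    show "(\<integral>\<^sup>+(x, c). of_nat c \<partial>map_pmf (\<lambda>(x, xp, g, c). (x, c))
        (mm_sarah n f u L (sarah_batch n) (sarah_period n) x0 k))
      \<le> ennreal (real k * (18 * real n powr (1/2)))"
      using sarah_cost_bound b
      by (intro order_trans[OF sarah_expected_cost] ennreal_leI mult_left_mono) auto
  qed simp_all
qed

end
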